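(* Let $r>1$ be real and let $f:I\to I$ be a $\mathcal{C}^r$ map such that $h_{\rm top}(f)>\frac{R(f)}{r}$. For any $\varepsilon>0$ there exist $\delta>0$ and $\eta>0$ such that for any $f$-ergodic measure $\mu$ with $h_f(\mu)\ge h_{\rm top}(f)-\delta$, $$\int_{\{x:\,|f'(x)|<\eta\}}-\log|f'|\,d\mu<\varepsilon.$$
   Context: $I$ denotes the interval $[0,1]$ or the circle $\mathbb{S}^1$. For real $r>1$, a map $g:I\to I$ is $\mathcal{C}^r$ if it is $\mathcal{C}^{\lfloor r\rfloor}$ and $g^{(\lfloor r\rfloor)}$ is $(r-\lfloor r\rfloor)$-Hölder. An $f$-ergodic measure is an $f$-invariant ergodic Borel probability measure. $h_f(\mu)$ is metric entropy and $h_{\rm top}(f)$ topological entropy. $R(f):=\lim_{n\to\infty}\frac1n\log^+\|(f^n)'\|_\infty$, where $\log^+=\max\{0,\log\}$ and $\|\cdot\|_\infty$ is the supremum over $I$. *)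

theory Defs
  imports "HOL-Probability.Probability"
begin

section \<open>Maps of class C^r on the interval and on the circle\<close>

text \<open>Derivatives are taken within the domain D, hence one-sided at the endpoints of an interval,
  and depend only on the values of the function on D.\<close>

definition deriv_within :: "real set \<Rightarrow> (real \<Rightarrow> real) \<Rightarrow> real \<Rightarrow> real" where
  "deriv_within D F x = vector_derivative F (at x within D)"

definition C_k_on :: "real set \<Rightarrow> nat \<Rightarrow> (real \<Rightarrow> real) \<Rightarrow> bool" where
  "C_k_on D k F \<longleftrightarrow>
     (\<forall>i<k. (deriv_within D ^^ i) F differentiable_on D) \<and>
     continuous_on D ((deriv_within D ^^ k) F)"

definition Hoelder_on :: "real set \<Rightarrow> real \<Rightarrow> (real \<Rightarrow> real) \<Rightarrow> bool" where
  "Hoelder_on D \<alpha> G \<longleftrightarrow>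
     (\<exists>C. \<forall>x\<in>D. \<forall>y\<in>D. \<bar>G x - G y\<bar> \<le> C * \<bar>x - y\<bar> powr \<alpha>)"

text \<open>If r is an integer, the exponent below is 0 and the Hoelder condition says that the
  oscillation of the last derivative is bounded, which is automatic on the interval and for lifts
  of circle maps: then C^r has its usual meaning.\<close>

definition C_r_on :: "real set \<Rightarrow> real \<Rightarrow> (real \<Rightarrow> real) \<Rightarrow> bool" where
  "C_r_on D r F \<longleftrightarrow>
     C_k_on D (nat \<lfloor>r\<rfloor>) F \<and>
     Hoelder_on D (r - of_int \<lfloor>r\<rfloor>) ((deriv_within D ^^ nat \<lfloor>r\<rfloor>) F)"

definition C_r_interval_map :: "real \<Rightarrow> (real \<Rightarrow> real) \<Rightarrow> bool" where
  "C_r_interval_map r f \<longleftrightarrow> f \<in> {0..1} \<rightarrow> {0..1} \<and> C_r_on {0..1} r f"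

abbreviation interval_deriv :: "(real \<Rightarrow> real) \<Rightarrow> real \<Rightarrow> real" where
  "interval_deriv \<equiv> deriv_within {0..1}"

text \<open>The circle is the unit circle of the complex plane, parametrised by t \<open>\<mapsto>\<close> exp(2 pi i t),
  that is, R/Z. Smoothness and the derivative of a circle map are those of its lifts to R.\<close>

abbreviation circle :: "complex set" where
  "circle \<equiv> sphere 0 1"

definition circle_lift :: "(complex \<Rightarrow> complex) \<Rightarrow> (real \<Rightarrow> real) \<Rightarrow> bool" where
  "circle_lift f F \<longleftrightarrow>
     continuous_on UNIV F \<and> (\<forall>t. f (cis (2 * pi * t)) = cis (2 * pi * F t))"

definition C_r_circle_map :: "real \<Rightarrow> (complex \<Rightarrow> complex) \<Rightarrow> bool" where
  "C_r_circle_map r f \<longleftrightarrow>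
     f \<in> circle \<rightarrow> circle \<and> (\<exists>F. circle_lift f F \<and> C_r_on UNIV r F)"

definition circle_deriv :: "(complex \<Rightarrow> complex) \<Rightarrow> complex \<Rightarrow> real" where
  "circle_deriv f z =
     (THE d. \<exists>F t. circle_lift f F \<and> z = cis (2 * pi * t) \<and> (F has_real_derivative d) (at t))"

lemma cis_2pi_eq_imp:
  assumes "cis (2 * pi * a) = cis (2 * pi * b)"
  shows "\<exists>n::int. a = b + of_int n"
proof -
  have "sin (2 * pi * a) = sin (2 * pi * b) \<and> cos (2 * pi * a) = cos (2 * pi * b)"
    using assms by (simp add: complex_eq_iff)
  then obtain n :: int where "2 * pi * a = 2 * pi * b + 2 * pi * of_int n"
    unfolding sin_cos_eq_iff by auto
  then have "2 * pi * (a - (b + of_int n)) = 0" by (simp add: algebra_simps)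
  then show ?thesis by auto
qed

lemma cis_2pi_add_int: "cis (2 * pi * (u + of_int k)) = cis (2 * pi * u)"
proof -
  have "cis (2 * pi * (u + of_int k)) = cis (2 * pi * u) * cis (2 * pi * of_int k)"
    by (simp add: cis_mult algebra_simps)
  then show ?thesis by simp
qed

text \<open>The derivative of a circle map does not depend on the choice of the lift.\<close>

lemma circle_deriv_eq:
  assumes F: "circle_lift f F" and D: "(F has_real_derivative d) (at t)"
  shows "circle_deriv f (cis (2 * pi * t)) = d"
  unfolding circle_deriv_def
proof (rule the_equality)
  fix e assume "\<exists>G s. circle_lift f G \<and> cis (2 * pi * t) = cis (2 * pi * s) \<and>
    (G has_real_derivative e) (at s)"
  then obtain G s where G: "circle_lift f G" and ts: "cis (2 * pi * t) = cis (2 * pi * s)"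
    and E: "(G has_real_derivative e) (at s)" by blast
  obtain k :: int where k: "t = s + of_int k" using cis_2pi_eq_imp[OF ts] by blast
  define H where "H u = F (u + of_int k) - G u" for u
  have int: "\<exists>n::int. H u = of_int n" for u
  proof -
    have "cis (2 * pi * F (u + of_int k)) = cis (2 * pi * G u)"
    proof -
      have "cis (2 * pi * F (u + of_int k)) = f (cis (2 * pi * (u + of_int k)))"
        using F unfolding circle_lift_def by (blast intro: sym)
      also have "\<dots> = f (cis (2 * pi * u))" by (simp only: cis_2pi_add_int)
      also have "\<dots> = cis (2 * pi * G u)" using G unfolding circle_lift_def by blast
      finally show ?thesis .
    qed
    from cis_2pi_eq_imp[OF this] show ?thesis unfolding H_def by auto
  qed
  have Fc: "continuous_on UNIV F" and Gc: "continuous_on UNIV G"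
    using F G unfolding circle_lift_def by blast+
  have "continuous_on UNIV (\<lambda>u::real. u + of_int k)"
    by (intro continuous_intros)
  then have "continuous_on UNIV (\<lambda>u. F (u + of_int k))"
    by (rule continuous_on_compose2[OF Fc]) simp
  then have cont: "continuous_on UNIV H"
    unfolding H_def using Gc by (rule continuous_on_diff)
  have "H constant_on UNIV"
  proof (rule continuous_discrete_range_constant[OF connected_UNIV cont])
    fix x
    have "1 \<le> norm (H y - H x)" if "H y \<noteq> H x" for y
    proof -
      obtain m n :: int where "H y = of_int m" "H x = of_int n" using int by metis
      moreover from this that have "1 \<le> \<bar>m - n\<bar>" by auto
      then have "(1::real) \<le> of_int \<bar>m - n\<bar>" by linarith
      ultimately show ?thesis by simp
    qed
    then show "\<exists>e>0. \<forall>y. y \<in> UNIV \<and> H y \<noteq> H x \<longrightarrow> e \<le> norm (H y - H x)"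
      by (intro exI[of _ 1]) auto
  qed
  then obtain c where c: "\<And>u. H u = c" unfolding constant_on_def by auto
  have "((\<lambda>u. F (u + of_int k)) has_real_derivative d) (at s)"
    using D unfolding k by (simp add: DERIV_shift)
  moreover have "((\<lambda>u. G u + c) has_real_derivative e) (at s)"
    using E by (auto intro!: derivative_eq_intros)
  moreover have "(\<lambda>u. F (u + of_int k)) = (\<lambda>u. G u + c)"
    using c unfolding H_def by (auto simp: algebra_simps)
  ultimately show "e = d" using DERIV_unique by metis
qed (use F D in blast)

text \<open>The rate R(f). The parameter df is the derivative operator on the space I
  (\<open>interval_deriv\<close> or \<open>circle_deriv\<close>). Since \<open>ln 0 = 0\<close>, the formula is right also when
  some iterate has zero derivative.\<close>

definition deriv_growth_rate :: "'a set \<Rightarrow> (('a \<Rightarrow> 'a) \<Rightarrow> 'a \<Rightarrow> real) \<Rightarrow> ('a \<Rightarrow> 'a) \<Rightarrow> real" where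
  "deriv_growth_rate I df f =
     lim (\<lambda>n. 1 / real n * max 0 (ln (SUP x\<in>I. \<bar>df (f ^^ n) x\<bar>)))"

section \<open>Topological entropy\<close>

text \<open>Bowen's definition, by (n, e)-separated sets.\<close>

definition separated_set :: "'a::metric_space set \<Rightarrow> ('a \<Rightarrow> 'a) \<Rightarrow> nat \<Rightarrow> real \<Rightarrow> 'a set \<Rightarrow> bool" where
  "separated_set X f n e E \<longleftrightarrow>
     E \<subseteq> X \<and> (\<forall>x\<in>E. \<forall>y\<in>E. x \<noteq> y \<longrightarrow> (\<exists>k<n. dist ((f ^^ k) x) ((f ^^ k) y) > e))"

definition topological_entropy :: "'a::metric_space set \<Rightarrow> ('a \<Rightarrow> 'a) \<Rightarrow> ereal" where
  "topological_entropy X f =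
     (SUP e\<in>{0<..}. limsup (\<lambda>n.
        (SUP E\<in>{E. finite E \<and> E \<noteq> {} \<and> separated_set X f n e E}. ereal (ln (real (card E))))
          / ereal (real n)))"

section \<open>Ergodic measures and metric entropy\<close>

definition ergodic_measure_on :: "'a::topological_space set \<Rightarrow> ('a \<Rightarrow> 'a) \<Rightarrow> 'a measure \<Rightarrow> bool" where
  "ergodic_measure_on X f \<mu> \<longleftrightarrow>
     space \<mu> = X \<and> sets \<mu> = sets (restrict_space borel X) \<and> prob_space \<mu> \<and>
     f \<in> measurable \<mu> \<mu> \<and> distr \<mu> \<mu> f = \<mu> \<and>
     (\<forall>A\<in>sets \<mu>. f -` A \<inter> space \<mu> = A \<longrightarrow> measure \<mu> A = 0 \<or> measure \<mu> A = 1)"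

definition finite_measurable_partition :: "'a measure \<Rightarrow> 'a set set \<Rightarrow> bool" where
  "finite_measurable_partition \<mu> P \<longleftrightarrow> finite P \<and> P \<subseteq> sets \<mu> \<and> partition_on (space \<mu>) P"

definition partition_entropy :: "'a measure \<Rightarrow> 'a set set \<Rightarrow> real" where
  "partition_entropy \<mu> P = - (\<Sum>A\<in>P. measure \<mu> A * ln (measure \<mu> A))"

text \<open>The join of the preimages of P under the iterates of f of order 0, ..., n - 1.\<close>

definition iterated_partition :: "'a set \<Rightarrow> ('a \<Rightarrow> 'a) \<Rightarrow> 'a set set \<Rightarrow> nat \<Rightarrow> 'a set set" where
  "iterated_partition X f P n =
     {B. B \<noteq> {} \<and> (\<exists>A. (\<forall>i<n. A i \<in> P) \<and> B = {x\<in>X. \<forall>i<n. (f ^^ i) x \<in> A i})}"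

definition metric_entropy :: "'a measure \<Rightarrow> ('a \<Rightarrow> 'a) \<Rightarrow> ereal" where
  "metric_entropy \<mu> f =
     (SUP P\<in>{P. finite_measurable_partition \<mu> P}.
        ereal (lim (\<lambda>n. partition_entropy \<mu> (iterated_partition (space \<mu>) f P n) / real n)))"

section \<open>Integrals of extended real functions\<close>

text \<open>The logarithm with \<open>log 0 = - \<infinity>\<close>, unlike \<open>ln\<close>.\<close>

definition ext_log :: "real \<Rightarrow> ereal" where
  "ext_log x = (if x = 0 then - \<infinity> else ereal (ln x))"

text \<open>Integral of the positive part minus integral of the negative part; \<open>e2ennreal\<close> maps
  negative numbers to 0.\<close>

definition ext_integral :: "'a measure \<Rightarrow> ('a \<Rightarrow> ereal) \<Rightarrow> ereal" where
  "ext_integral \<mu> \<phi> =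
     enn2ereal (\<integral>\<^sup>+ x. e2ennreal (\<phi> x) \<partial>\<mu>) - enn2ereal (\<integral>\<^sup>+ x. e2ennreal (- \<phi> x) \<partial>\<mu>)"

definition ext_set_integral :: "'a measure \<Rightarrow> 'a set \<Rightarrow> ('a \<Rightarrow> ereal) \<Rightarrow> ereal" where
  "ext_set_integral \<mu> A \<phi> = ext_integral \<mu> (\<lambda>x. if x \<in> A then \<phi> x else 0)"

end

theory Submission
  imports Defs
begin

text \<open>Write \<open>\<kappa> = 1 / (r - 1)\<close>. A piece of curve of size d in the region \<open>\<bar>f'\<bar> \<approx> e\<^sup>-\<^sup>k\<close> is cut
  into about \<open>e\<^sup>\<kappa>\<^sup>k\<close> monotone pieces of size \<open>d e\<^sup>-\<^sup>\<kappa>\<^sup>k\<close>, because f' is there close to a polynomial of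
  degree less than r; their images have size \<open>d e\<^sup>-\<^sup>(\<^sup>1\<^sup>+\<^sup>\<kappa>\<^sup>)\<^sup>k\<close>. After a deep passage near the
  critical set only critical steps require cutting until the pieces have recovered the original size, and
  since derivatives grow at rate at most R, such a bad block with levels of sum a has length at least
  \<open>(1 + \<kappa>) a / R\<close>. It therefore costs entropy \<open>\<kappa> a\<close>, at most \<open>\<kappa> / (1 + \<kappa>) = 1 / r\<close> times R per unit of time,
  instead of the topological entropy h. A measure which spends a fraction \<open>\<beta>\<close> of the time in bad blocks
  has entropy at most \<open>(1 - \<beta>) h + \<beta> R / r\<close> up to a small error. If its entropy is close to \<open>h > R / r\<close>
  then \<open>\<beta>\<close> is small, and so is the integral of \<open>- log \<bar>f'\<bar>\<close> over the deep part of the critical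
  region.\<close>

text \<open>Entropy is bounded by the mean length of a code for itineraries (Gibbs' inequality). The
  code of a point first gives its tag, that is, its critical levels and the ends of its bad blocks,
  and then its grid name among the points with the same tag. Good runs are counted by spanning sets,
  which brings in h; cutting takes over in bad blocks. All constants are charged to levels: those
  paid at each critical step to levels at least \<open>K0\<close>, those paid for each block to
  levels at least \<open>K1\<close>. The obstacle is the order of choices. The constants of a block
  depend on the scale, which depends on \<open>K0\<close>, so \<open>K1\<close> lies far above
  \<open>K0\<close>; critical steps with levels in between start no block but still cost \<kappa>
  times their level. To make this loss small for every measure, J successive windows of levels are
  fixed in advance. Ruelle's inequality bounds the mean level by \<open>ln \<Lambda>\<close>, so
  some window has mean at most \<open>ln \<Lambda> / J\<close>. The length of an unfinished block is
  not bounded. It is controlled in the mean by maximal Birkhoff sums of \<open>psi\<close>, provided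
  that \<open>psi\<close> has positive mean; otherwise the Lyapunov exponent is at most R / r up to
  a small error, which contradicts the large entropy.\<close>

lemma subadditive_mult_le:
  fixes a :: "nat \<Rightarrow> real"
  assumes sub: "\<And>m n. a (m + n) \<le> a m + a n" and a0: "a 0 = 0"
  shows "a (q * m) \<le> real q * a m"
proof (induction q)
  case (Suc q)
  have "a (Suc q * m) \<le> a m + a (q * m)" using sub[of m "q * m"] by simp
  then show ?case using Suc by (simp add: algebra_simps)
qed (use a0 in simp)

text \<open>The entropy along a partition and the rate \<open>R\<close> are defined by
  \<open>lim\<close>, which says nothing without convergence. The second part lets a single n bound
  the limit from above.\<close>

lemma fekete:
  fixes a :: "nat \<Rightarrow> real"
  assumes sub: "\<And>m n. a (m + n) \<le> a m + a n" and nonneg: "\<And>n. 0 \<le> a n" and a0: "a 0 = 0"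
  defines "L \<equiv> INF n\<in>{1..}. a n / real n"
  shows "(\<lambda>n. a n / real n) \<longlonglongrightarrow> L" and "\<And>n. n \<ge> 1 \<Longrightarrow> L \<le> a n / real n"
proof -
  have bdd: "bdd_below ((\<lambda>n. a n / real n) ` {1..})"
    using nonneg by (intro bdd_belowI2[where m = 0]) simp
  show le: "L \<le> a n / real n" if "n \<ge> 1" for n
    unfolding L_def using that by (intro cINF_lower[OF bdd]) auto
  show "(\<lambda>n. a n / real n) \<longlonglongrightarrow> L"
  proof (rule LIMSEQ_I)
    fix e :: real assume e: "e > 0"
    have "\<exists>m\<in>{1..}. a m / real m < L + e / 2"
      using cINF_less_iff[OF _ bdd, of "L + e / 2"] e unfolding L_def by auto
    then obtain m where m: "m \<ge> 1" "a m / real m < L + e / 2" by auto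
    define B where "B = Max (a ` {..<m})"
    have B: "a k \<le> B" if "k < m" for k unfolding B_def using that by (intro Max_ge) auto
    obtain N where N: "real N > 2 * B / e" "N \<ge> 1"
      by (metis reals_Archimedean2 max.cobounded1 max.cobounded2 less_le_trans of_nat_le_iff)
    show "\<exists>no. \<forall>n\<ge>no. norm (a n / real n - L) < e"
    proof (intro exI[of _ N] allI impI)
      fix n assume n: "N \<le> n"
      then have n1: "n \<ge> 1" using N by linarith
      define q where "q = n div m"
      define k where "k = n mod m"
      have k: "k < m" "n = q * m + k" using m by (auto simp: q_def k_def)
      have "a n \<le> a (q * m) + a k" using sub k by simp
      also have "\<dots> \<le> real q * a m + B"
        using subadditive_mult_le[of a, OF sub a0, of q m] B[OF k(1)] by linarith
      finally have "a n \<le> real q * a m + B" .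
      moreover have "real q * a m \<le> real n * (a m / real m)"
      proof -
        have "real q * a m = real (q * m) * (a m / real m)" using m by simp
        also have "\<dots> \<le> real n * (a m / real m)"
          using k nonneg[of m] by (intro mult_right_mono) (simp_all del: of_nat_mult)
        finally show ?thesis .
      qed
      ultimately have "a n / real n \<le> a m / real m + B / real n"
        using n1 by (simp add: field_simps)
      moreover have "B / real n < e / 2"
      proof -
        have "2 * B / e < real n" using N n by (meson less_le_trans of_nat_mono)
        then show ?thesis using e n1 by (simp add: field_simps)
      qed
      ultimately have "a n / real n < L + e" using m by linarith
      then show "norm (a n / real n - L) < e" using le[OF n1] by simp
    qed
  qed
qed

text \<open>A Kraft inequality: the first letter and the rest of a word factor. The alphabet may be
  infinite, so the total mass is measured on finite subsets.\<close>

lemma sum_prod_list_le_1: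
  fixes q :: "'s \<Rightarrow> real"
  assumes nonneg: "\<And>s. 0 \<le> q s" and le1: "\<And>S. finite S \<Longrightarrow> sum q S \<le> 1"
  shows "finite S \<Longrightarrow> (\<And>T. T \<in> S \<Longrightarrow> length T = n) \<Longrightarrow> (\<Sum>T\<in>S. prod_list (map q T)) \<le> 1"
proof (induction n arbitrary: S)
  case 0
  then have "S \<subseteq> {[]}" by auto
  then have "(\<Sum>T\<in>S. prod_list (map q T)) \<le> (\<Sum>T\<in>{[]}. prod_list (map q T))"
    by (intro sum_mono2) (auto intro!: prod_list_nonneg nonneg)
  then show ?case by simp
next
  case (Suc n)
  have "S \<subseteq> (\<lambda>(s,T). s # T) ` (hd ` S \<times> tl ` S)"
  proof
    fix T assume T: "T \<in> S"
    then have "T = hd T # tl T" using Suc.prems(2)[OF T] by (cases T) auto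
    then show "T \<in> (\<lambda>(s,T). s # T) ` (hd ` S \<times> tl ` S)" using T by force
  qed
  then have "(\<Sum>T\<in>S. prod_list (map q T)) \<le> (\<Sum>T\<in>(\<lambda>(s,T). s # T) ` (hd ` S \<times> tl ` S). prod_list (map q T))"
    using Suc.prems(1) by (intro sum_mono2) (auto intro!: prod_list_nonneg mult_nonneg_nonneg nonneg)
  also have "\<dots> = (\<Sum>(s,T)\<in>hd ` S \<times> tl ` S. q s * prod_list (map q T))"
    by (subst sum.reindex) (auto simp: inj_on_def case_prod_unfold)
  also have "\<dots> = (\<Sum>s\<in>hd ` S. q s) * (\<Sum>T\<in>tl ` S. prod_list (map q T))"
    by (simp add: sum_product sum.cartesian_product)
  also have "\<dots> \<le> 1 * 1"
    using Suc.prems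
    by (intro mult_mono le1 Suc.IH sum_nonneg) (auto intro!: prod_list_nonneg nonneg simp: finite_imageI)
  finally show ?case by simp
qed

section \<open>Counting values of integer functions and names of monotone orbits\<close>

lemma card_int_near:
  fixes f :: "'a \<Rightarrow> int"
  assumes "0 \<le> d" and "\<And>x y. x \<in> A \<Longrightarrow> y \<in> A \<Longrightarrow> \<bar>real_of_int (f x) - real_of_int (f y)\<bar> \<le> d"
  shows "finite (f ` A)" and "real (card (f ` A)) \<le> d + 1"
proof -
  have "finite (f ` A) \<and> real (card (f ` A)) \<le> d + 1"
  proof (cases "A = {}")
    case False
    then obtain a where a: "a \<in> A" by auto
    have bdd: "f x \<ge> f a - \<lceil>d\<rceil>" "f x \<le> f a + \<lceil>d\<rceil>" if "x \<in> A" for x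
      using assms(2)[OF that a] by linarith+
    have fin: "finite (f ` A)"
      by (rule finite_subset[of _ "{f a - \<lceil>d\<rceil>..f a + \<lceil>d\<rceil>}"]) (use bdd in auto)
    \<comment> \<open>Measuring from the minimum, not from an arbitrary value, gives d + 1 instead
      of 2 d + 1.\<close>
    define m where "m = Min (f ` A)"
    have "m \<in> f ` A" unfolding m_def using fin False by (intro Min_in) auto
    then obtain b where b: "b \<in> A" "f b = m" by auto
    have "f ` A \<subseteq> {m..m + \<lfloor>d\<rfloor>}"
    proof
      fix y assume "y \<in> f ` A"
      then obtain x where x: "x \<in> A" "y = f x" by auto
      have "m \<le> y" unfolding m_def using fin x by auto
      moreover have "y \<le> m + \<lfloor>d\<rfloor>" using assms(2)[OF x(1) b(1)] b x by linarith
      ultimately show "y \<in> {m..m + \<lfloor>d\<rfloor>}" by simp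
    qed
    then have "card (f ` A) \<le> card {m..m + \<lfloor>d\<rfloor>}" by (intro card_mono) auto
    also have "\<dots> = nat (\<lfloor>d\<rfloor> + 1)" by simp
    finally have "real (card (f ` A)) \<le> d + 1" using assms(1) by linarith
    then show ?thesis using fin by simp
  qed (use assms(1) in simp)
  then show "finite (f ` A)" "real (card (f ` A)) \<le> d + 1" by auto
qed

lemma card_floor_near:
  fixes f :: "'a \<Rightarrow> real"
  assumes "0 \<le> d" and "\<And>x y. x \<in> A \<Longrightarrow> y \<in> A \<Longrightarrow> \<bar>f x - f y\<bar> \<le> d"
  shows "finite ((\<lambda>x. \<lfloor>f x\<rfloor>) ` A)" and "real (card ((\<lambda>x. \<lfloor>f x\<rfloor>) ` A)) \<le> d + 2"
proof -
  have "\<bar>real_of_int \<lfloor>f x\<rfloor> - real_of_int \<lfloor>f y\<rfloor>\<bar> \<le> d + 1" if "x \<in> A" "y \<in> A" for x y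
    using assms(2)[OF that] by linarith
  from card_int_near[of "d + 1" A "\<lambda>x. \<lfloor>f x\<rfloor>", OF _ this] assms(1)
  show "finite ((\<lambda>x. \<lfloor>f x\<rfloor>) ` A)" and "real (card ((\<lambda>x. \<lfloor>f x\<rfloor>) ` A)) \<le> d + 2" by auto
qed

text \<open>Orienting every coordinate increasingly makes the sum of the coordinates monotone, and
  two points with the same sum agree in every coordinate.\<close>

lemma card_monotone_names:
  fixes a :: "nat \<Rightarrow> real \<Rightarrow> int" and W :: "real set"
  assumes mono: "\<And>j. j < n \<Longrightarrow> mono_on W (a j) \<or> antimono_on W (a j)"
    and near: "\<And>j x y. j < n \<Longrightarrow> x \<in> W \<Longrightarrow> y \<in> W \<Longrightarrow> \<bar>real_of_int (a j x) - real_of_int (a j y)\<bar> \<le> d"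
    and d: "0 \<le> d"
  shows "finite ((\<lambda>x. map (\<lambda>j. a j x) [0..<n]) ` W)"
    and "real (card ((\<lambda>x. map (\<lambda>j. a j x) [0..<n]) ` W)) \<le> real n * d + 1"
proof -
  define b where "b j x = (if mono_on W (a j) then a j x else - a j x)" for j x
  have bm: "b j x \<le> b j y" if "j < n" "x \<in> W" "y \<in> W" "x \<le> y" for j x y
    using mono[OF that(1)] that(2-) unfolding b_def by (auto simp: monotone_on_def)
  define s where "s x = (\<Sum>j<n. b j x)" for x
  have near_s: "\<bar>real_of_int (s x) - real_of_int (s y)\<bar> \<le> real n * d" if "x \<in> W" "y \<in> W" for x y
  proof -
    have "\<bar>real_of_int (s x) - real_of_int (s y)\<bar> \<le> (\<Sum>j<n. \<bar>real_of_int (b j x) - real_of_int (b j y)\<bar>)"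
      unfolding s_def by (simp add: sum_subtractf[symmetric])
    also have "\<dots> \<le> (\<Sum>j<n. d)"
    proof (rule sum_mono)
      fix j assume "j \<in> {..<n}"
      then show "\<bar>real_of_int (b j x) - real_of_int (b j y)\<bar> \<le> d"
        using near[of j x y] that by (auto simp: b_def)
    qed
    finally show ?thesis by simp
  qed
  have eq: "a j x = a j y" if "s x = s y" "x \<in> W" "y \<in> W" "x \<le> y" "j < n" for x y j
  proof -
    have "b j x = b j y"
    proof (rule ccontr)
      assume "b j x \<noteq> b j y"
      then have "b j x < b j y" using bm[of j x y] that by simp
      then have "s x < s y" unfolding s_def using bm that
        by (intro sum_strict_mono_ex1) auto
      then show False using that by simp
    qed
    then show ?thesis by (auto simp: b_def split: if_splits)
  qed
  define g where "g x = map (\<lambda>j. a j x) [0..<n]" for x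
  have g_eq: "g x = g y" if "s x = s y" "x \<in> W" "y \<in> W" for x y
  proof -
    have "a j x = a j y" if "j < n" for j
      using eq[of x y j] eq[of y x j] \<open>s x = s y\<close> \<open>x \<in> W\<close> \<open>y \<in> W\<close> that by (metis linear)
    then show ?thesis unfolding g_def by simp
  qed
  \<comment> \<open>The name is a function of the sum \<open>s\<close>, so there are at most as many
    names as values of \<open>s\<close>: linearly many in n, where a product over the coordinates
    would be exponential.\<close>
  define h where "h v = g (SOME x. x \<in> W \<and> s x = v)" for v
  have "g x = h (s x)" if "x \<in> W" for x
    unfolding h_def using g_eq[of x "SOME z. z \<in> W \<and> s z = s x"] that
      someI[of "\<lambda>z. z \<in> W \<and> s z = s x" x] by auto
  then have img: "g ` W = h ` (s ` W)" by (simp add: image_image cong: image_cong)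
  have sW: "finite (s ` W)" "real (card (s ` W)) \<le> real n * d + 1"
    using card_int_near[of "real n * d" W s] near_s d by auto
  show "finite ((\<lambda>x. map (\<lambda>j. a j x) [0..<n]) ` W)"
    using sW img unfolding g_def by simp
  show "real (card ((\<lambda>x. map (\<lambda>j. a j x) [0..<n]) ` W)) \<le> real n * d + 1"
  proof -
    have "card (g ` W) \<le> card (s ` W)" unfolding img using sW by (intro card_image_le) auto
    then have "real (card (g ` W)) \<le> real n * d + 1" using sW(2) by linarith
    then show ?thesis unfolding g_def .
  qed
qed

section \<open>Entropy of finite-valued functions\<close>

context prob_space begin

text \<open>Finite-valued functions replace partitions: joins become pairs and coarser partitions
  become compositions.\<close>

definition finite_valued :: "('a \<Rightarrow> 'v) \<Rightarrow> bool" where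
  "finite_valued X \<longleftrightarrow> finite (X ` space M) \<and> (\<forall>v. {x\<in>space M. X x = v} \<in> events)"

definition pr :: "('a \<Rightarrow> 'v) \<Rightarrow> 'v \<Rightarrow> real" where
  "pr X v = prob {x\<in>space M. X x = v}"

definition ent :: "('a \<Rightarrow> 'v) \<Rightarrow> real" where
  "ent X = - (\<Sum>v\<in>X ` space M. pr X v * ln (pr X v))"

lemma pr_nonneg: "0 \<le> pr X v" and pr_le_1: "pr X v \<le> 1"
  by (auto simp: pr_def)

lemma finite_valued_integral:
  fixes \<phi> :: "'v \<Rightarrow> real"
  assumes X: "finite_valued X"
  shows "integrable M (\<lambda>x. \<phi> (X x))"
    and "(\<integral>x. \<phi> (X x) \<partial>M) = (\<Sum>v\<in>X ` space M. pr X v * \<phi> v)"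
proof -
  have fin: "finite (X ` space M)" and ev: "{x\<in>space M. X x = v} \<in> events" for v
    using X by (auto simp: finite_valued_def)
  let ?g = "\<lambda>x. \<Sum>v\<in>X ` space M. \<phi> v * indicator {x\<in>space M. X x = v} x"
  have eq: "\<phi> (X x) = ?g x" if "x \<in> space M" for x
  proof -
    have "?g x = (\<Sum>v\<in>X ` space M. if v = X x then \<phi> v else 0)"
      using that by (intro sum.cong) (auto simp: indicator_def)
    then show ?thesis using fin that by (simp add: sum.delta)
  qed
  have int: "integrable M ?g"
    using ev by (intro Bochner_Integration.integrable_sum integrable_mult_right integrable_real_indicator)
      (auto simp: emeasure_eq_measure)
  show "integrable M (\<lambda>x. \<phi> (X x))"
    using int by (subst Bochner_Integration.integrable_cong[OF refl eq]) auto
  have "(\<integral>x. \<phi> (X x) \<partial>M) = (\<integral>x. ?g x \<partial>M)"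
    by (intro Bochner_Integration.integral_cong eq refl)
  also have "\<dots> = (\<Sum>v\<in>X ` space M. \<phi> v * pr X v)"
    using ev by (subst Bochner_Integration.integral_sum) 
      (auto intro!: sum.cong integrable_mult_right integrable_real_indicator
        simp: emeasure_eq_measure pr_def Int_def conj_commute)
  finally show "(\<integral>x. \<phi> (X x) \<partial>M) = (\<Sum>v\<in>X ` space M. pr X v * \<phi> v)"
    by (simp add: mult.commute)
qed

lemma ent_integral: "finite_valued X \<Longrightarrow> ent X = (\<integral>x. - ln (pr X (X x)) \<partial>M)"
  using finite_valued_integral(2)[of X "\<lambda>v. - ln (pr X v)"] by (simp add: ent_def sum_negf)

lemma finite_valued_comp:
  assumes X: "finite_valued X"
  shows "finite_valued (\<lambda>x. h (X x))"
proof -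
  have 1: "(\<lambda>x. h (X x)) ` space M = h ` (X ` space M)" by auto
  have 2: "{x \<in> space M. h (X x) = v} = (\<Union>w\<in>{w\<in>X ` space M. h w = v}. {x\<in>space M. X x = w})" for v
    by auto
  have "(\<Union>w\<in>{w\<in>X ` space M. h w = v}. {x\<in>space M. X x = w}) \<in> events" for v
    using X by (intro sets.finite_UN) (auto simp: finite_valued_def)
  moreover have "finite (h ` (X ` space M))"
    using X by (metis finite_imageI finite_valued_def)
  ultimately show ?thesis unfolding finite_valued_def 1 2 by blast
qed

lemma finite_valued_pair:
  assumes "finite_valued X" "finite_valued Y"
  shows "finite_valued (\<lambda>x. (X x, Y x))"
proof -
  have "(\<lambda>x. (X x, Y x)) ` space M \<subseteq> X ` space M \<times> Y ` space M" by auto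
  moreover have "finite (X ` space M \<times> Y ` space M)"
    using assms by (simp add: finite_valued_def)
  ultimately have 1: "finite ((\<lambda>x. (X x, Y x)) ` space M)" by (rule finite_subset)
  have 2: "{x\<in>space M. (X x, Y x) = v} = {x\<in>space M. X x = fst v} \<inter> {x\<in>space M. Y x = snd v}" for v
    by auto
  have "{x\<in>space M. X x = fst v} \<inter> {x\<in>space M. Y x = snd v} \<in> events" for v
    using assms by (intro sets.Int) (simp_all add: finite_valued_def)
  then show ?thesis unfolding finite_valued_def using 1 2 by simp
qed

lemma finite_valued_map:
  assumes "\<And>i. i < n \<Longrightarrow> finite_valued (Y i)"
  shows "finite_valued (\<lambda>x. map (\<lambda>i. Y i x) [0..<n])"
  using assms
proof (induction n)
  case 0
  have "(\<lambda>x. []) ` space M \<subseteq> {[]}" by auto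
  then show ?case by (auto simp: finite_valued_def intro: finite_subset)
next
  case (Suc n)
  have "finite_valued (\<lambda>x. (map (\<lambda>i. Y i x) [0..<n], Y n x))"
    using Suc by (intro finite_valued_pair) auto
  from finite_valued_comp[OF this, of "\<lambda>p. fst p @ [snd p]"] show ?case by simp
qed

lemma sum_pr:
  assumes "finite_valued X"
  shows "(\<Sum>v\<in>X ` space M. pr X v) = 1"
  using finite_valued_integral(2)[OF assms, of "\<lambda>_. 1"] by (simp add: prob_space)

text \<open>Since \<open>ln 0 = 0\<close>, comparisons of \<open>- ln (pr X v)\<close> fail on null
  fibres. This set of full measure avoids them.\<close>

lemma AE_pr_pos:
  assumes X: "finite_valued X"
  shows "{x\<in>space M. 0 < pr X (X x)} \<in> events" "prob {x\<in>space M. 0 < pr X (X x)} = 1"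
    "AE x in M. 0 < pr X (X x)"
proof -
  show ev: "{x\<in>space M. 0 < pr X (X x)} \<in> events"
    using finite_valued_comp[OF X, of "\<lambda>v. 0 < pr X v"]
    unfolding finite_valued_def by (auto dest!: spec[of _ True])
  have "(\<integral>x. indicator {v. pr X v = 0} (X x) \<partial>M) = (0::real)"
    by (subst finite_valued_integral(2)[OF X]) (auto intro!: sum.neutral simp: indicator_def)
  moreover have "(\<integral>x. (indicator {v. pr X v = 0} (X x) :: real) \<partial>M) = (\<integral>x. indicator (space M - {x\<in>space M. 0 < pr X (X x)}) x \<partial>M)"
    using pr_nonneg[of X] by (intro Bochner_Integration.integral_cong refl)
      (auto simp: indicator_def less_le)
  ultimately have "prob (space M - {x\<in>space M. 0 < pr X (X x)}) = 0" by (simp add: Int_absorb2 Diff_subset)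
  then show p: "prob {x\<in>space M. 0 < pr X (X x)} = 1"
    using prob_compl[OF ev] by simp
  show "AE x in M. 0 < pr X (X x)"
    using prob_Collect_eq_1[OF ev] p by simp
qed

text \<open>Gibbs' inequality for a code which first describes the class \<open>tag x\<close>, with weight
  \<open>w (tag x)\<close>, and then one of the at most \<open>N\<close> values of X on this class. The class is allowed
  to range over an infinite set and need not be measurable.\<close>

lemma ent_le_code:
  fixes X :: "'a \<Rightarrow> 'v" and tag :: "'a \<Rightarrow> 's" and w N :: "'s \<Rightarrow> real"
  assumes X: "finite_valued X" and Z: "Z \<in> events" "prob Z = 1"
    and w0: "\<And>s. 0 \<le> w s" and wpos: "\<And>x. x \<in> Z \<Longrightarrow> 0 < w (tag x)"
    and w1: "\<And>S. finite S \<Longrightarrow> S \<subseteq> tag ` Z \<Longrightarrow> sum w S \<le> 1"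
    and N1: "\<And>x. x \<in> Z \<Longrightarrow> 1 \<le> N (tag x)"
    and N: "\<And>x. x \<in> Z \<Longrightarrow> real (card (X ` {y\<in>Z. tag y = tag x})) \<le> N (tag x)"
    and G: "integrable M G" "\<And>x. x \<in> Z \<Longrightarrow> ln (N (tag x)) - ln (w (tag x)) \<le> G x"
  shows "ent X \<le> (\<integral>x. G x \<partial>M)"
proof -
  have ZS: "Z \<subseteq> space M" using Z sets.sets_into_space by blast
  define V where "V = X ` Z"
  have finX: "finite (X ` space M)" using X by (simp add: finite_valued_def)
  have VS: "V \<subseteq> X ` space M" using ZS by (auto simp: V_def)
  have finV: "finite V" using finite_subset[OF VS finX] .
  define q where "q x = w (tag x) / N (tag x)" for x
  have qpos: "0 < q x" if "x \<in> Z" for x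
    unfolding q_def using wpos[OF that] N1[OF that] by simp
  have q1: "q x \<le> 1" if "x \<in> Z" for x
  proof -
    have "w (tag x) \<le> 1" using w1[of "{tag x}"] that by simp
    then show ?thesis unfolding q_def using N1[OF that] by (simp add: divide_le_eq)
  qed
  \<comment> \<open>A value of X may occur with several tags; \<open>c v\<close> is the best weight
    among its descriptions. With infinitely many tags the supremum need not be attained, hence the
    near-maximizers \<open>y v\<close> and the slack \<open>e'\<close> below.\<close>
  define c where "c v = (SUP x\<in>{x\<in>Z. X x = v}. q x)" for v
  have bdd: "bdd_above (q ` {x\<in>Z. X x = v})" for v
    using q1 by (intro bdd_aboveI2[where M = 1]) auto
  have cq: "q x \<le> c (X x)" if "x \<in> Z" for x
    unfolding c_def using that by (intro cSUP_upper bdd) auto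
  have cpos: "0 < c v" if "v \<in> V" for v
    using that cq qpos unfolding V_def by fastforce
  have sum_c: "(\<Sum>v\<in>V. c v) \<le> 1"
  proof (rule field_le_epsilon)
    fix e :: real assume e: "e > 0"
    define e' where "e' = e / (real (card V) + 1)"
    have e': "e' > 0" using e by (simp add: e'_def)
    have "\<exists>y. y \<in> Z \<and> X y = v \<and> c v - e' < q y" if "v \<in> V" for v
    proof -
      have ne: "{x\<in>Z. X x = v} \<noteq> {}" using that by (auto simp: V_def)
      have "c v - e' < (SUP x\<in>{x\<in>Z. X x = v}. q x)" using e' unfolding c_def by simp
      then show ?thesis using less_cSUP_iff[OF ne bdd] by auto
    qed
    then obtain y where y: "\<And>v. v \<in> V \<Longrightarrow> y v \<in> Z \<and> X (y v) = v \<and> c v - e' < q (y v)"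
      by metis
    let ?T = "\<lambda>v. tag (y v)"
    have "(\<Sum>v\<in>V. c v) \<le> (\<Sum>v\<in>V. q (y v) + e')"
      using y by (intro sum_mono) (auto simp: less_imp_le algebra_simps dest!: y)
    also have "\<dots> = (\<Sum>v\<in>V. q (y v)) + real (card V) * e'" by (simp add: sum.distrib)
    also have "real (card V) * e' \<le> e"
      using e unfolding e'_def by (simp add: field_simps)
    \<comment> \<open>Group the representatives by tag: at most \<open>N s\<close> values are
      represented with tag s, each with weight \<open>w s / N s\<close>.\<close>
    also have "(\<Sum>v\<in>V. q (y v)) = (\<Sum>s\<in>?T ` V. \<Sum>v\<in>{v\<in>V. ?T v = s}. q (y v))"
      by (rule sum.image_gen[OF finV])
    also have "\<dots> \<le> (\<Sum>s\<in>?T ` V. w s)"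
    proof (rule sum_mono)
      fix s assume "s \<in> ?T ` V"
      then obtain v0 where v0: "v0 \<in> V" "s = ?T v0" by auto
      have "{v\<in>V. ?T v = s} \<subseteq> X ` {z\<in>Z. tag z = tag (y v0)}"
        using y v0 by force
      then have "card {v\<in>V. ?T v = s} \<le> card (X ` {z\<in>Z. tag z = tag (y v0)})"
        by (intro card_mono finite_subset[OF _ finX]) (use ZS in auto)
      then have le: "real (card {v\<in>V. ?T v = s}) \<le> N s"
        using N[of "y v0"] y v0 by fastforce
      have "(\<Sum>v\<in>{v\<in>V. ?T v = s}. q (y v)) = real (card {v\<in>V. ?T v = s}) * (w s / N s)"
        by (simp add: q_def)
      also have "\<dots> \<le> N s * (w s / N s)"
        using le w0[of s] N1[of "y v0"] y v0 by (intro mult_right_mono) auto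
      also have "\<dots> = w s" using N1[of "y v0"] y v0 by fastforce
      finally show "(\<Sum>v\<in>{v\<in>V. ?T v = s}. q (y v)) \<le> w s" .
    qed
    also have "\<dots> \<le> 1" using finV y by (intro w1) auto
    finally show "(\<Sum>v\<in>V. c v) \<le> 1 + e" by simp
  qed
  have pr0: "pr X v = 0" if "v \<in> X ` space M - V" for v
  proof -
    have "pr X v \<le> prob (space M - Z)"
      unfolding pr_def
    proof (rule finite_measure_mono)
      show "{x\<in>space M. X x = v} \<subseteq> space M - Z"
      proof safe
        fix x assume "x \<in> Z" "v = X x"
        then show False using that by (auto simp: V_def)
      qed
    qed (use Z in auto)
    then show ?thesis using prob_compl[OF Z(1)] Z(2) pr_nonneg[of X v] by simp
  qed
  have sum_p: "(\<Sum>v\<in>V. pr X v) = 1"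
    using sum_pr[OF X] sum.mono_neutral_left[OF finX VS, of "pr X"] pr0 by simp
  define \<psi> where "\<psi> v = (if v \<in> V then - ln (c v) else 0)" for v
  have "ent X = (\<Sum>v\<in>V. - (pr X v * ln (pr X v)))"
    unfolding ent_def sum_negf[symmetric]
    using sum.mono_neutral_left[OF finX VS, of "\<lambda>v. - (pr X v * ln (pr X v))"] pr0 by simp
  also have "\<dots> \<le> (\<Sum>v\<in>V. pr X v * \<psi> v + (c v - pr X v))"
  proof (rule sum_mono)
    fix v assume v: "v \<in> V"
    show "- (pr X v * ln (pr X v)) \<le> pr X v * \<psi> v + (c v - pr X v)"
    proof (cases "pr X v = 0")
      case True
      then show ?thesis using cpos[OF v] by simp
    next
      case False
      then have p: "pr X v > 0" using pr_nonneg[of X v] by simp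
      \<comment> \<open>Gibbs' inequality in the form \<open>ln t \<le> t - 1\<close>; the
        correction terms \<open>c v - pr X v\<close> have a non-positive sum.\<close>
      have "ln (c v / pr X v) \<le> c v / pr X v - 1"
        using p cpos[OF v] by (intro ln_le_minus_one) simp
      then have "pr X v * (ln (c v) - ln (pr X v)) \<le> pr X v * (c v / pr X v - 1)"
        using p cpos[OF v] by (intro mult_left_mono) (simp_all add: ln_div)
      then show ?thesis using p v by (simp add: \<psi>_def algebra_simps)
    qed
  qed
  also have "\<dots> \<le> (\<Sum>v\<in>V. pr X v * \<psi> v)"
    using sum_c sum_p by (simp add: sum.distrib sum_subtractf)
  also have "\<dots> = (\<Sum>v\<in>X ` space M. pr X v * \<psi> v)"
    using pr0 by (intro sum.mono_neutral_left finX VS) auto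
  also have "\<dots> = (\<integral>x. \<psi> (X x) \<partial>M)" by (rule finite_valued_integral(2)[OF X, symmetric])
  also have "\<dots> \<le> (\<integral>x. G x \<partial>M)"
  proof (rule integral_mono_AE[OF finite_valued_integral(1)[OF X] G(1)])
    have "AE x in M. x \<in> Z" using Z by (simp add: prob_eq_1)
    then show "AE x in M. \<psi> (X x) \<le> G x"
    proof (rule AE_mp, intro AE_I2 impI)
      fix x assume x: "x \<in> Z"
      have "\<psi> (X x) = - ln (c (X x))" using x by (auto simp: \<psi>_def V_def)
      also have "\<dots> \<le> - ln (q x)" using cq[OF x] qpos[OF x] by simp
      also have "\<dots> = ln (N (tag x)) - ln (w (tag x))"
        unfolding q_def using wpos[OF x] N1[OF x] by (simp add: ln_div)
      finally show "\<psi> (X x) \<le> G x" using G(2)[OF x] by simp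
    qed
  qed
  finally show ?thesis .
qed

lemma ent_le_weights:
  fixes X :: "'a \<Rightarrow> 'v" and W :: "'v \<Rightarrow> real"
  assumes X: "finite_valued X" and Z: "Z \<in> events" "prob Z = 1"
    and pos: "\<And>x. x \<in> Z \<Longrightarrow> 0 < W (X x)" and W1: "(\<Sum>v\<in>X ` Z. W v) \<le> 1"
    and G: "integrable M G" "\<And>x. x \<in> Z \<Longrightarrow> - ln (W (X x)) \<le> G x"
  shows "ent X \<le> (\<integral>x. G x \<partial>M)"
proof -
  define w where "w v = (if v \<in> X ` Z then W v else 0)" for v
  have ZS: "Z \<subseteq> space M" using Z sets.sets_into_space by blast
  have fin: "finite (X ` Z)" using X ZS unfolding finite_valued_def
    by (meson finite_subset image_mono)
  have w0: "0 \<le> w v" for v using pos by (auto simp: w_def less_imp_le)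
  show ?thesis
  proof (rule ent_le_code[OF X Z w0, where tag = X and N = "\<lambda>_. 1"])
    fix S assume S: "finite S" "S \<subseteq> X ` Z"
    have "sum w S \<le> sum w (X ` Z)" using S fin w0 by (intro sum_mono2) auto
    also have "\<dots> \<le> 1" using W1 by (simp add: w_def)
    finally show "sum w S \<le> 1" .
  next
    fix x assume "x \<in> Z"
    then have "X ` {y \<in> Z. X y = X x} = {X x}" by auto
    then show "real (card (X ` {y \<in> Z. X y = X x})) \<le> 1" by simp
  qed (use pos G in \<open>auto simp: w_def\<close>)
qed

lemma ent_comp_le:
  assumes Y: "finite_valued Y"
  shows "ent (\<lambda>x. h (Y x)) \<le> ent Y"
proof -
  let ?X = "\<lambda>x. h (Y x)"
  have X: "finite_valued ?X" using finite_valued_comp[OF Y] .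
  have ge: "pr Y (Y x) \<le> pr ?X (?X x)" for x
  proof -
    have "{y\<in>space M. ?X y = ?X x} \<in> events" using X by (auto simp: finite_valued_def)
    then show ?thesis unfolding pr_def by (intro finite_measure_mono) auto
  qed
  have "ent ?X = (\<integral>x. - ln (pr ?X (?X x)) \<partial>M)" by (rule ent_integral[OF X])
  also have "\<dots> \<le> (\<integral>x. - ln (pr Y (Y x)) \<partial>M)"
  proof (rule integral_mono_AE)
    show "integrable M (\<lambda>x. - ln (pr ?X (?X x)))"
      using finite_valued_integral(1)[OF X, of "\<lambda>v. - ln (pr ?X v)"] by simp
    show "integrable M (\<lambda>x. - ln (pr Y (Y x)))"
      using finite_valued_integral(1)[OF Y, of "\<lambda>v. - ln (pr Y v)"] by simp
    show "AE x in M. - ln (pr ?X (?X x)) \<le> - ln (pr Y (Y x))"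
      using AE_pr_pos(3)[OF Y]
    proof (rule AE_mp, intro AE_I2 impI)
      fix x assume "0 < pr Y (Y x)"
      then show "- ln (pr ?X (?X x)) \<le> - ln (pr Y (Y x))" using ge[of x] by simp
    qed
  qed
  also have "\<dots> = ent Y" by (rule ent_integral[OF Y, symmetric])
  finally show ?thesis .
qed

lemma ent_pair_le:
  assumes X: "finite_valued X" and Y: "finite_valued Y"
  shows "ent (\<lambda>x. (X x, Y x)) \<le> ent X + ent Y"
proof -
  let ?Z = "{x\<in>space M. 0 < pr X (X x)} \<inter> {x\<in>space M. 0 < pr Y (Y x)}"
  let ?G = "\<lambda>x. - ln (pr X (X x)) + - ln (pr Y (Y x))"
  have iX: "integrable M (\<lambda>x. - ln (pr X (X x)))" and iY: "integrable M (\<lambda>x. - ln (pr Y (Y x)))"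
    using finite_valued_integral(1)[OF X, of "\<lambda>v. - ln (pr X v)"]
      finite_valued_integral(1)[OF Y, of "\<lambda>v. - ln (pr Y v)"] by auto
  have fins: "finite (X ` space M)" "finite (Y ` space M)"
    using X Y by (auto simp: finite_valued_def)
  have "ent (\<lambda>x. (X x, Y x)) \<le> (\<integral>x. ?G x \<partial>M)"
  proof (rule ent_le_weights[OF finite_valued_pair[OF X Y], where Z = ?Z and W = "\<lambda>(a,b). pr X a * pr Y b"])
    show "?Z \<in> events" using AE_pr_pos(1)[OF X] AE_pr_pos(1)[OF Y] by auto
    moreover have "AE x in M. x \<in> ?Z"
      using AE_pr_pos(3)[OF X] AE_pr_pos(3)[OF Y] AE_space by eventually_elim auto
    ultimately show "prob ?Z = 1" by (simp add: prob_eq_1)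
    have "(\<Sum>v\<in>(\<lambda>x. (X x, Y x)) ` ?Z. (\<lambda>(a,b). pr X a * pr Y b) v) \<le>
      (\<Sum>v\<in>X ` space M \<times> Y ` space M. (\<lambda>(a,b). pr X a * pr Y b) v)"
      using fins by (intro sum_mono2) (auto simp: pr_nonneg)
    also have "\<dots> = (\<Sum>a\<in>X ` space M. pr X a) * (\<Sum>b\<in>Y ` space M. pr Y b)"
      by (simp add: sum_product sum.cartesian_product)
    finally show "(\<Sum>v\<in>(\<lambda>x. (X x, Y x)) ` ?Z. (\<lambda>(a,b). pr X a * pr Y b) v) \<le> 1"
      using sum_pr[OF X] sum_pr[OF Y] by simp
    show "integrable M ?G" using iX iY by (rule Bochner_Integration.integrable_add)
  qed (auto simp: ln_mult)
  also have "\<dots> = ent X + ent Y"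
    using iX iY by (simp add: ent_integral[OF X] ent_integral[OF Y])
  finally show ?thesis .
qed

end

section \<open>Itineraries under a measure-preserving map\<close>

definition itinerary :: "('a \<Rightarrow> 'a) \<Rightarrow> ('a \<Rightarrow> 'v) \<Rightarrow> nat \<Rightarrow> 'a \<Rightarrow> 'v list" where
  "itinerary f a n x = map (\<lambda>i. a ((f ^^ i) x)) [0..<n]"

lemma length_itinerary [simp]: "length (itinerary f a n x) = n"
  by (simp add: itinerary_def)

lemma nth_itinerary [simp]: "i < n \<Longrightarrow> itinerary f a n x ! i = a ((f ^^ i) x)"
  by (simp add: itinerary_def)

lemma itinerary_Suc: "itinerary f a (Suc n) x = a x # itinerary f a n (f x)"
  by (rule nth_equalityI) (auto simp: nth_Cons funpow_swap1 split: nat.split)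

lemma itinerary_add: "itinerary f a (m + n) x = itinerary f a m x @ itinerary f a n ((f ^^ m) x)"
  by (rule nth_equalityI) (auto simp: nth_append funpow_add[symmetric, unfolded o_def, THEN fun_cong]
      simp flip: funpow_add[unfolded o_def, THEN fun_cong])

text \<open>Conditional version of the Kraft inequality: given the word \<open>bs\<close>, the
  letters are chosen independently, each with weights governed by the letter of \<open>bs\<close> in
  the same place.\<close>

lemma sum_zip_prod_le_1:
  fixes c :: "'v \<Rightarrow> 'w \<Rightarrow> real"
  assumes A: "finite A" and c0: "\<And>a b. 0 \<le> c a b" and c1: "\<And>b. (\<Sum>a\<in>A. c a b) \<le> 1"
  shows "finite S \<Longrightarrow> (\<And>s. s \<in> S \<Longrightarrow> set s \<subseteq> A \<and> length s = length bs) \<Longrightarrow>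
    (\<Sum>s\<in>S. \<Prod>i<length bs. c (s ! i) (bs ! i)) \<le> 1"
proof (induction bs arbitrary: S)
  case Nil
  then have "S \<subseteq> {[]}" by auto
  then have "S = {} \<or> S = {[]}" by auto
  then show ?case by auto
next
  case (Cons b bs)
  let ?p = "\<lambda>s. \<Prod>i<length bs. c (s ! i) (bs ! i)"
  have "S \<subseteq> (\<lambda>(a,s). a # s) ` (A \<times> tl ` S)"
  proof
    fix s assume s: "s \<in> S"
    then have "set s \<subseteq> A \<and> length s = Suc (length bs)" using Cons.prems(2)[OF s] by simp
    then obtain a t where "s = a # t" "a \<in> A" by (cases s) auto
    then show "s \<in> (\<lambda>(a,s). a # s) ` (A \<times> tl ` S)" using s by force
  qed
  then have "(\<Sum>s\<in>S. \<Prod>i<length (b # bs). c (s ! i) ((b # bs) ! i))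
      \<le> (\<Sum>s\<in>(\<lambda>(a,s). a # s) ` (A \<times> tl ` S). \<Prod>i<length (b # bs). c (s ! i) ((b # bs) ! i))"
    using Cons.prems(1) A by (intro sum_mono2 prod_nonneg c0 ballI) auto
  also have "\<dots> = (\<Sum>(a,s)\<in>A \<times> tl ` S. c a b * ?p s)"
    by (subst sum.reindex) (auto simp: inj_on_def case_prod_unfold prod.lessThan_Suc_shift simp del: prod.lessThan_Suc)
  also have "\<dots> = (\<Sum>a\<in>A. c a b) * (\<Sum>s\<in>tl ` S. ?p s)"
    by (simp add: sum_product sum.cartesian_product)
  also have "\<dots> \<le> 1 * 1"
  proof (intro mult_mono c1 Cons.IH)
    fix s assume "s \<in> tl ` S"
    then obtain t where t: "t \<in> S" "s = tl t" by auto
    then show "set s \<subseteq> A \<and> length s = length bs"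
      using Cons.prems(2)[OF t(1)] by (cases t) auto
  qed (use Cons.prems in \<open>auto intro!: sum_nonneg prod_nonneg c0\<close>)
  finally show ?case by simp
qed

lemma sum_UNION_le:
  fixes g :: "'b \<Rightarrow> real"
  assumes "finite I" "\<And>i. i \<in> I \<Longrightarrow> finite (A i)" "\<And>x. 0 \<le> g x"
  shows "(\<Sum>x\<in>(\<Union>i\<in>I. A i). g x) \<le> (\<Sum>i\<in>I. \<Sum>x\<in>A i. g x)"
  using assms(1,2)
proof (induction I rule: finite_induct)
  case (insert i I)
  have "(\<Sum>x\<in>A i \<union> (\<Union>i\<in>I. A i). g x) + (\<Sum>x\<in>A i \<inter> (\<Union>i\<in>I. A i). g x) = (\<Sum>x\<in>A i. g x) + (\<Sum>x\<in>(\<Union>i\<in>I. A i). g x)"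
    using insert by (intro sum.union_inter) auto
  moreover have "0 \<le> (\<Sum>x\<in>A i \<inter> (\<Union>i\<in>I. A i). g x)" by (intro sum_nonneg assms(3))
  ultimately show ?case using insert by simp
qed simp

locale mpt = prob_space M for M :: "'a measure" +
  fixes f :: "'a \<Rightarrow> 'a"
  assumes f_meas: "f \<in> measurable M M" and f_inv: "distr M M f = M"
begin

lemma funpow_meas [measurable]: "f ^^ n \<in> measurable M M"
proof (induction n)
  case (Suc n)
  then show ?case using f_meas by (simp add: measurable_comp)
qed (simp add: id_def)

lemma funpow_inv: "distr M M (f ^^ n) = M"
proof (induction n)
  case (Suc n)
  have "distr M M (f ^^ Suc n) = distr (distr M M (f ^^ n)) M f"
    by (subst distr_distr[OF f_meas funpow_meas]) simp
  then show ?case using Suc f_inv by (simp add: o_def)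
qed (simp add: id_def distr_id)

lemma mpt_funpow: "mpt M (f ^^ n)"
  by unfold_locales (use funpow_meas funpow_inv in auto)

lemma f_space: "x \<in> space M \<Longrightarrow> f x \<in> space M"
  using f_meas by (rule measurable_space)

lemma funpow_space: "x \<in> space M \<Longrightarrow> (f ^^ n) x \<in> space M"
  using funpow_meas by (rule measurable_space)

lemma integral_funpow:
  fixes g :: "'a \<Rightarrow> real"
  assumes "g \<in> borel_measurable M"
  shows "(\<integral>x. g ((f ^^ n) x) \<partial>M) = (\<integral>x. g x \<partial>M)"
  using integral_distr[OF funpow_meas[of n] assms] funpow_inv[of n] by simp

lemma integrable_funpow:
  fixes g :: "'a \<Rightarrow> real"
  assumes "integrable M g"
  shows "integrable M (\<lambda>x. g ((f ^^ n) x))"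
  by (rule integrable_distr[OF funpow_meas]) (use assms funpow_inv in simp)

lemma AE_funpow:
  assumes P: "AE x in M. P x"
  shows "AE x in M. P ((f ^^ n) x)"
proof -
  from P have "AE x in distr M M (f ^^ n). P x" unfolding funpow_inv .
  then show ?thesis by (rule AE_distrD[OF funpow_meas])
qed

lemma measure_funpow_vimage:
  assumes "A \<in> events"
  shows "{x\<in>space M. (f ^^ n) x \<in> A} \<in> events" "prob {x\<in>space M. (f ^^ n) x \<in> A} = prob A"
proof -
  have eq: "{x\<in>space M. (f ^^ n) x \<in> A} = (f ^^ n) -` A \<inter> space M" by auto
  show "{x\<in>space M. (f ^^ n) x \<in> A} \<in> events"
    unfolding eq using measurable_sets[OF funpow_meas assms] .
  show "prob {x\<in>space M. (f ^^ n) x \<in> A} = prob A"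
    unfolding eq using measure_distr[OF funpow_meas[of n] assms] funpow_inv by simp
qed

lemma finite_valued_funpow:
  assumes X: "finite_valued X"
  shows "finite_valued (\<lambda>x. X ((f ^^ n) x))"
proof -
  have "(\<lambda>x. X ((f ^^ n) x)) ` space M \<subseteq> X ` space M" using funpow_space by auto
  moreover have "finite (X ` space M)" using X by (simp add: finite_valued_def)
  ultimately have 1: "finite ((\<lambda>x. X ((f ^^ n) x)) ` space M)" by (rule finite_subset)
  have "{x\<in>space M. (f ^^ n) x \<in> {x\<in>space M. X x = v}} \<in> events" for v
    using X by (intro measure_funpow_vimage) (simp add: finite_valued_def)
  moreover have "{x\<in>space M. (f ^^ n) x \<in> {x\<in>space M. X x = v}} = {x\<in>space M. X ((f ^^ n) x) = v}" for v
    using funpow_space by auto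
  ultimately show ?thesis unfolding finite_valued_def using 1 by simp
qed

lemma pr_funpow:
  assumes X: "finite_valued X"
  shows "pr (\<lambda>x. X ((f ^^ n) x)) v = pr X v"
proof -
  have "prob {x\<in>space M. (f ^^ n) x \<in> {x\<in>space M. X x = v}} = prob {x\<in>space M. X x = v}"
    using X by (intro measure_funpow_vimage) (simp add: finite_valued_def)
  moreover have "{x\<in>space M. (f ^^ n) x \<in> {x\<in>space M. X x = v}} = {x\<in>space M. X ((f ^^ n) x) = v}"
    using funpow_space by auto
  ultimately show ?thesis by (simp add: pr_def)
qed

lemma ent_funpow:
  assumes X: "finite_valued X"
  shows "ent (\<lambda>x. X ((f ^^ n) x)) = ent X"
proof -
  have "(\<lambda>x. - ln (pr X (X x))) \<in> borel_measurable M"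
    using finite_valued_integral(1)[OF X, of "\<lambda>v. - ln (pr X v)"] by (rule borel_measurable_integrable)
  from integral_funpow[OF this, of n] show ?thesis
    by (simp add: ent_integral[OF X] ent_integral[OF finite_valued_funpow[OF X]] pr_funpow[OF X])
qed

lemma finite_valued_itinerary:
  assumes "finite_valued a"
  shows "finite_valued (itinerary f a n)"
proof -
  have "itinerary f a n = (\<lambda>x. map (\<lambda>i. a ((f ^^ i) x)) [0..<n])" by (rule ext) (simp add: itinerary_def)
  moreover have "finite_valued (\<lambda>x. map (\<lambda>i. a ((f ^^ i) x)) [0..<n])"
    by (rule finite_valued_map) (rule finite_valued_funpow[OF assms])
  ultimately show ?thesis by simp
qed

lemma ent_nonneg: "0 \<le> ent X"
  unfolding ent_def sum_negf[symmetric]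
proof (intro sum_nonneg)
  fix v
  show "0 \<le> - (pr X v * ln (pr X v))"
    using pr_nonneg[of X v] pr_le_1[of X v]
    by (cases "pr X v = 0") (auto intro!: mult_nonneg_nonpos)
qed

lemma ent_itinerary_add:
  assumes a: "finite_valued a"
  shows "ent (itinerary f a (m + n)) \<le> ent (itinerary f a m) + ent (itinerary f a n)"
proof -
  note fv = finite_valued_itinerary[OF a]
  have "ent (itinerary f a (m + n)) = ent (\<lambda>x. (\<lambda>(s,t). s @ t) (itinerary f a m x, itinerary f a n ((f ^^ m) x)))"
    by (simp add: itinerary_add[abs_def])
  also have "\<dots> \<le> ent (\<lambda>x. (itinerary f a m x, itinerary f a n ((f ^^ m) x)))"
    by (intro ent_comp_le finite_valued_pair fv finite_valued_funpow)
  also have "\<dots> \<le> ent (itinerary f a m) + ent (\<lambda>x. itinerary f a n ((f ^^ m) x))"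
    by (intro ent_pair_le fv finite_valued_funpow)
  finally show ?thesis using ent_funpow[OF fv] by simp
qed

lemma ent_itinerary_0: "ent (itinerary f a 0) = 0"
proof -
  have "space M \<noteq> {}" using not_empty .
  then have "itinerary f a 0 ` space M = {[]}" by (auto simp: itinerary_def)
  moreover have "pr (itinerary f a 0) [] = 1" by (simp add: pr_def itinerary_def prob_space)
  ultimately show ?thesis by (simp add: ent_def)
qed

lemma ent_itinerary_limit:
  assumes a: "finite_valued a"
  shows "n \<ge> 1 \<Longrightarrow> lim (\<lambda>n. ent (itinerary f a n) / real n) \<le> ent (itinerary f a n) / real n"
proof -
  note F = fekete[of "\<lambda>n. ent (itinerary f a n)", OF ent_itinerary_add[OF a] ent_nonneg ent_itinerary_0]
  show "n \<ge> 1 \<Longrightarrow> lim (\<lambda>n. ent (itinerary f a n) / real n) \<le> ent (itinerary f a n) / real n"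
    using F(2) limI[OF F(1)] by simp
qed

lemma partition_entropy_fibres:
  "partition_entropy M ((\<lambda>v. {x\<in>space M. X x = v}) ` (X ` space M)) = ent X"
proof -
  have "inj_on (\<lambda>v. {x\<in>space M. X x = v}) (X ` space M)"
  proof (rule inj_onI)
    fix v w assume "v \<in> X ` space M" and eq: "{x\<in>space M. X x = v} = {x\<in>space M. X x = w}"
    then obtain x where "x \<in> space M" "X x = v" by auto
    then show "v = w" using eq by auto
  qed
  then show ?thesis
    unfolding partition_entropy_def ent_def pr_def by (subst sum.reindex) (auto simp: o_def)
qed

text \<open>By subadditivity the limit along a partition lies below every quotient, so one n for
  each partition and each error suffices.\<close>

lemma metric_entropy_le:
  assumes le: "\<And>(a :: 'a \<Rightarrow> 'a set) \<theta>. finite_valued a \<Longrightarrow> 0 < \<theta> \<Longrightarrow>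
    \<exists>n\<ge>1. ent (itinerary f a n) / real n \<le> c + \<theta>"
  shows "metric_entropy M f \<le> ereal c"
  unfolding metric_entropy_def
proof (rule SUP_least)
  fix P assume "P \<in> {P. finite_measurable_partition M P}"
  then have fin: "finite P" and sub: "P \<subseteq> sets M" and part: "partition_on (space M) P"
    by (auto simp: finite_measurable_partition_def)
  define a where "a x = (THE A. A \<in> P \<and> x \<in> A)" for x
  have ex1: "\<exists>!A. A \<in> P \<and> x \<in> A" if x: "x \<in> space M" for x
  proof -
    obtain A where A: "A \<in> P" "x \<in> A" using x partition_onD1[OF part] by blast
    show ?thesis
    proof (rule ex1I[of _ A])
      fix B assume B: "B \<in> P \<and> x \<in> B"
      show "B = A"
      proof (rule ccontr)
        assume "B \<noteq> A"
        then have "B \<inter> A = {}" using disjointD[OF partition_onD2[OF part]] B A by blast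
        then show False using A B by blast
      qed
    qed (use A in simp)
  qed
  have a: "a x \<in> P \<and> x \<in> a x" if "x \<in> space M" for x
    unfolding a_def using theI'[OF ex1[OF that]] .
  have a_eq: "a x = A" if "x \<in> space M" "A \<in> P" "x \<in> A" for x A
    using ex1[OF that(1)] a[OF that(1)] that by auto
  have "a ` space M \<subseteq> P" using a by auto
  then have fina: "finite (a ` space M)" using fin by (rule finite_subset)
  have "{x\<in>space M. a x = v} \<in> events" for v
  proof (cases "v \<in> P")
    case True
    then have vsp: "v \<subseteq> space M" using sub sets.sets_into_space by blast
    have "{x\<in>space M. a x = v} = v"
    proof (rule set_eqI)
      fix x show "x \<in> {x\<in>space M. a x = v} \<longleftrightarrow> x \<in> v"
        using a[of x] a_eq[of x v] True vsp by auto
    qed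
    then show ?thesis using True sub by auto
  next
    case False
    then have "{x\<in>space M. a x = v} = {}" using a by auto
    then show ?thesis by (metis sets.empty_sets)
  qed
  then have fv: "finite_valued a" using fina by (simp add: finite_valued_def)
  \<comment> \<open>The definition drops empty cells, just as only attained itineraries have fibres
    here.\<close>
  have "iterated_partition (space M) f P n =
      (\<lambda>v. {x\<in>space M. itinerary f a n x = v}) ` (itinerary f a n ` space M)" for n
  proof (rule set_eqI, rule iffI)
    fix B assume "B \<in> iterated_partition (space M) f P n"
    then obtain A where "B \<noteq> {}" and A: "\<And>i. i < n \<Longrightarrow> A i \<in> P"
      and B: "B = {x\<in>space M. \<forall>i<n. (f ^^ i) x \<in> A i}"
      by (auto simp: iterated_partition_def)
    then obtain x where x: "x \<in> B" by auto
    have aA: "a ((f ^^ i) y) = A i \<longleftrightarrow> (f ^^ i) y \<in> A i" if "y \<in> space M" "i < n" for y i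
      using a_eq[OF funpow_space[OF that(1)] A[OF that(2)]] a[OF funpow_space[OF that(1)]] by auto
    have "B = {y\<in>space M. itinerary f a n y = itinerary f a n x}"
    proof (rule set_eqI)
      fix y
      have "itinerary f a n y = itinerary f a n x \<longleftrightarrow> (\<forall>i<n. a ((f ^^ i) y) = A i)" if "y \<in> space M"
      proof -
        have "a ((f ^^ i) x) = A i" if "i < n" for i using x aA[of x i] that unfolding B by blast
        then show ?thesis by (auto simp: itinerary_def)
      qed
      then show "y \<in> B \<longleftrightarrow> y \<in> {y\<in>space M. itinerary f a n y = itinerary f a n x}"
        using aA[of y] unfolding B by blast
    qed
    then show "B \<in> (\<lambda>v. {x\<in>space M. itinerary f a n x = v}) ` (itinerary f a n ` space M)"
      using x unfolding B by auto
  next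
    fix B assume "B \<in> (\<lambda>v. {x\<in>space M. itinerary f a n x = v}) ` (itinerary f a n ` space M)"
    then obtain x where x: "x \<in> space M" and B: "B = {y\<in>space M. itinerary f a n y = itinerary f a n x}"
      by auto
    have eq: "a ((f ^^ i) y) = a ((f ^^ i) x) \<longleftrightarrow> (f ^^ i) y \<in> a ((f ^^ i) x)" if "y \<in> space M" for y i
      using a_eq[OF funpow_space[OF that], of "a ((f ^^ i) x)"] a[OF funpow_space[OF x]]
        a[OF funpow_space[OF that]] by auto
    have "B = {y\<in>space M. \<forall>i<n. (f ^^ i) y \<in> a ((f ^^ i) x)}"
      unfolding B itinerary_def list_eq_iff_nth_eq using eq by auto
    moreover have "B \<noteq> {}" using x B by auto
    moreover have "\<forall>i<n. a ((f ^^ i) x) \<in> P" using a funpow_space[OF x] by auto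
    ultimately show "B \<in> iterated_partition (space M) f P n"
      unfolding iterated_partition_def
      by (intro CollectI conjI exI[of _ "\<lambda>i. a ((f ^^ i) x)"]) simp_all
  qed
  then have pe: "partition_entropy M (iterated_partition (space M) f P n) = ent (itinerary f a n)" for n
    by (simp add: partition_entropy_fibres)
  have "lim (\<lambda>n. ent (itinerary f a n) / real n) \<le> c"
  proof (rule field_le_epsilon)
    fix \<theta> :: real assume "\<theta> > 0"
    from le[OF fv this] ent_itinerary_limit[OF fv]
    show "lim (\<lambda>n. ent (itinerary f a n) / real n) \<le> c + \<theta>" by force
  qed
  then show "ereal (lim (\<lambda>n. partition_entropy M (iterated_partition (space M) f P n) / real n)) \<le> ereal c"
    by (simp add: pe)
qed

text \<open>The weights w play the role of the conditional probabilities of a given q.\<close>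

lemma ent_itinerary_cond:
  assumes a: "finite_valued a" and q: "finite_valued q"
    and w0: "\<And>u v. 0 < w u v" and w1: "\<And>v. (\<Sum>u\<in>a ` space M. w u v) \<le> 1"
  shows "ent (itinerary f a n) \<le> ent (itinerary f q n) + real n * (\<integral>x. - ln (w (a x) (q x)) \<partial>M)"
proof -
  let ?aq = "\<lambda>x. (a x, q x)"
  note aq = finite_valued_pair[OF a q]
  note fa = finite_valued_itinerary[OF a, of n] and fq = finite_valued_itinerary[OF q, of n]
  have finA: "finite (a ` space M)" using a by (simp add: finite_valued_def)
  let ?W = "\<lambda>(s,t). pr (itinerary f q n) t * (\<Prod>i<n. w (s ! i) (t ! i))"
  let ?X = "\<lambda>x. (itinerary f a n x, itinerary f q n x)"
  let ?C = "\<lambda>x. - ln (w (a x) (q x))"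
  let ?G = "\<lambda>x. - ln (pr (itinerary f q n) (itinerary f q n x)) + (\<Sum>i<n. ?C ((f ^^ i) x))"
  let ?Z = "{x\<in>space M. 0 < pr (itinerary f q n) (itinerary f q n x)}"
  have C: "integrable M ?C"
    using finite_valued_integral(1)[OF aq, of "\<lambda>(u,v). - ln (w u v)"] by simp
  have iq: "integrable M (\<lambda>x. - ln (pr (itinerary f q n) (itinerary f q n x)))"
    using finite_valued_integral(1)[OF fq, of "\<lambda>v. - ln (pr (itinerary f q n) v)"] by simp
  have "ent (itinerary f a n) = ent (\<lambda>x. fst (?X x))" by simp
  also have "\<dots> \<le> ent ?X" by (intro ent_comp_le finite_valued_pair fa fq)
  also have "\<dots> \<le> (\<integral>x. ?G x \<partial>M)"
  proof (rule ent_le_weights[OF finite_valued_pair[OF fa fq] AE_pr_pos(1,2)[OF fq], where W = ?W])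
    fix x assume x: "x \<in> ?Z"
    have pp: "0 < (\<Prod>i<n. w (a ((f ^^ i) x)) (q ((f ^^ i) x)))" by (intro prod_pos w0)
    have W: "?W (?X x) = pr (itinerary f q n) (itinerary f q n x) * (\<Prod>i<n. w (a ((f ^^ i) x)) (q ((f ^^ i) x)))"
      by simp
    show "0 < ?W (?X x)" unfolding W using x pp by (intro mult_pos_pos) simp_all
    have "ln (\<Prod>i<n. w (a ((f ^^ i) x)) (q ((f ^^ i) x))) = (\<Sum>i<n. ln (w (a ((f ^^ i) x)) (q ((f ^^ i) x))))"
      using w0 by (intro ln_prod) (auto simp: less_imp_neq[THEN not_sym])
    then show "- ln (?W (?X x)) \<le> ?G x"
      unfolding W using x pp by (subst ln_mult_pos) (auto simp: sum_negf)
  next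
    let ?S = "itinerary f a n ` space M" and ?T = "itinerary f q n ` space M"
    have fin: "finite ?S" "finite ?T" using fa fq by (auto simp: finite_valued_def)
    have "(\<Sum>v\<in>?X ` ?Z. ?W v) \<le> (\<Sum>v\<in>?S \<times> ?T. ?W v)"
    proof (rule sum_mono2)
      show "?X ` ?Z \<subseteq> ?S \<times> ?T" by auto
    qed (use fin in \<open>auto intro!: mult_nonneg_nonneg pr_nonneg prod_nonneg less_imp_le[OF w0]\<close>)
    also have "\<dots> = (\<Sum>s\<in>?S. \<Sum>t\<in>?T. ?W (s,t))" by (simp add: sum.cartesian_product)
    also have "\<dots> = (\<Sum>t\<in>?T. \<Sum>s\<in>?S. ?W (s,t))" by (rule sum.swap)
    also have "\<dots> = (\<Sum>t\<in>?T. pr (itinerary f q n) t * (\<Sum>s\<in>?S. \<Prod>i<length t. w (s ! i) (t ! i)))"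
      by (auto intro!: sum.cong simp: sum_distrib_left)
    also have "\<dots> \<le> (\<Sum>t\<in>?T. pr (itinerary f q n) t * 1)"
    proof (intro sum_mono mult_left_mono pr_nonneg sum_zip_prod_le_1[OF finA less_imp_le[OF w0] w1])
      fix t s assume "t \<in> ?T" "s \<in> ?S"
      then show "set s \<subseteq> a ` space M \<and> length s = length t"
        using funpow_space by (auto simp: itinerary_def)
    qed (use fin in auto)
    also have "\<dots> = 1" using sum_pr[OF fq] by simp
    finally show "(\<Sum>v\<in>?X ` ?Z. ?W v) \<le> 1" .
    show "integrable M ?G"
      by (intro Bochner_Integration.integrable_add Bochner_Integration.integrable_sum iq integrable_funpow C)
  qed
  also have "\<dots> = ent (itinerary f q n) + real n * (\<integral>x. ?C x \<partial>M)"
  proof -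
    have "(\<integral>x. ?G x \<partial>M) = (\<integral>x. - ln (pr (itinerary f q n) (itinerary f q n x)) \<partial>M) + (\<integral>x. (\<Sum>i<n. ?C ((f ^^ i) x)) \<partial>M)"
      by (intro Bochner_Integration.integral_add iq Bochner_Integration.integrable_sum integrable_funpow C)
    also have "(\<integral>x. (\<Sum>i<n. ?C ((f ^^ i) x)) \<partial>M) = (\<Sum>i<n. (\<integral>x. ?C ((f ^^ i) x) \<partial>M))"
      by (intro Bochner_Integration.integral_sum integrable_funpow C)
    also have "\<dots> = (\<Sum>i<n. (\<integral>x. ?C x \<partial>M))"
      by (simp only: integral_funpow[OF borel_measurable_integrable[OF C]])
    finally show ?thesis by (simp add: ent_integral[OF fq])
  qed
  finally show ?thesis .
qed

text \<open>A Markov code: the next symbol is chosen among the possible successors with equal weights.\<close>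

lemma ent_itinerary_successors:
  assumes q: "finite_valued q"
  defines "succ j \<equiv> (\<lambda>y. q (f y)) ` {y\<in>space M. q y = j}"
  shows "ent (itinerary f q k) \<le> ln (real (card (q ` space M))) + real k * (\<integral>x. ln (real (card (succ (q x)))) \<partial>M)"
proof -
  have finq: "finite (q ` space M)" using q by (simp add: finite_valued_def)
  have succ_sub: "succ j \<subseteq> q ` space M" for j using f_space by (auto simp: succ_def)
  have fins: "finite (succ j)" for j using finite_subset[OF succ_sub finq] .
  define c where "c j = 1 / real (card (succ j))" for j
  have c0: "0 \<le> c j" for j by (simp add: c_def)
  have cpos: "0 < c (q x)" if "x \<in> space M" for x
  proof -
    have "succ (q x) \<noteq> {}" using that by (auto simp: succ_def)
    then show ?thesis using fins[of "q x"] by (simp add: c_def card_gt_0_iff)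
  qed
  let ?I = "\<lambda>k j. itinerary f q k ` {y\<in>space M. q y = j}"
  have finI: "finite (?I k j)" for k j
    using finite_valued_itinerary[OF q, of k] unfolding finite_valued_def
    by (auto intro: finite_subset[of _ "itinerary f q k ` space M"])
  \<comment> \<open>Words beginning with j are split by their second letter l, a successor of j, and
    \<open>c j\<close> is the reciprocal of the number of successors. If j is not attained then
    \<open>1 / 0 = 0\<close> keeps the bound.\<close>
  have path: "(\<Sum>w\<in>?I k j. \<Prod>i<k. c (w ! i)) \<le> 1" for k j
  proof (induction k arbitrary: j)
    case 0
    have sub: "?I 0 j \<subseteq> {[]}" by (auto simp: itinerary_def)
    show ?case using card_mono[OF finite.insertI[OF finite.emptyI] sub] by simp
  next
    case (Suc k)
    have "?I (Suc k) j \<subseteq> (\<lambda>w. j # w) ` (\<Union>l\<in>succ j. ?I k l)"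
    proof
      fix w assume "w \<in> ?I (Suc k) j"
      then obtain y where y: "y \<in> space M" "q y = j" "w = j # itinerary f q k (f y)"
        by (auto simp: itinerary_Suc)
      then have "itinerary f q k (f y) \<in> ?I k (q (f y))" "q (f y) \<in> succ j"
        using f_space by (auto simp: succ_def)
      then show "w \<in> (\<lambda>w. j # w) ` (\<Union>l\<in>succ j. ?I k l)" using y(3) by blast
    qed
    then have "(\<Sum>w\<in>?I (Suc k) j. \<Prod>i<Suc k. c (w ! i)) \<le> (\<Sum>w\<in>(\<lambda>w. j # w) ` (\<Union>l\<in>succ j. ?I k l). \<Prod>i<Suc k. c (w ! i))"
      using fins finI by (intro sum_mono2 prod_nonneg ballI c0) auto
    also have "\<dots> = (\<Sum>w\<in>(\<Union>l\<in>succ j. ?I k l). c j * (\<Prod>i<k. c (w ! i)))"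
      by (subst sum.reindex) (auto simp: inj_on_def prod.lessThan_Suc_shift simp del: prod.lessThan_Suc)
    also have "\<dots> = c j * (\<Sum>w\<in>(\<Union>l\<in>succ j. ?I k l). \<Prod>i<k. c (w ! i))"
      by (simp add: sum_distrib_left)
    also have "\<dots> \<le> c j * (\<Sum>l\<in>succ j. \<Sum>w\<in>?I k l. \<Prod>i<k. c (w ! i))"
      using fins finI by (intro mult_left_mono c0 sum_UNION_le) (auto intro!: prod_nonneg c0)
    also have "\<dots> \<le> c j * (\<Sum>l\<in>succ j. 1)" by (intro mult_left_mono sum_mono Suc c0)
    also have "\<dots> \<le> 1" by (simp add: c_def)
    finally show ?case .
  qed
  let ?m = "real (card (q ` space M))"
  have m: "0 < ?m" using finq not_empty by (simp add: card_gt_0_iff)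
  let ?W = "\<lambda>w. (1 / ?m) * (\<Prod>i<k. c (w ! i))"
  let ?C = "\<lambda>x. ln (real (card (succ (q x))))"
  let ?G = "\<lambda>x. ln ?m + (\<Sum>i<k. ?C ((f ^^ i) x))"
  have C: "integrable M ?C" using finite_valued_integral(1)[OF q, of "\<lambda>j. ln (real (card (succ j)))"] .
  have "ent (itinerary f q k) \<le> (\<integral>x. ?G x \<partial>M)"
  proof (rule ent_le_weights[OF finite_valued_itinerary[OF q], where Z = "space M" and W = ?W])
    fix x assume x: "x \<in> space M"
    have cp: "0 < c (q ((f ^^ i) x))" for i using cpos[OF funpow_space[OF x]] .
    have eq: "?W (itinerary f q k x) = (1 / ?m) * (\<Prod>i<k. c (q ((f ^^ i) x)))" by simp
    have pp: "0 < (\<Prod>i<k. c (q ((f ^^ i) x)))" by (intro prod_pos cp)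
    show "0 < ?W (itinerary f q k x)" unfolding eq using m pp by (intro mult_pos_pos) auto
    have "ln (\<Prod>i<k. c (q ((f ^^ i) x))) = (\<Sum>i<k. ln (c (q ((f ^^ i) x))))"
      using cp by (intro ln_prod) (auto simp: less_imp_neq[THEN not_sym])
    also have "\<dots> = - (\<Sum>i<k. ?C ((f ^^ i) x))"
      unfolding sum_negf[symmetric] using cp by (intro sum.cong) (auto simp: c_def ln_div)
    finally show "- ln (?W (itinerary f q k x)) \<le> ?G x"
      unfolding eq using m pp by (subst ln_mult_pos) (auto simp: ln_div)
  next
    have "itinerary f q k ` space M \<subseteq> (\<Union>j\<in>q ` space M. ?I k j)" by auto
    then have "(\<Sum>w\<in>itinerary f q k ` space M. ?W w) \<le> (\<Sum>w\<in>(\<Union>j\<in>q ` space M. ?I k j). ?W w)"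
      by (intro sum_mono2 finite_UN_I[OF finq finI] mult_nonneg_nonneg prod_nonneg ballI c0) auto
    also have "\<dots> \<le> (\<Sum>j\<in>q ` space M. \<Sum>w\<in>?I k j. ?W w)"
      using finq finI by (intro sum_UNION_le) (auto intro!: divide_nonneg_nonneg prod_nonneg c0)
    also have "\<dots> = (\<Sum>j\<in>q ` space M. (1 / ?m) * (\<Sum>w\<in>?I k j. \<Prod>i<k. c (w ! i)))"
      by (simp add: sum_distrib_left)
    also have "\<dots> \<le> (\<Sum>j\<in>q ` space M. (1 / ?m) * 1)" by (intro sum_mono mult_left_mono path) auto
    also have "\<dots> = 1" using m by simp
    finally show "(\<Sum>w\<in>itinerary f q k ` space M. ?W w) \<le> 1" .
    show "integrable M ?G"
      by (intro Bochner_Integration.integrable_add integrable_const Bochner_Integration.integrable_sum integrable_funpow C)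
  qed (auto simp: prob_space)
  also have "\<dots> = ln ?m + (\<integral>x. (\<Sum>i<k. ?C ((f ^^ i) x)) \<partial>M)"
    by (subst Bochner_Integration.integral_add)
      (auto intro!: Bochner_Integration.integrable_sum integrable_funpow C simp: prob_space)
  also have "(\<integral>x. (\<Sum>i<k. ?C ((f ^^ i) x)) \<partial>M) = (\<Sum>i<k. (\<integral>x. ?C ((f ^^ i) x) \<partial>M))"
    by (intro Bochner_Integration.integral_sum integrable_funpow C)
  also have "\<dots> = (\<Sum>i<k. (\<integral>x. ?C x \<partial>M))"
    by (simp only: integral_funpow[OF borel_measurable_integrable[OF C]])
  finally show ?thesis by simp
qed

text \<open>Blocks of length N are treated as single symbols of \<open>f ^^ N\<close>, so that
  constants paid once per symbol become negligible per unit of time for large N.\<close>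

lemma ent_itinerary_power:
  assumes a: "finite_valued a"
  shows "ent (itinerary f a (N * k)) \<le> ent (itinerary (f ^^ N) (itinerary f a N) k)"
proof -
  have eq: "itinerary f a (N * k) x = concat (itinerary (f ^^ N) (itinerary f a N) k x)" for x
  proof (induction k arbitrary: x)
    case (Suc k)
    have "itinerary f a (N * Suc k) x = itinerary f a N x @ itinerary f a (N * k) ((f ^^ N) x)"
      using itinerary_add[of f a N "N * k" x] by simp
    then show ?case using Suc by (simp add: itinerary_Suc)
  qed (simp add: itinerary_def)
  interpret P: mpt M "f ^^ N" by (rule mpt_funpow)
  have "finite_valued (itinerary (f ^^ N) (itinerary f a N) k)"
    by (intro P.finite_valued_itinerary finite_valued_itinerary a)
  from ent_comp_le[OF this, of concat] show ?thesis by (simp add: eq[abs_def])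
qed

end

section \<open>Maximal Birkhoff sums\<close>

definition birk :: "('a \<Rightarrow> 'a) \<Rightarrow> ('a \<Rightarrow> real) \<Rightarrow> nat \<Rightarrow> 'a \<Rightarrow> real" where
  "birk f g n x = (\<Sum>i<n. g ((f ^^ i) x))"

text \<open>The recursion makes this the maximum of the Birkhoff sums of order 0, ..., n.\<close>

fun maxbirk :: "('a \<Rightarrow> 'a) \<Rightarrow> ('a \<Rightarrow> real) \<Rightarrow> nat \<Rightarrow> 'a \<Rightarrow> real" where
  "maxbirk f g 0 x = 0"
| "maxbirk f g (Suc n) x = max 0 (g x + maxbirk f g n (f x))"

lemma birk_Suc: "birk f g (Suc n) x = g x + birk f g n (f x)"
  unfolding birk_def by (subst sum.lessThan_Suc_shift) (simp add: funpow_swap1)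

lemma maxbirk_nonneg: "0 \<le> maxbirk f g n x"
  by (cases n) auto

lemma birk_le_maxbirk: "birk f g n x \<le> maxbirk f g n x"
proof (induction n arbitrary: x)
  case (Suc n)
  show ?case using Suc.IH[of "f x"] unfolding birk_Suc maxbirk.simps by linarith
qed (simp add: birk_def)

lemma maxbirk_mono: "maxbirk f g n x \<le> maxbirk f g (Suc n) x"
proof (induction n arbitrary: x)
  case (Suc n)
  show ?case using Suc.IH[of "f x"] unfolding maxbirk.simps(2)[of f g n x] maxbirk.simps(2)[of f g "Suc n" x] by linarith
qed simp

lemma incseq_maxbirk: "incseq (\<lambda>n. maxbirk f g n x)"
  by (rule incseq_SucI) (rule maxbirk_mono)

context mpt
begin

lemma birk_integrable:
  assumes "integrable M g"
  shows "integrable M (birk f g n)" "(\<integral>x. birk f g n x \<partial>M) = real n * (\<integral>x. g x \<partial>M)"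
proof -
  show "integrable M (birk f g n)"
    unfolding birk_def by (intro Bochner_Integration.integrable_sum integrable_funpow assms)
  show "(\<integral>x. birk f g n x \<partial>M) = real n * (\<integral>x. g x \<partial>M)"
    unfolding birk_def
    by (subst Bochner_Integration.integral_sum)
      (auto intro!: integrable_funpow assms simp: integral_funpow[OF borel_measurable_integrable[OF assms]])
qed

lemma integrable_f: "integrable M (g :: 'a \<Rightarrow> real) \<Longrightarrow> integrable M (\<lambda>x. g (f x))"
  using integrable_funpow[of g 1] by simp

lemma integral_f: "g \<in> borel_measurable M \<Longrightarrow> (\<integral>x. g (f x) \<partial>M) = (\<integral>x. (g x :: real) \<partial>M)"
  using integral_funpow[of g 1] by simp

lemma maxbirk_integrable:
  assumes "integrable M g"
  shows "integrable M (maxbirk f g n)"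
proof (induction n)
  case (Suc n)
  have "integrable M (\<lambda>x. max 0 (g x + maxbirk f g n (f x)))"
    using assms integrable_f[OF Suc] by (intro Bochner_Integration.integrable_max Bochner_Integration.integrable_add) auto
  moreover have "maxbirk f g (Suc n) = (\<lambda>x. max 0 (g x + maxbirk f g n (f x)))"
    by (rule ext) simp
  ultimately show ?case by simp
next
  case 0
  have "maxbirk f g 0 = (\<lambda>x. 0)" by (rule ext) simp
  then show ?case by simp
qed

text \<open>L itself need not be integrable, so two integrals cannot simply be subtracted.
  Truncations of L are integrable, and because truncation is 1-Lipschitz their differences are
  dominated by \<open>\<bar>L x - L (f x)\<bar>\<close>.\<close>

lemma coboundary_integral:
  fixes L :: "'a \<Rightarrow> real"
  assumes L: "L \<in> borel_measurable M" and int: "integrable M (\<lambda>x. L x - L (f x))"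
  shows "(\<integral>x. L x - L (f x) \<partial>M) = 0"
proof -
  define T where "T j y = max (- real j) (min (real j) y)" for j :: nat and y :: real
  have TL: "integrable M (\<lambda>x. T j (L x))" for j
    by (rule integrable_const_bound[where B = "real j"]) (use L in \<open>auto simp: T_def\<close>)
  have z: "(\<integral>x. T j (L x) - T j (L (f x)) \<partial>M) = 0" for j
    using TL[of j] integrable_f[OF TL[of j]] integral_f[of "\<lambda>x. T j (L x)"]
    by (simp add: borel_measurable_integrable)
  have T_lim: "(\<lambda>j. T j y) \<longlonglongrightarrow> y" for y
  proof (rule tendsto_eventually)
    have "eventually (\<lambda>j. \<bar>y\<bar> \<le> real j) sequentially"
      using eventually_ge_at_top[of "nat \<lceil>\<bar>y\<bar>\<rceil>"] by eventually_elim linarith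
    then show "eventually (\<lambda>j. T j y = y) sequentially"
      by eventually_elim (auto simp: T_def)
  qed
  have "(\<lambda>j. \<integral>x. T j (L x) - T j (L (f x)) \<partial>M) \<longlonglongrightarrow> (\<integral>x. L x - L (f x) \<partial>M)"
  proof (rule integral_dominated_convergence[where w = "\<lambda>x. \<bar>L x - L (f x)\<bar>"])
    show "AE x in M. (\<lambda>j. T j (L x) - T j (L (f x))) \<longlonglongrightarrow> L x - L (f x)"
      by (intro AE_I2 tendsto_diff T_lim)
    show "AE x in M. norm (T j (L x) - T j (L (f x))) \<le> \<bar>L x - L (f x)\<bar>" for j
      by (intro AE_I2) (auto simp: T_def)
    show "(\<lambda>x. L x - L (f x)) \<in> borel_measurable M" using int by simp
    show "(\<lambda>x. T j (L x) - T j (L (f x))) \<in> borel_measurable M" for j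
      using TL[of j] integrable_f[OF TL[of j]] by simp
  qed (use int in simp)
  then show ?thesis using z by (simp add: LIMSEQ_const_iff)
qed

text \<open>Along an ergodic orbit the maximal Birkhoff sums are either almost surely bounded or almost
  surely unbounded. In the bounded case their supremum L satisfies g \<open>\<le>\<close> L - L f, so that the
  integral of g would not be positive.\<close>

lemma maxbirk_growth:
  assumes erg: "\<And>A. A \<in> events \<Longrightarrow> f -` A \<inter> space M = A \<Longrightarrow> prob A = 0 \<or> prob A = 1"
    and g: "integrable M g" and pos: "0 < (\<integral>x. g x \<partial>M)" and \<theta>: "0 < \<theta>"
  shows "\<exists>C. \<forall>n. (\<integral>x. maxbirk f g n x \<partial>M) \<le> C + real n * ((\<integral>x. g x \<partial>M) + \<theta>)"
proof -
  let ?m = "maxbirk f g"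
  define U where "U = {x\<in>space M. \<forall>k::nat. \<exists>n. real k < ?m n x}"
  have meas: "?m n \<in> borel_measurable M" for n
    using maxbirk_integrable[OF g] by (rule borel_measurable_integrable)
  have Uev: "U \<in> events" unfolding U_def using meas by measurable
  \<comment> \<open>By invariance the integral of \<open>d n\<close> is the increment of the
    integrals of \<open>maxbirk\<close>. The recursion turns \<open>d n\<close> into a cut-off of g
    from below, dominated by |g|, so it remains to find its pointwise limit.\<close>
  define d where "d n x = ?m (Suc n) x - ?m n (f x)" for n x
  have d_eq: "d n x = max (- ?m n (f x)) (g x)" for n x
    unfolding d_def using maxbirk_nonneg[of f g n "f x"] by auto
  have d_int: "integrable M (d n)" for n
    unfolding d_def
    by (rule Bochner_Integration.integrable_diff[OF maxbirk_integrable[OF g] integrable_f[OF maxbirk_integrable[OF g]]])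
  have d_integral: "(\<integral>x. d n x \<partial>M) = (\<integral>x. ?m (Suc n) x \<partial>M) - (\<integral>x. ?m n x \<partial>M)" for n
    unfolding d_def
    using Bochner_Integration.integral_diff[OF maxbirk_integrable[OF g, of "Suc n"] integrable_f[OF maxbirk_integrable[OF g, of n]]]
      integral_f[OF meas[of n]] by linarith
  have d_bound: "\<bar>d n x\<bar> \<le> \<bar>g x\<bar>" for n x
    unfolding d_eq using maxbirk_nonneg[of f g n "f x"] by auto
  have unb: "x \<in> U \<longleftrightarrow> (\<forall>c. \<exists>n. c < ?m n x)" if "x \<in> space M" for x
  proof
    assume x: "x \<in> U"
    show "\<forall>c. \<exists>n. c < ?m n x"
    proof
      fix c
      obtain k :: nat where "c < real k" using reals_Archimedean2 by blast
      moreover obtain n where "real k < ?m n x" using x unfolding U_def by blast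
      ultimately show "\<exists>n. c < ?m n x" by (intro exI[of _ n]) linarith
    qed
  next
    assume "\<forall>c. \<exists>n. c < ?m n x"
    then show "x \<in> U" unfolding U_def using that by blast
  qed
  have inv: "f -` U \<inter> space M = U"
  proof -
    have "f x \<in> U \<longleftrightarrow> x \<in> U" if x: "x \<in> space M" for x
    proof
      assume "f x \<in> U"
      then have A: "\<exists>n. c < ?m n (f x)" for c using unb[OF f_space[OF x]] by blast
      show "x \<in> U" unfolding unb[OF x]
      proof
        fix c
        obtain n where "c - g x < ?m n (f x)" using A by blast
        then have "c < ?m (Suc n) x" by simp
        then show "\<exists>n. c < ?m n x" by blast
      qed
    next
      assume "x \<in> U"
      then have A: "\<exists>n. c < ?m n x" for c using unb[OF x] by blast
      show "f x \<in> U" unfolding unb[OF f_space[OF x]]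
      proof
        fix c
        obtain n where n: "max 0 (c + g x) < ?m n x" using A by blast
        then obtain k where "n = Suc k" by (cases n) auto
        then have "c < ?m k (f x)" using n by auto
        then show "\<exists>n. c < ?m n (f x)" by blast
      qed
    qed
    then show ?thesis by (auto simp: U_def)
  qed
  have lim: "(\<lambda>n. \<integral>x. d n x \<partial>M) \<longlonglongrightarrow> (\<integral>x. g x \<partial>M)"
  proof -
    from erg[OF Uev inv] consider "prob U = 1" | "prob U = 0" by blast
    then show ?thesis
    proof cases
      \<comment> \<open>On unbounded orbits the cut-off falls below \<open>g x\<close>, and
        \<open>d n x\<close> is eventually equal to \<open>g x\<close>.\<close>
      case 1
      then have AEU: "AE x in M. x \<in> U" using Uev by (simp add: prob_eq_1)
      show ?thesis
      proof (rule integral_dominated_convergence[where w = "\<lambda>x. \<bar>g x\<bar>"])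
        show "AE x in M. (\<lambda>n. d n x) \<longlonglongrightarrow> g x"
          using AEU AE_space
        proof eventually_elim
          fix x assume x: "x \<in> U" "x \<in> space M"
          then have "f x \<in> U" using inv by auto
          then obtain N where N: "- g x < ?m N (f x)" using unb[OF f_space[OF x(2)]] by blast
          have "eventually (\<lambda>n. d n x = g x) sequentially"
          proof (rule eventually_sequentiallyI[of N])
            fix n assume "N \<le> n"
            then have "?m N (f x) \<le> ?m n (f x)" by (rule incseqD[OF incseq_maxbirk])
            then show "d n x = g x" unfolding d_eq using N by auto
          qed
          then show "(\<lambda>n. d n x) \<longlonglongrightarrow> g x" by (rule tendsto_eventually)
        qed
      qed (use g d_int d_bound in auto)
    next
      case 2
      then have AEU: "AE x in M. x \<notin> U" using Uev
        by (intro AE_I[of _ _ U]) (auto simp: emeasure_eq_measure)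
      define L where "L x = lim (\<lambda>n. ?m n x)" for x
      have L_meas: "L \<in> borel_measurable M"
        unfolding L_def using meas by (intro borel_measurable_lim_metric)
      have L_lim: "(\<lambda>n. ?m n x) \<longlonglongrightarrow> L x" if x: "x \<in> space M" "x \<notin> U" for x
      proof -
        obtain c where "\<forall>n. ?m n x \<le> c" using unb[OF x(1)] x(2) by (auto simp: not_less)
        then have "convergent (\<lambda>n. ?m n x)"
          by (intro Bseq_mono_convergent BseqI'[of _ c] incseqD[OF incseq_maxbirk])
            (use maxbirk_nonneg[of f g _ x] in \<open>auto intro: incseqD[OF incseq_maxbirk]\<close>)
        then show ?thesis unfolding L_def by (simp add: convergent_LIMSEQ_iff)
      qed
      have lims: "AE x in M. (\<lambda>n. d n x) \<longlonglongrightarrow> L x - L (f x) \<and> \<bar>L x - L (f x)\<bar> \<le> \<bar>g x\<bar> \<and> g x \<le> L x - L (f x)"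
        using AEU AE_space
      proof eventually_elim
        fix x assume x: "x \<notin> U" "x \<in> space M"
        then have "f x \<notin> U" using inv by auto
        have "(\<lambda>n. d n x) \<longlonglongrightarrow> L x - L (f x)"
          unfolding d_def
          by (intro tendsto_diff L_lim[OF f_space[OF x(2)] \<open>f x \<notin> U\<close>] LIMSEQ_Suc L_lim x)
        moreover from this have "\<bar>L x - L (f x)\<bar> \<le> \<bar>g x\<bar>"
          by (intro LIMSEQ_le_const2[OF tendsto_rabs]) (use d_bound in auto)
        moreover have "g x \<le> L x - L (f x)"
          using calculation(1) by (rule LIMSEQ_le_const) (auto simp: d_eq)
        ultimately show "(\<lambda>n. d n x) \<longlonglongrightarrow> L x - L (f x) \<and> \<bar>L x - L (f x)\<bar> \<le> \<bar>g x\<bar> \<and> g x \<le> L x - L (f x)" by blast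
      qed
      have Lf: "(\<lambda>x. L (f x)) \<in> borel_measurable M" using measurable_compose[OF f_meas L_meas] .
      have D: "integrable M (\<lambda>x. L x - L (f x))"
      proof (rule Bochner_Integration.integrable_bound[OF g])
        show "AE x in M. norm (L x - L (f x)) \<le> norm (g x)"
          using lims by eventually_elim simp
      qed (use L_meas Lf in measurable)
      have "(\<integral>x. g x \<partial>M) \<le> (\<integral>x. L x - L (f x) \<partial>M)"
        using lims by (intro integral_mono_AE[OF g D]) (auto elim: eventually_mono)
      then show ?thesis using coboundary_integral[OF L_meas D] pos by simp
    qed
  qed
  then obtain N where N: "\<And>n. n \<ge> N \<Longrightarrow> (\<integral>x. d n x \<partial>M) < (\<integral>x. g x \<partial>M) + \<theta>"
    using order_tendstoD(2)[OF lim, of "(\<integral>x. g x \<partial>M) + \<theta>"] \<theta> by (auto simp: eventually_sequentially)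
  let ?I = "(\<integral>x. g x \<partial>M) + \<theta>"
  let ?C = "\<integral>x. ?m N x \<partial>M"
  have mono_int: "(\<integral>x. ?m n x \<partial>M) \<le> (\<integral>x. ?m k x \<partial>M)" if "n \<le> k" for n k
    using that incseq_maxbirk[of f g] by (intro integral_mono maxbirk_integrable[OF g]) (auto simp: incseq_def)
  have step: "(\<integral>x. ?m (N + k) x \<partial>M) \<le> ?C + real k * ?I" for k
  proof (induction k)
    case (Suc k)
    then show ?case using N[of "N + k"] d_integral[of "N + k"] by (simp add: algebra_simps)
  qed simp
  have "(\<integral>x. ?m n x \<partial>M) \<le> ?C + real n * ?I" for n
    using mono_int[of n "N + n"] step[of n] by simp
  then show ?thesis by blast
qed

end

section \<open>Smooth maps and their monotone pieces\<close>

text \<open>The convex hull on the line. Pieces of curve are arbitrary point sets; derivatives are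
  controlled on the hull so that the mean value theorem applies between two points of a
  piece.\<close>

definition convex_closure1 :: "real set \<Rightarrow> real set" where
  "convex_closure1 W = {t. \<exists>a\<in>W. \<exists>b\<in>W. a \<le> t \<and> t \<le> b}"

text \<open>The bound is real because the counts are products of exponentials. A cover suffices, as
  only numbers of names are estimated from it.\<close>

definition splits :: "real \<Rightarrow> ('a set \<Rightarrow> bool) \<Rightarrow> 'a set \<Rightarrow> bool" where
  "splits N P W \<longleftrightarrow> (\<exists>\<W>. finite \<W> \<and> real (card \<W>) \<le> N \<and> W \<subseteq> \<Union>\<W> \<and> (\<forall>V\<in>\<W>. V \<subseteq> W \<and> P V))"

lemma splits_1: "P W \<Longrightarrow> splits 1 P W"
  unfolding splits_def by (intro exI[of _ "{W}"]) auto

lemma splits_mono: "splits N P W \<Longrightarrow> N \<le> N' \<Longrightarrow> (\<And>V. V \<subseteq> W \<Longrightarrow> P V \<Longrightarrow> P' V) \<Longrightarrow> splits N' P' W"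
  unfolding splits_def by (meson order_trans)

lemma splits_trans:
  assumes 1: "splits N P W" and 2: "\<And>V. V \<subseteq> W \<Longrightarrow> P V \<Longrightarrow> splits N' Q V" and N': "0 \<le> N'"
  shows "splits (N * N') Q W"
proof -
  obtain \<W> where W: "finite \<W>" "real (card \<W>) \<le> N" "W \<subseteq> \<Union>\<W>" "\<And>V. V \<in> \<W> \<Longrightarrow> V \<subseteq> W \<and> P V"
    using 1 unfolding splits_def by auto
  have "\<forall>V\<in>\<W>. \<exists>\<V>. finite \<V> \<and> real (card \<V>) \<le> N' \<and> V \<subseteq> \<Union>\<V> \<and> (\<forall>U\<in>\<V>. U \<subseteq> V \<and> Q U)"
    using 2 W(4) unfolding splits_def by blast
  then obtain \<V> where V: "\<And>V. V \<in> \<W> \<Longrightarrow> finite (\<V> V) \<and> real (card (\<V> V)) \<le> N' \<and> V \<subseteq> \<Union>(\<V> V) \<and> (\<forall>U\<in>\<V> V. U \<subseteq> V \<and> Q U)"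
    by metis
  let ?U = "\<Union>V\<in>\<W>. \<V> V"
  have "card ?U \<le> (\<Sum>V\<in>\<W>. card (\<V> V))" by (rule card_UN_le[OF W(1)])
  then have "real (card ?U) \<le> (\<Sum>V\<in>\<W>. real (card (\<V> V)))" by (simp flip: of_nat_sum)
  also have "\<dots> \<le> (\<Sum>V\<in>\<W>. N')" using V by (intro sum_mono) auto
  also have "\<dots> \<le> N * N'" using W(2) N' by (simp add: mult_right_mono)
  finally have card: "real (card ?U) \<le> N * N'" .
  show ?thesis unfolding splits_def
  proof (intro exI[of _ ?U] conjI ballI card)
    show "finite ?U" using W(1) V by auto
    show "W \<subseteq> \<Union>?U"
    proof
      fix x assume "x \<in> W"
      then obtain A where A: "A \<in> \<W>" "x \<in> A" using W(3) by auto
      then have "x \<in> \<Union>(\<V> A)" using V[OF A(1)] by blast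
      then show "x \<in> \<Union>?U" using A by blast
    qed
    fix U assume "U \<in> ?U"
    then obtain A where A: "A \<in> \<W>" "U \<in> \<V> A" by auto
    show "U \<subseteq> W" using A V[OF A(1)] W(4)[OF A(1)] by blast
    show "Q U" using A V[OF A(1)] by blast
  qed
qed

lemma splits_fibres:
  assumes fin: "finite (g ` W)" and card: "real (card (g ` W)) \<le> N"
    and P: "\<And>v. v \<in> g ` W \<Longrightarrow> P {x\<in>W. g x = v}"
  shows "splits N P W"
proof -
  let ?F = "(\<lambda>v. {x\<in>W. g x = v}) ` (g ` W)"
  have "card ?F \<le> card (g ` W)" using fin by (rule card_image_le)
  then have "real (card ?F) \<le> N" using card by linarith
  then show ?thesis unfolding splits_def
    by (intro exI[of _ ?F]) (use fin P in auto)
qed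

lemma splits_card_image:
  assumes "splits N P W" and le: "\<And>V. V \<subseteq> W \<Longrightarrow> P V \<Longrightarrow> finite (g ` V) \<and> real (card (g ` V)) \<le> m"
    and m: "0 \<le> m"
  shows "real (card (g ` W)) \<le> N * m"
proof -
  obtain \<W> where W: "finite \<W>" "real (card \<W>) \<le> N" "W \<subseteq> \<Union>\<W>" "\<And>V. V \<in> \<W> \<Longrightarrow> V \<subseteq> W \<and> P V"
    using assms(1) unfolding splits_def by auto
  have gle: "finite (g ` V) \<and> real (card (g ` V)) \<le> m" if "V \<in> \<W>" for V
    using le W(4)[OF that] by blast
  have "g ` W \<subseteq> (\<Union>V\<in>\<W>. g ` V)" using W(3) by auto
  then have "card (g ` W) \<le> card (\<Union>V\<in>\<W>. g ` V)"
    using W(1) gle by (intro card_mono) auto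
  also have "\<dots> \<le> (\<Sum>V\<in>\<W>. card (g ` V))" by (rule card_UN_le[OF W(1)])
  finally have "real (card (g ` W)) \<le> (\<Sum>V\<in>\<W>. real (card (g ` V)))" by (simp flip: of_nat_sum)
  also have "\<dots> \<le> (\<Sum>V\<in>\<W>. m)" using gle by (intro sum_mono) auto
  also have "\<dots> \<le> N * m" using W(2) m by (simp add: mult_right_mono)
  finally show ?thesis .
qed

text \<open>Taylor approximation from a bound on the oscillation of the last derivative alone. With
  exponent 0 the bound only says that the oscillation is bounded.\<close>

lemma taylor_poly:
  fixes G :: "nat \<Rightarrow> real \<Rightarrow> real"
  assumes D: "is_interval D" and t0: "t0 \<in> D" and \<alpha>: "0 \<le> \<alpha>" and C: "0 \<le> C"
    and der: "\<And>i t. i < m \<Longrightarrow> t \<in> D \<Longrightarrow> (G i has_real_derivative G (Suc i) t) (at t within D)"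
    and osc: "\<And>t. t \<in> D \<Longrightarrow> \<bar>G m t - G m t0\<bar> \<le> C * \<bar>t - t0\<bar> powr \<alpha>"
  shows "\<exists>p. degree p \<le> m \<and> (\<forall>t\<in>D. \<bar>G 0 t - poly p t\<bar> \<le> C * \<bar>t - t0\<bar> powr (real m + \<alpha>))"
  using der osc
proof (induction m arbitrary: G)
  case 0
  then show ?case by (intro exI[of _ "[:G 0 t0:]"]) auto
next
  case (Suc m)
  have "\<exists>p. degree p \<le> m \<and> (\<forall>t\<in>D. \<bar>G (Suc 0) t - poly p t\<bar> \<le> C * \<bar>t - t0\<bar> powr (real m + \<alpha>))"
    using Suc.IH[of "\<lambda>i. G (Suc i)"] Suc.prems by auto
  then obtain p where p: "degree p \<le> m" "\<And>t. t \<in> D \<Longrightarrow> \<bar>G (Suc 0) t - poly p t\<bar> \<le> C * \<bar>t - t0\<bar> powr (real m + \<alpha>)"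
    by auto
  obtain q where q: "pderiv q = p" "degree q \<le> Suc m" "poly q t0 = G 0 t0"
  proof -
    define q0 where "q0 = (\<Sum>i\<le>m. monom (coeff p i / real (Suc i)) (Suc i))"
    have "pderiv q0 = (\<Sum>i\<le>m. monom (coeff p i) i)"
    proof -
      have "pderiv q0 = (\<Sum>i\<le>m. pderiv (monom (coeff p i / real (Suc i)) (Suc i)))"
        unfolding q0_def using higher_pderiv_sum[of 1 _ "{..m}"] by simp
      then show ?thesis by (simp add: pderiv_monom del: of_nat_Suc)
    qed
    also have "\<dots> = p" using p(1) by (simp add: poly_as_sum_of_monoms')
    finally have "pderiv q0 = p" .
    moreover have "degree q0 \<le> Suc m" unfolding q0_def
      by (intro degree_sum_le) (auto intro: order_trans[OF degree_monom_le])
    ultimately show ?thesis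
      by (intro that[of "q0 + [:G 0 t0 - poly q0 t0:]"])
        (auto simp: pderiv_add pderiv_pCons intro: order_trans[OF degree_add_le_max])
  qed
  have "\<bar>G 0 t - poly q t\<bar> \<le> C * \<bar>t - t0\<bar> powr (real (Suc m) + \<alpha>)" if t: "t \<in> D" for t
  proof -
    let ?S = "closed_segment t0 t"
    have S: "?S \<subseteq> D" using D t0 t by (simp add: closed_segment_subset is_interval_convex)
    have "norm ((G 0 t - poly q t) - (G 0 t0 - poly q t0)) \<le> (C * \<bar>t - t0\<bar> powr (real m + \<alpha>)) * norm (t - t0)"
    proof (rule field_differentiable_bound[of ?S "\<lambda>s. G 0 s - poly q s" "\<lambda>s. G 1 s - poly p s"])
      fix s assume s: "s \<in> ?S"
      then have sD: "s \<in> D" using S by auto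
      have "(G 0 has_real_derivative G 1 s) (at s within ?S)"
        using Suc.prems(1)[of 0 s] sD S by (auto intro: DERIV_subset)
      moreover have "(poly q has_real_derivative poly p s) (at s within ?S)"
        using poly_DERIV[of q s] q(1) by (auto intro: DERIV_subset)
      ultimately show "((\<lambda>s. G 0 s - poly q s) has_real_derivative G 1 s - poly p s) (at s within ?S)"
        by (rule DERIV_diff)
      have "\<bar>s - t0\<bar> \<le> \<bar>t - t0\<bar>" using s by (auto simp: closed_segment_eq_real_ivl split: if_splits)
      then have "C * \<bar>s - t0\<bar> powr (real m + \<alpha>) \<le> C * \<bar>t - t0\<bar> powr (real m + \<alpha>)"
        using \<alpha> C by (intro mult_left_mono powr_mono2) auto
      then show "norm (G 1 s - poly p s) \<le> C * \<bar>t - t0\<bar> powr (real m + \<alpha>)"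
        using p(2)[OF sD] by simp
    qed auto
    also have "\<dots> = C * (\<bar>t - t0\<bar> powr (real m + \<alpha>) * \<bar>t - t0\<bar> powr 1)" by simp
    also have "\<dots> = C * \<bar>t - t0\<bar> powr (real (Suc m) + \<alpha>)"
      by (simp only: powr_add[symmetric]) (simp add: algebra_simps)
    finally show ?thesis using q(3) by simp
  qed
  then show ?case using q(2) by blast
qed

text \<open>Between two consecutive roots of the polynomial \<open>(p\<^sup>2 - a\<^sup>2) (p\<^sup>2 - b\<^sup>2)\<close> the bounds
  \<open>a < \<bar>p\<bar> < b\<close> hold everywhere or nowhere.\<close>

lemma poly_window_index:
  fixes p :: "real poly"
  assumes deg: "degree p \<le> d" and a: "0 \<le> a"
  shows "\<exists>g :: real \<Rightarrow> nat. finite (range g) \<and> card (range g) \<le> 4 * d + 1 \<and>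
    (\<forall>s t z. g s = g t \<longrightarrow> a < \<bar>poly p s\<bar> \<longrightarrow> \<bar>poly p s\<bar> < b \<longrightarrow> s \<le> z \<longrightarrow> z \<le> t \<longrightarrow>
      a < \<bar>poly p z\<bar> \<and> \<bar>poly p z\<bar> < b)"
proof -
  define q where "q = (p * p - [:a\<^sup>2:]) * (p * p - [:b\<^sup>2:])"
  have poly_q: "poly q t = ((poly p t)\<^sup>2 - a\<^sup>2) * ((poly p t)\<^sup>2 - b\<^sup>2)" for t
    by (simp add: q_def power2_eq_square)
  show ?thesis
  proof (cases "q = 0")
    case True
    \<comment> \<open>Here p is constant with modulus a or |b|, so no point lies strictly inside the
      window.\<close>
    have False if "a < \<bar>poly p s\<bar>" "\<bar>poly p s\<bar> < b" for s
    proof -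
      have "a\<^sup>2 < \<bar>poly p s\<bar>\<^sup>2" "\<bar>poly p s\<bar>\<^sup>2 < b\<^sup>2" 
        using power_strict_mono[OF that(1) a, of 2] power_strict_mono[OF that(2) abs_ge_zero, of 2] by auto
      then have "poly q s \<noteq> 0" unfolding poly_q by simp
      then show False using True by simp
    qed
    then show ?thesis by (intro exI[of _ "\<lambda>_. 0"]) auto
  next
    case False
    let ?R = "{z. poly q z = 0}"
    have fin: "finite ?R" using False by (rule poly_roots_finite)
    have deg2: "degree (p * p - [:c:]) \<le> 2 * d" for c
      using deg degree_mult_le[of p p] by (intro degree_diff_le) auto
    then have "degree q \<le> 4 * d"
      unfolding q_def using degree_mult_le[of "p * p - [:a\<^sup>2:]" "p * p - [:b\<^sup>2:]"]
      deg2[of "a\<^sup>2"] deg2[of "b\<^sup>2"] by linarith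
    then have cR: "card ?R \<le> 4 * d" using card_poly_roots_bound[OF False] by simp
    \<comment> \<open>Equal values at s and t with s below t mean that no root lies in the half-open
      interval from s to t; s itself is no root if it lies in the window.\<close>
    define g where "g t = card {z\<in>?R. z \<le> t}" for t
    have "g t \<le> 4 * d" for t
      unfolding g_def by (rule order_trans[OF card_mono[OF fin] cR]) auto
    then have rg: "range g \<subseteq> {..4 * d}" by auto
    have noroot: "poly q z \<noteq> 0" if "g s = g t" "poly q s \<noteq> 0" "s \<le> z" "z \<le> t" for s t z
    proof
      assume "poly q z = 0"
      then have "z \<in> {z\<in>?R. z \<le> t} - {z\<in>?R. z \<le> s}" using that by (cases "z = s") auto
      moreover have "{z\<in>?R. z \<le> s} \<subseteq> {z\<in>?R. z \<le> t}" using that by auto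
      ultimately have "{z\<in>?R. z \<le> s} \<subset> {z\<in>?R. z \<le> t}" by blast
      then have "g s < g t" unfolding g_def using fin by (intro psubset_card_mono) auto
      then show False using that by simp
    qed
    have key: "a < \<bar>poly p z\<bar> \<and> \<bar>poly p z\<bar> < b"
      if st: "g s = g t" "a < \<bar>poly p s\<bar>" "\<bar>poly p s\<bar> < b" "s \<le> z" "z \<le> t" for s t z
    proof -
      have sq: "a\<^sup>2 < (poly p s)\<^sup>2" "(poly p s)\<^sup>2 < b\<^sup>2"
        using power_strict_mono[OF st(2) a, of 2] power_strict_mono[OF st(3) abs_ge_zero, of 2] by auto
      then have qs: "poly q s \<noteq> 0" by (simp add: poly_q)
      have nz: "(poly p y)\<^sup>2 \<noteq> a\<^sup>2" "(poly p y)\<^sup>2 \<noteq> b\<^sup>2" if "s \<le> y" "y \<le> z" for y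
        using noroot[OF st(1) qs that(1)] that st(5) by (auto simp: poly_q)
      have cont: "continuous_on {s..z} (\<lambda>y. (poly p y)\<^sup>2)" by (intro continuous_intros)
      have "a\<^sup>2 < (poly p z)\<^sup>2"
      proof (rule ccontr)
        assume "\<not> a\<^sup>2 < (poly p z)\<^sup>2"
        then have "\<exists>y. s \<le> y \<and> y \<le> z \<and> (poly p y)\<^sup>2 = a\<^sup>2"
          using IVT2'[of "\<lambda>y. (poly p y)\<^sup>2" z "a\<^sup>2" s] sq cont st by auto
        then show False using nz by auto
      qed
      moreover have "(poly p z)\<^sup>2 < b\<^sup>2"
      proof (rule ccontr)
        assume "\<not> (poly p z)\<^sup>2 < b\<^sup>2"
        then have "\<exists>y. s \<le> y \<and> y \<le> z \<and> (poly p y)\<^sup>2 = b\<^sup>2"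
          using IVT'[of "\<lambda>y. (poly p y)\<^sup>2" s "b\<^sup>2" z] sq cont st by auto
        then show False using nz by auto
      qed
      ultimately have "a\<^sup>2 < \<bar>poly p z\<bar>\<^sup>2" "\<bar>poly p z\<bar>\<^sup>2 < b\<^sup>2" by simp_all
      moreover have "0 \<le> b" using st(2,3) a by simp
      ultimately show ?thesis using power_less_imp_less_base by (metis abs_ge_zero)
    qed
    have "card (range g) \<le> card {..4 * d}" using rg by (intro card_mono) auto
    then have "card (range g) \<le> 4 * d + 1" by simp
    moreover have "finite (range g)" using finite_subset[OF rg] by simp
    ultimately show ?thesis using key by (intro exI[of _ g] conjI allI impI) metis+
  qed
qed

section \<open>Lifted one-dimensional maps\<close>

lemma funpow_has_derivative:
  fixes F dF :: "real \<Rightarrow> real"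
  assumes F: "\<And>t. t \<in> D \<Longrightarrow> F t \<in> D" and dF: "\<And>t. t \<in> D \<Longrightarrow> (F has_real_derivative dF t) (at t within D)"
    and t: "t \<in> D"
  shows "((F ^^ n) has_real_derivative (\<Prod>i<n. dF ((F ^^ i) t))) (at t within D)"
proof (induction n)
  case 0
  then show ?case by (simp add: id_def)
next
  case (Suc n)
  have Fn: "(F ^^ n) s \<in> D" if "s \<in> D" for s using that by (induction n) (auto intro: F)
  have "(F has_real_derivative dF ((F ^^ n) t)) (at ((F ^^ n) t) within (F ^^ n) ` D)"
    using dF[OF Fn[OF t]] by (rule DERIV_subset) (auto intro: Fn)
  from DERIV_image_chain[OF this Suc.IH]
  show ?case by (simp add: o_def mult.commute)
qed

text \<open>A common description of maps of the interval (\<open>prj\<close> is the identity of [0,1]) and of the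
  circle (\<open>prj\<close> is the universal covering map and F is a lift); \<open>sec\<close> is a measurable section
  of \<open>prj\<close>.\<close>

locale lifted_map =
  fixes X :: "'a::euclidean_space set" and f :: "'a \<Rightarrow> 'a" and D :: "real set"
    and prj :: "real \<Rightarrow> 'a" and sec :: "'a \<Rightarrow> real" and F dF :: "real \<Rightarrow> real"
    and u :: "'a \<Rightarrow> real" and r R \<Lambda> :: real
  assumes D_interval: "is_interval D" and X_closed: "closed X"
    and prj_in: "t \<in> D \<Longrightarrow> prj t \<in> X"
    and F_in: "t \<in> D \<Longrightarrow> F t \<in> D"
    and semiconj: "t \<in> D \<Longrightarrow> f (prj t) = prj (F t)"
    and sec: "x \<in> X \<Longrightarrow> sec x \<in> D" "x \<in> X \<Longrightarrow> 0 \<le> sec x" "x \<in> X \<Longrightarrow> sec x \<le> 1"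
      "x \<in> X \<Longrightarrow> prj (sec x) = x"
    and sec_measurable: "sec \<in> borel_measurable (restrict_space borel X)"
    and prj_near: "s \<in> D \<Longrightarrow> t \<in> D \<Longrightarrow> \<bar>s - t\<bar> \<le> 1/4 \<Longrightarrow> \<bar>s - t\<bar> \<le> dist (prj s) (prj t)"
    and prj_Lipschitz: "\<exists>L. \<forall>s\<in>D. \<forall>t\<in>D. dist (prj s) (prj t) \<le> L * \<bar>s - t\<bar>"
    and sec_index: "\<exists>\<iota>. \<forall>t\<in>D. \<lfloor>real K * sec (prj t)\<rfloor> = \<iota> \<lfloor>real K * t\<rfloor>"
    and F_deriv: "t \<in> D \<Longrightarrow> (F has_real_derivative dF t) (at t within D)"
    and dF_bound: "t \<in> D \<Longrightarrow> \<bar>dF t\<bar> \<le> \<Lambda>" and \<Lambda>_ge_1: "1 \<le> \<Lambda>"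
    and dF_unif: "uniformly_continuous_on D dF"
    and dF_taylor: "\<exists>C d. 0 \<le> C \<and> (\<forall>t0\<in>D. \<exists>p. degree p \<le> d \<and>
      (\<forall>t\<in>D. \<bar>dF t - poly p t\<bar> \<le> C * \<bar>t - t0\<bar> powr (r - 1)))"
    and r_gt_1: "1 < r"
    and u_prj: "t \<in> D \<Longrightarrow> u (prj t) = \<bar>dF t\<bar>"
    and R_nonneg: "0 \<le> R"
    and growth: "0 < \<gamma> \<Longrightarrow> \<exists>C\<ge>1. \<forall>l. \<forall>t\<in>D. (\<Prod>i<l. \<bar>dF ((F ^^ i) t)\<bar>) \<le> C * exp (real l * (R + \<gamma>))"
begin

definition \<kappa> :: real where "\<kappa> = 1 / (r - 1)"

lemma \<kappa>_pos: "0 < \<kappa>" using r_gt_1 by (simp add: \<kappa>_def)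

lemma Fn_in: "t \<in> D \<Longrightarrow> (F ^^ n) t \<in> D"
  by (induction n) (auto intro: F_in)

lemma semiconj_n: "t \<in> D \<Longrightarrow> (f ^^ n) (prj t) = prj ((F ^^ n) t)"
  by (induction n) (auto simp: semiconj Fn_in)

lemma closure_in_D: "W \<subseteq> D \<Longrightarrow> convex_closure1 W \<subseteq> D"
  using D_interval unfolding convex_closure1_def is_interval_1 by blast

lemma convex_closure1_mono: "V \<subseteq> W \<Longrightarrow> convex_closure1 V \<subseteq> convex_closure1 W"
  unfolding convex_closure1_def by blast

lemma subset_convex_closure1: "W \<subseteq> convex_closure1 W"
  unfolding convex_closure1_def by blast

lemma segment_in_closure: "a \<in> W \<Longrightarrow> b \<in> W \<Longrightarrow> closed_segment a b \<subseteq> convex_closure1 W"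
  unfolding convex_closure1_def closed_segment_eq_real_ivl by auto

lemma F_lipschitz_closure:
  assumes W: "W \<subseteq> D" and c: "\<And>t. t \<in> convex_closure1 W \<Longrightarrow> \<bar>dF t\<bar> \<le> c"
    and a: "a \<in> W" and b: "b \<in> W"
  shows "\<bar>F a - F b\<bar> \<le> c * \<bar>a - b\<bar>"
proof -
  let ?S = "closed_segment b a"
  have S: "?S \<subseteq> convex_closure1 W" using segment_in_closure[OF b a] .
  then have SD: "?S \<subseteq> D" using closure_in_D[OF W] by blast
  have "norm (F a - F b) \<le> c * norm (a - b)"
  proof (rule field_differentiable_bound[of ?S F dF])
    fix s assume s: "s \<in> ?S"
    show "(F has_real_derivative dF s) (at s within ?S)"
      using F_deriv[of s] s SD by (auto intro: DERIV_subset)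
    show "norm (dF s) \<le> c" using c s S by auto
  qed auto
  then show ?thesis by simp
qed

lemma F_lipschitz: "a \<in> D \<Longrightarrow> b \<in> D \<Longrightarrow> \<bar>F a - F b\<bar> \<le> \<Lambda> * \<bar>a - b\<bar>"
  by (rule F_lipschitz_closure[of D]) (use closure_in_D dF_bound in auto)

text \<open>The hull is connected and dF is continuous without zeros on it, hence of constant
  sign.\<close>

lemma F_strict_mono_closure:
  assumes W: "W \<subseteq> D" and nz: "\<And>t. t \<in> convex_closure1 W \<Longrightarrow> dF t \<noteq> 0"
  shows "(\<forall>a\<in>W. \<forall>b\<in>W. a \<le> b \<longrightarrow> F a \<le> F b) \<or> (\<forall>a\<in>W. \<forall>b\<in>W. a \<le> b \<longrightarrow> F b \<le> F a)"
proof -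
  let ?C = "convex_closure1 W"
  have CD: "?C \<subseteq> D" using closure_in_D[OF W] .
  have cont: "continuous_on D dF" using dF_unif by (rule uniformly_continuous_imp_continuous)
  have int: "is_interval ?C" unfolding is_interval_1 convex_closure1_def by (simp, meson order_trans)
  have "connected (dF ` ?C)"
    using int CD cont by (intro connected_continuous_image) (auto intro: continuous_on_subset simp: is_interval_connected)
  then have sgn: "(\<forall>t\<in>?C. 0 < dF t) \<or> (\<forall>t\<in>?C. dF t < 0)"
  proof -
    have "False" if "s \<in> ?C" "t \<in> ?C" "dF s < 0" "0 < dF t" for s t
    proof -
      have "0 \<in> dF ` ?C"
        using connectedD_interval[OF \<open>connected (dF ` ?C)\<close>, of "dF s" "dF t" 0] that by auto
      then show False using nz by auto
    qed
    then show ?thesis using nz by (metis linorder_neqE_linordered_idom)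
  qed
  have mvt: "\<exists>z\<in>?C. F b - F a = (b - a) * dF z" if ab: "a \<in> W" "b \<in> W" "a < b" for a b
  proof -
    have seg: "{a..b} \<subseteq> ?C" using segment_in_closure[OF ab(1,2)] ab(3) by (simp add: closed_segment_eq_real_ivl)
    have "\<exists>z\<in>{a<..<b}. F b - F a = (b - a) * dF z"
    proof (rule mvt_simple[OF ab(3), of F "\<lambda>x h. h * dF x", simplified])
      fix x assume "a \<le> x" "x \<le> b"
      then have "x \<in> D" using seg CD by auto
      then have "(F has_real_derivative dF x) (at x within {a..b})"
        using F_deriv seg CD by (auto intro: DERIV_subset)
      then show "(F has_derivative (\<lambda>h. h * dF x)) (at x within {a..b})"
        by (simp add: has_field_derivative_def mult.commute[of _ "dF x"])
    qed
    then obtain z where z: "z \<in> {a<..<b}" "F b - F a = (b - a) * dF z" by blast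
    then have "z \<in> ?C" using seg by auto
    then show ?thesis using z(2) by blast
  qed
  from sgn show ?thesis
  proof
    assume pos: "\<forall>t\<in>?C. 0 < dF t"
    have "F a \<le> F b" if ab: "a \<in> W" "b \<in> W" "a \<le> b" for a b
    proof (cases "a = b")
      case False
      then obtain z where "z \<in> ?C" "F b - F a = (b - a) * dF z" using mvt[OF ab(1,2)] ab(3) by auto
      moreover have "0 \<le> (b - a) * dF z" using pos calculation(1) ab(3) by (simp add: less_imp_le)
      ultimately show ?thesis by simp
    qed simp
    then show ?thesis by blast
  next
    assume neg: "\<forall>t\<in>?C. dF t < 0"
    have "F b \<le> F a" if ab: "a \<in> W" "b \<in> W" "a \<le> b" for a b
    proof (cases "a = b")
      case False
      then obtain z where "z \<in> ?C" "F b - F a = (b - a) * dF z" using mvt[OF ab(1,2)] ab(3) by auto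
      moreover have "(b - a) * dF z \<le> 0" using neg calculation(1) ab(3)
        by (simp add: less_imp_le mult_nonneg_nonpos)
      ultimately show ?thesis by simp
    qed simp
    then show ?thesis by blast
  qed
qed

text \<open>W then lies in a single monotone branch of each of the first i iterates. The hull is
  taken anew around each image, because only the points of W itself are followed.\<close>

definition no_fold :: "nat \<Rightarrow> real set \<Rightarrow> bool" where
  "no_fold i W \<longleftrightarrow> (\<forall>j<i. \<forall>t\<in>convex_closure1 ((F ^^ j) ` W). dF t \<noteq> 0)"

lemma no_fold_subset: "no_fold i W \<Longrightarrow> V \<subseteq> W \<Longrightarrow> no_fold i V"
  unfolding no_fold_def using convex_closure1_mono[OF image_mono] by blast

lemma no_fold_monotone:
  assumes W: "W \<subseteq> D" and nf: "no_fold i W" and j: "j \<le> i"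
  shows "mono_on W (F ^^ j) \<or> antimono_on W (F ^^ j)"
  using j
proof (induction j)
  case (Suc j)
  let ?V = "(F ^^ j) ` W"
  have V: "?V \<subseteq> D" using W Fn_in by auto
  have "\<And>t. t \<in> convex_closure1 ?V \<Longrightarrow> dF t \<noteq> 0" using nf Suc_le_lessD[OF Suc.prems] unfolding no_fold_def by blast
  note F = F_strict_mono_closure[OF V this]
  have "mono_on W (F ^^ j) \<or> antimono_on W (F ^^ j)" using Suc by simp
  with F show ?case unfolding monotone_on_def by auto
qed (simp add: monotone_on_def)

text \<open>At size \<open>\<delta> * exp (- \<kappa> * k)\<close> the Taylor error of dF is at most
  a small multiple of \<open>exp (- k)\<close>, because \<kappa> (r - 1) = 1. There dF can be
  replaced by a polynomial, which crosses the window of level k a bounded number of times. It is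
  essential that B and \<epsilon> do not depend on k.\<close>

lemma critical_splits:
  "\<exists>B\<ge>1. \<exists>\<epsilon>>0. \<forall>Y \<delta> (k::nat). Y \<subseteq> D \<longrightarrow> 0 \<le> \<delta> \<longrightarrow> \<delta> \<le> \<epsilon> \<longrightarrow> (\<forall>a\<in>Y. \<forall>b\<in>Y. \<bar>a - b\<bar> \<le> \<delta>) \<longrightarrow>
    (\<forall>a\<in>Y. exp (- real k - 1) < \<bar>dF a\<bar> \<and> \<bar>dF a\<bar> \<le> exp (- real k)) \<longrightarrow>
    splits (B * exp (\<kappa> * real k))
      (\<lambda>V. (\<forall>a\<in>V. \<forall>b\<in>V. \<bar>a - b\<bar> \<le> \<delta> * exp (- \<kappa> * real k)) \<and>
           (\<forall>t\<in>convex_closure1 V. dF t \<noteq> 0 \<and> \<bar>dF t\<bar> \<le> exp (2 - real k))) Y"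
proof -
  obtain C d where C: "0 \<le> C" and tay: "\<And>t0. t0 \<in> D \<Longrightarrow> \<exists>p. degree p \<le> d \<and>
      (\<forall>t\<in>D. \<bar>dF t - poly p t\<bar> \<le> C * \<bar>t - t0\<bar> powr (r - 1))"
    using dF_taylor by blast
  \<comment> \<open>Chosen so that \<open>C * \<epsilon> powr (r - 1) \<le> exp (-3)\<close>; at
    level k the Taylor error is then at most \<open>exp (-3) * exp (- k)\<close>.\<close>
  define \<epsilon> where "\<epsilon> = (exp (-3) / (C + 1)) powr \<kappa>"
  have \<epsilon>: "0 < \<epsilon>" using C by (simp add: \<epsilon>_def)
  have \<kappa>r: "\<kappa> * (r - 1) = 1" using r_gt_1 by (simp add: \<kappa>_def)
  have "\<epsilon> powr (r - 1) = exp (-3) / (C + 1)" unfolding \<epsilon>_def powr_powr \<kappa>r using C by simp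
  then have "C * \<epsilon> powr (r - 1) = (C / (C + 1)) * exp (-3)" by simp
  also have "\<dots> \<le> 1 * exp (-3)" using C by (intro mult_right_mono) auto
  finally have C\<epsilon>: "C * \<epsilon> powr (r - 1) \<le> exp (-3)" by simp
  \<comment> \<open>The factor 3 comes from cutting to size \<theta>, the factor 4 d + 1 from the
    windows of a polynomial of degree at most d.\<close>
  define B where "B = 3 * (4 * real d + 1)"
  have B: "1 \<le> B" by (simp add: B_def)
  have e2: "2 \<le> exp (1::real)" using exp_ge_add_one_self[of 1] by simp
  let ?P = "\<lambda>(\<delta>::real) (k::nat) V. (\<forall>a\<in>V. \<forall>b\<in>V. \<bar>a - b\<bar> \<le> \<delta> * exp (- \<kappa> * real k)) \<and>
           (\<forall>t\<in>convex_closure1 V. dF t \<noteq> 0 \<and> \<bar>dF t\<bar> \<le> exp (2 - real k))"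
  have main: "splits (B * exp (\<kappa> * real k)) (?P \<delta> k) Y"
    if Y: "Y \<subseteq> D" and \<delta>: "0 \<le> \<delta>" "\<delta> \<le> \<epsilon>" and diam: "\<forall>a\<in>Y. \<forall>b\<in>Y. \<bar>a - b\<bar> \<le> \<delta>"
      and win: "\<forall>a\<in>Y. exp (- real k - 1) < \<bar>dF a\<bar> \<and> \<bar>dF a\<bar> \<le> exp (- real k)" for Y \<delta> and k :: nat
  proof -
    define \<theta> where "\<theta> = \<delta> * exp (- \<kappa> * real k)"
    have \<theta>0: "0 \<le> \<theta>" using \<delta> by (simp add: \<theta>_def)
    have ek: "1 \<le> exp (\<kappa> * real k)" using \<kappa>_pos by simp
    let ?E = "exp (- real k)"
    have err: "C * \<theta> powr (r - 1) \<le> exp (-3) * ?E"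
    proof -
      have "\<theta> powr (r - 1) = \<delta> powr (r - 1) * exp (- \<kappa> * real k) powr (r - 1)"
        unfolding \<theta>_def using \<delta> by (simp add: powr_mult)
      also have "exp (- \<kappa> * real k) powr (r - 1) = ?E"
      proof -
        have "exp (- \<kappa> * real k) powr (r - 1) = exp (- (\<kappa> * (r - 1)) * real k)"
          by (simp add: powr_def algebra_simps)
        then show ?thesis unfolding \<kappa>r by simp
      qed
      finally have "C * \<theta> powr (r - 1) = C * \<delta> powr (r - 1) * ?E" by simp
      also have "\<dots> \<le> C * \<epsilon> powr (r - 1) * ?E"
        using \<delta> C r_gt_1 by (intro mult_right_mono mult_left_mono powr_mono2) auto
      also have "\<dots> \<le> exp (-3) * ?E" using C\<epsilon> by (intro mult_right_mono) auto
      finally show ?thesis .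
    qed
    \<comment> \<open>A grid of mesh \<theta>. If \<theta> = 0 then \<delta> = 0 and Y has at most
      one point, while division by zero sends all points to one fibre.\<close>
    have P1: "splits (3 * exp (\<kappa> * real k)) (\<lambda>V. \<forall>a\<in>V. \<forall>b\<in>V. \<bar>a - b\<bar> \<le> \<theta>) Y"
    proof (rule splits_fibres[where g = "\<lambda>a. \<lfloor>a / \<theta>\<rfloor>"])
      have "\<bar>a / \<theta> - b / \<theta>\<bar> \<le> exp (\<kappa> * real k)" if "a \<in> Y" "b \<in> Y" for a b
      proof (cases "\<theta> = 0")
        case False
        then have "0 < \<theta>" using \<theta>0 by simp
        have "\<bar>a / \<theta> - b / \<theta>\<bar> = \<bar>a - b\<bar> / \<theta>"
          using \<open>0 < \<theta>\<close> by (simp add: diff_divide_distrib[symmetric])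
        also have "\<dots> \<le> \<delta> / \<theta>" using diam that \<open>0 < \<theta>\<close> by (intro divide_right_mono) auto
        also have "\<dots> = exp (\<kappa> * real k)"
          using False unfolding \<theta>_def by (simp add: exp_minus field_simps)
        finally show ?thesis .
      qed simp
      note card_floor_near[of "exp (\<kappa> * real k)" Y "\<lambda>a. a / \<theta>", OF _ this]
      then show "finite ((\<lambda>a. \<lfloor>a / \<theta>\<rfloor>) ` Y)" "real (card ((\<lambda>a. \<lfloor>a / \<theta>\<rfloor>) ` Y)) \<le> 3 * exp (\<kappa> * real k)"
        using ek by (simp, linarith)
      fix v
      show "\<forall>a\<in>{x \<in> Y. \<lfloor>x / \<theta>\<rfloor> = v}. \<forall>b\<in>{x \<in> Y. \<lfloor>x / \<theta>\<rfloor> = v}. \<bar>a - b\<bar> \<le> \<theta>"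
      proof (intro ballI)
        fix a b assume a: "a \<in> {x \<in> Y. \<lfloor>x / \<theta>\<rfloor> = v}" and b: "b \<in> {x \<in> Y. \<lfloor>x / \<theta>\<rfloor> = v}"
        show "\<bar>a - b\<bar> \<le> \<theta>"
        proof (cases "\<theta> = 0")
          case True
          then have "\<delta> = 0" by (simp add: \<theta>_def)
          then show ?thesis using diam a b True by auto
        next
          case False
          then have "0 < \<theta>" using \<theta>0 by simp
          have "\<bar>a / \<theta> - b / \<theta>\<bar> \<le> 1" using a b by (simp, linarith)
          then have "\<bar>a - b\<bar> / \<theta> \<le> 1"
            using \<open>0 < \<theta>\<close> by (simp add: diff_divide_distrib[symmetric])
          then show ?thesis using \<open>0 < \<theta>\<close> by (simp add: divide_le_eq)
        qed
      qed
    qed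
    have "splits (3 * exp (\<kappa> * real k) * (4 * real d + 1)) (?P \<delta> k) Y"
    proof (rule splits_trans[OF P1])
      fix V assume V: "V \<subseteq> Y" "\<forall>a\<in>V. \<forall>b\<in>V. \<bar>a - b\<bar> \<le> \<theta>"
      show "splits (4 * real d + 1) (?P \<delta> k) V"
      proof (cases "V = {}")
        case True
        then have "?P \<delta> k V" by (simp add: convex_closure1_def)
        then show ?thesis
          using splits_mono[OF splits_1[of "?P \<delta> k" V], of "4 * real d + 1" "?P \<delta> k"] by simp
      next
        case False
        then obtain t0 where t0: "t0 \<in> V" by auto
        then have t0D: "t0 \<in> D" using V Y by auto
        obtain p where p: "degree p \<le> d" "\<And>t. t \<in> D \<Longrightarrow> \<bar>dF t - poly p t\<bar> \<le> C * \<bar>t - t0\<bar> powr (r - 1)"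
          using tay[OF t0D] by blast
        have VD: "V \<subseteq> D" using V Y by blast
        have close: "\<bar>dF t - poly p t\<bar> \<le> exp (-3) * ?E" if "t \<in> convex_closure1 V" for t
        proof -
          obtain a b where ab: "a \<in> V" "b \<in> V" "a \<le> t" "t \<le> b" using \<open>t \<in> convex_closure1 V\<close> unfolding convex_closure1_def by blast
          have "\<bar>a - t0\<bar> \<le> \<theta>" "\<bar>b - t0\<bar> \<le> \<theta>" using V ab t0 by blast+
          then have "\<bar>t - t0\<bar> \<le> \<theta>" using ab by linarith
          then have "C * \<bar>t - t0\<bar> powr (r - 1) \<le> C * \<theta> powr (r - 1)"
            using C r_gt_1 by (intro mult_left_mono powr_mono2) auto
          then show ?thesis using p(2)[of t] closure_in_D[OF VD] that err by force
        qed
        \<comment> \<open>The window for p exceeds that for dF by a factor of about e on both sides.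
          The error \<open>exp (-3) * exp (- k)\<close> thus keeps the points of V inside it, and
          conversely p inside it forces dF to be nonzero and at most
          \<open>exp (2 - k)\<close>.\<close>
        obtain g :: "real \<Rightarrow> nat" where g: "finite (range g)" "card (range g) \<le> 4 * d + 1"
          "\<And>s t z. g s = g t \<Longrightarrow> exp (-2) * ?E < \<bar>poly p s\<bar> \<Longrightarrow> \<bar>poly p s\<bar> < exp 1 * ?E \<Longrightarrow> s \<le> z \<Longrightarrow> z \<le> t \<Longrightarrow>
            exp (-2) * ?E < \<bar>poly p z\<bar> \<and> \<bar>poly p z\<bar> < exp 1 * ?E"
          using poly_window_index[OF p(1), of "exp (-2) * ?E" "exp 1 * ?E"] by auto
        define q where "q = exp (- 1 :: real)"
        have q: "0 < q" "q \<le> 1/2" using e2 by (auto simp: q_def exp_minus field_simps)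
        have qs: "exp (-2) = q * q" "exp (-3) = q * (q * q)" unfolding q_def by (simp_all add: mult_exp_exp)
        have q3: "q * (q * q) < q * q" using q mult_strict_right_mono[of q 1 "q * q"] by simp
        have qq: "q * q \<le> q / 2" using q by simp
        have Ek: "exp (- real k - 1) = q * ?E" unfolding q_def by (simp add: mult_exp_exp)
        have E2: "exp (2 - real k) = exp 1 * exp 1 * ?E" by (simp add: mult_exp_exp)
        have Epos: "0 < ?E" by simp
        show ?thesis
        proof (rule splits_fibres[where g = g])
          have sub: "g ` V \<subseteq> range g" by auto
          show "finite (g ` V)" using finite_subset[OF sub g(1)] .
          show "real (card (g ` V)) \<le> 4 * real d + 1" using card_mono[OF g(1) sub] g(2) by linarith
          fix v
          let ?W = "{x \<in> V. g x = v}"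
          have WV: "convex_closure1 ?W \<subseteq> convex_closure1 V" by (intro convex_closure1_mono) auto
          have "dF t \<noteq> 0 \<and> \<bar>dF t\<bar> \<le> exp (2 - real k)" if t: "t \<in> convex_closure1 ?W" for t
          proof -
            obtain a b where ab: "a \<in> V" "b \<in> V" "g a = v" "g b = v" "a \<le> t" "t \<le> b"
              using t unfolding convex_closure1_def by blast
            have ca: "\<bar>dF a - poly p a\<bar> \<le> exp (-3) * ?E"
              using close ab(1) subset_convex_closure1[of V] by blast
            have wa: "q * ?E < \<bar>dF a\<bar>" "\<bar>dF a\<bar> \<le> ?E" using win ab(1) V(1) Ek by auto
            have q3E: "exp (-3) * ?E \<le> q * q * ?E" using q3 Epos unfolding qs by (intro mult_right_mono) auto
            have qqE: "q * q * ?E \<le> q * ?E / 2" using mult_right_mono[OF qq, of ?E] by simp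
            have q3E': "exp (-3) * ?E < q * q * ?E" using q3 Epos unfolding qs by (intro mult_strict_right_mono)
            have qE: "q * ?E \<le> ?E / 2" using mult_right_mono[OF q(2), of ?E] by simp
            have eE: "2 * ?E \<le> exp 1 * ?E" using mult_right_mono[OF e2, of ?E] by simp
            have eeE: "2 * (exp 1 * ?E) \<le> exp 1 * exp 1 * ?E" using mult_right_mono[OF e2, of "exp 1 * ?E"] by simp
            have "exp (-2) * ?E < \<bar>poly p a\<bar>" "\<bar>poly p a\<bar> < exp 1 * ?E"
              using ca wa q3E' qqE qE eE Epos unfolding qs(1) by linarith+
            from g(3)[OF _ this ab(5,6)] ab
            have pt: "q * q * ?E < \<bar>poly p t\<bar>" "\<bar>poly p t\<bar> < exp 1 * ?E" unfolding qs(1) by auto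
            have ct: "\<bar>dF t - poly p t\<bar> \<le> exp (-3) * ?E" using close t WV by blast
            have "0 < \<bar>dF t\<bar>" using pt(1) ct q3E' by linarith
            moreover have "\<bar>dF t\<bar> \<le> exp (2 - real k)"
              using pt(2) ct q3E qqE qE eE eeE Epos unfolding E2 by linarith
            ultimately show ?thesis by simp
          qed
          moreover have "\<forall>a\<in>?W. \<forall>b\<in>?W. \<bar>a - b\<bar> \<le> \<delta> * exp (- \<kappa> * real k)"
            using V(2) unfolding \<theta>_def by blast
          ultimately show "?P \<delta> k ?W" by blast
        qed
      qed
    qed simp
    moreover have "3 * exp (\<kappa> * real k) * (4 * real d + 1) = B * exp (\<kappa> * real k)"
      by (simp add: B_def algebra_simps)
    ultimately show ?thesis by simp
  qed
  show ?thesis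
    by (rule exI[of _ B], rule conjI[OF B], rule exI[of _ \<epsilon>], rule conjI[OF \<epsilon>]) (use main in blast)
qed

end

section \<open>Symbolic coding of orbits\<close>

lemma splits_vimage:
  assumes "splits N P (g ` U)"
  shows "splits N (\<lambda>V. P (g ` V)) U"
proof -
  obtain \<W> where W: "finite \<W>" "real (card \<W>) \<le> N" "g ` U \<subseteq> \<Union>\<W>" "\<And>V. V \<in> \<W> \<Longrightarrow> V \<subseteq> g ` U \<and> P V"
    using assms unfolding splits_def by auto
  let ?F = "(\<lambda>V. {x\<in>U. g x \<in> V}) ` \<W>"
  have img: "g ` {x\<in>U. g x \<in> V} = V" if "V \<in> \<W>" for V using W(4)[OF that] by auto
  show ?thesis unfolding splits_def
  proof (intro exI[of _ ?F] conjI ballI)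
    show "finite ?F" using W(1) by simp
    show "real (card ?F) \<le> N" using card_image_le[OF W(1), of "\<lambda>V. {x\<in>U. g x \<in> V}"] W(2) by linarith
    show "U \<subseteq> \<Union>?F" using W(3) by auto
    fix V assume "V \<in> ?F"
    then obtain V' where "V' \<in> \<W>" "V = {x\<in>U. g x \<in> V'}" by auto
    then show "V \<subseteq> U" "P (g ` V)" using img W(4) by auto
  qed
qed

context lifted_map
begin

text \<open>Level 0 comprises all points with \<open>u x > exp (-1)\<close> and, because
  \<open>ln 0 = 0\<close>, the critical points as well. The latter form a null set for measures of
  positive entropy.\<close>

definition lev :: "'a \<Rightarrow> nat" where "lev x = nat \<lfloor>- ln (u x)\<rfloor>"

lemma lev_window:
  assumes "0 < u x"
  shows "exp (- real (lev x) - 1) < u x" and "1 \<le> lev x \<Longrightarrow> u x \<le> exp (- real (lev x))"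
proof -
  have "- ln (u x) < real (lev x) + 1" unfolding lev_def by linarith
  then have "- real (lev x) - 1 < ln (u x)" by linarith
  then have "exp (- real (lev x) - 1) < exp (ln (u x))" by (rule exp_less_mono)
  then show "exp (- real (lev x) - 1) < u x" using assms by simp
  assume "1 \<le> lev x"
  then have "ln (u x) \<le> - real (lev x)" unfolding lev_def by linarith
  then have "exp (ln (u x)) \<le> exp (- real (lev x))" by simp
  then show "u x \<le> exp (- real (lev x))" using assms by simp
qed

end

text \<open>A step is critical at level k if \<open>e\<^sup>-\<^sup>k\<^sup>-\<^sup>1 < \<bar>f'\<bar> \<le> e\<^sup>-\<^sup>k\<close> with \<open>k \<ge> K0\<close>, and deep if \<open>k \<ge> K1\<close>. The state
  \<open>vst\<close> vanishes at good times. A deep step starts a bad block, in which it is an upper bound for the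
  logarithm of the size of the pieces of curve relative to the scale \<open>\<epsilon>\<close>; the block lasts until
  this size has recovered.\<close>

locale coding = lifted_map +
  fixes K0 K1 :: nat and \<gamma> \<epsilon> B C1 H :: real
  assumes K0: "2 \<le> K0" and K01: "K0 \<le> K1" and \<gamma>: "0 < \<gamma>" and \<epsilon>: "0 < \<epsilon>" and \<Lambda>\<epsilon>: "\<Lambda> * \<epsilon> \<le> 1/4"
    and dF_osc: "s \<in> D \<Longrightarrow> t \<in> D \<Longrightarrow> \<bar>s - t\<bar> \<le> \<epsilon> \<Longrightarrow> \<bar>dF s - dF t\<bar> < min \<gamma> (1/2) * exp (- real K0)"
    and B: "1 \<le> B"
    and crit: "Y \<subseteq> D \<Longrightarrow> 0 \<le> \<delta> \<Longrightarrow> \<delta> \<le> \<epsilon> \<Longrightarrow> (\<forall>a\<in>Y. \<forall>b\<in>Y. \<bar>a - b\<bar> \<le> \<delta>) \<Longrightarrow>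
      (\<forall>a\<in>Y. exp (- real k - 1) < \<bar>dF a\<bar> \<and> \<bar>dF a\<bar> \<le> exp (- real k)) \<Longrightarrow>
      splits (B * exp (\<kappa> * real k))
        (\<lambda>V. (\<forall>a\<in>V. \<forall>b\<in>V. \<bar>a - b\<bar> \<le> \<delta> * exp (- \<kappa> * real k)) \<and>
             (\<forall>t\<in>convex_closure1 V. dF t \<noteq> 0 \<and> \<bar>dF t\<bar> \<le> exp (2 - real k))) Y"
    and C1: "1 \<le> C1"
    and spanning: "\<exists>E. finite E \<and> real (card E) \<le> C1 * exp (real m * H) \<and>
      (\<forall>x\<in>X. \<exists>e\<in>E. \<forall>k<m. dist ((f ^^ k) x) ((f ^^ k) e) \<le> \<epsilon> / 2)"
begin

text \<open>Only the levels of critical steps enter the symbolic class of a point.\<close>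

definition clev :: "'a \<Rightarrow> nat" where "clev x = (if K0 \<le> lev x then lev x else 0)"

lemma clev: "K0 \<le> clev x \<longleftrightarrow> K0 \<le> lev x" "K1 \<le> clev x \<longleftrightarrow> K1 \<le> lev x"
    "K0 \<le> clev x \<Longrightarrow> clev x = lev x"
  using K0 K01 by (auto simp: clev_def)

text \<open>An upper bound for the change in one step of the logarithmic size of a piece. A critical
  step of level k loses \<kappa> k by cutting and at least k - 2 by contraction; at other steps
  \<gamma> absorbs the oscillation of dF on the piece.\<close>

definition psi :: "'a \<Rightarrow> real" where
  "psi x = (if K0 \<le> lev x then 2 - (1 + \<kappa>) * real (lev x) else ln (u x) + \<gamma>)"

fun vst :: "nat \<Rightarrow> 'a \<Rightarrow> real" where
  "vst 0 x = 0"
| "vst (Suc i) x = (if vst i x < 0 \<or> K1 \<le> lev ((f ^^ i) x) then min 0 (vst i x + psi ((f ^^ i) x)) else 0)"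

lemma vst_nonpos: "vst i x \<le> 0"
  by (cases i) auto

lemma deep_psi: "K1 \<le> lev x \<Longrightarrow> psi x < 0"
proof -
  assume "K1 \<le> lev x"
  then have k: "K0 \<le> lev x" "2 \<le> real (lev x)" using K01 K0 by auto
  have "2 < (1 + \<kappa>) * real (lev x)" 
  proof -
    have "0 < \<kappa> * real (lev x)" using k(2) \<kappa>_pos by (intro mult_pos_pos) auto
    then show ?thesis using k(2) by (simp add: distrib_right)
  qed
  then show "psi x < 0" using k(1) by (simp add: psi_def)
qed

lemma \<epsilon>_quarter: "\<epsilon> \<le> 1/4"
proof -
  have "1 * \<epsilon> \<le> \<Lambda> * \<epsilon>" using \<Lambda>_ge_1 \<epsilon> by (intro mult_right_mono) auto
  then show ?thesis using \<Lambda>\<epsilon> by linarith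
qed

text \<open>The first factor pays for cutting from size 1/4 down to \<epsilon> when a block starts,
  the second for the cutting of \<open>critical_splits\<close>.\<close>

definition step_cost :: "(nat \<Rightarrow> nat) \<Rightarrow> (nat \<Rightarrow> bool) \<Rightarrow> nat \<Rightarrow> real" where
  "step_cost ll bb i = (if \<not> bb i \<and> K1 \<le> ll i then 1 / \<epsilon> + 2 else 1) *
     (if K0 \<le> ll i then B * exp (\<kappa> * real (ll i)) else 1)"

section \<open>Counting the grid names of points with common critical levels and bad times\<close>

context
  fixes n :: nat and Z :: "real set" and ll :: "nat \<Rightarrow> nat" and bb :: "nat \<Rightarrow> bool"
  assumes ZD: "Z \<subseteq> D" and Z01: "Z \<subseteq> {0..1}"
    and ll: "\<And>t i. t \<in> Z \<Longrightarrow> i < n \<Longrightarrow> clev ((f ^^ i) (prj t)) = ll i"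
    and upos: "\<And>t i. t \<in> Z \<Longrightarrow> i < n \<Longrightarrow> 0 < u ((f ^^ i) (prj t))"
    and bb: "\<And>t i. t \<in> Z \<Longrightarrow> i \<le> n \<Longrightarrow> (vst i (prj t) < 0) = bb i"
    and Zne: "Z \<noteq> {}"
begin

lemma ll_clev:
  assumes "t \<in> Z" "i < n"
  shows "K0 \<le> lev ((f ^^ i) (prj t)) \<longleftrightarrow> K0 \<le> ll i" "K1 \<le> lev ((f ^^ i) (prj t)) \<longleftrightarrow> K1 \<le> ll i"
    "K0 \<le> ll i \<Longrightarrow> lev ((f ^^ i) (prj t)) = ll i"
  using ll[OF assms] clev by metis+

abbreviation "good i \<equiv> \<not> bb i \<and> ll i < K1"
abbreviation "start i \<equiv> \<not> bb i \<and> K1 \<le> ll i"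

text \<open>Nothing is demanded at bad times: spanning sets serve only along good runs, so that bad
  times do not contribute to the exponent H.\<close>

definition shadow :: "nat \<Rightarrow> real set \<Rightarrow> bool" where
  "shadow i W \<longleftrightarrow> (\<forall>s\<in>W. \<forall>t\<in>W. \<forall>j<i. good j \<longrightarrow> dist ((f ^^ j) (prj s)) ((f ^^ j) (prj t)) \<le> \<epsilon>)"

lemma good_Suc: "i < n \<Longrightarrow> good i \<Longrightarrow> \<not> bb (Suc i)"
proof -
  assume i: "i < n" and g: "good i"
  obtain t where t: "t \<in> Z" using Zne by auto
  have "\<not> vst i (prj t) < 0" "\<not> K1 \<le> lev ((f ^^ i) (prj t))"
    using bb[OF t, of i] ll_clev[OF t i] g i by auto
  then have "vst (Suc i) (prj t) = 0" by simp
  then show "\<not> bb (Suc i)" using bb[OF t, of "Suc i"] i by simp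
qed

lemma not_bb_0: "\<not> bb 0"
  using Zne bb[of _ 0] by auto

text \<open>The orbits from time s on are sorted by the point of a spanning set of order i - s that
  follows them. The constant \<open>C1\<close> is paid once for the whole run.\<close>

lemma shadow_run:
  assumes V: "V \<subseteq> Z" and s: "s \<le> i" and sh: "shadow s V"
  shows "splits (C1 * exp (real (i - s) * H)) (shadow i) V"
proof -
  obtain E where E: "finite E" "real (card E) \<le> C1 * exp (real (i - s) * H)"
    "\<And>x. x \<in> X \<Longrightarrow> \<exists>e\<in>E. \<forall>k<i - s. dist ((f ^^ k) x) ((f ^^ k) e) \<le> \<epsilon> / 2"
    using spanning[of "i - s"] by auto
  have "(f ^^ s) (prj t) \<in> X" if "t \<in> V" for t
    using that V ZD by (auto simp: semiconj_n intro!: prj_in Fn_in)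
  then have "\<forall>t\<in>V. \<exists>e\<in>E. \<forall>k<i - s. dist ((f ^^ k) ((f ^^ s) (prj t))) ((f ^^ k) e) \<le> \<epsilon> / 2"
    using E(3) by blast
  then obtain e where e: "\<And>t. t \<in> V \<Longrightarrow> e t \<in> E"
    "\<And>t k. t \<in> V \<Longrightarrow> k < i - s \<Longrightarrow> dist ((f ^^ k) ((f ^^ s) (prj t))) ((f ^^ k) (e t)) \<le> \<epsilon> / 2"
    by metis
  have sub: "e ` V \<subseteq> E" using e(1) by auto
  show ?thesis
  proof (rule splits_fibres[where g = e])
    show "finite (e ` V)" using finite_subset[OF sub E(1)] .
    show "real (card (e ` V)) \<le> C1 * exp (real (i - s) * H)"
      using card_mono[OF E(1) sub] E(2) by linarith
    fix v
    show "shadow i {x \<in> V. e x = v}" unfolding shadow_def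
    proof (intro ballI allI impI)
      fix a b j assume a: "a \<in> {x \<in> V. e x = v}" and b: "b \<in> {x \<in> V. e x = v}" and j: "j < i" and g: "good j"
      show "dist ((f ^^ j) (prj a)) ((f ^^ j) (prj b)) \<le> \<epsilon>"
      proof (cases "j < s")
        case True
        then show ?thesis using sh a b g unfolding shadow_def by auto
      next
        case False
        define k where "k = j - s"
        have k: "k < i - s" "j = k + s" using False j by (auto simp: k_def)
        have "(f ^^ j) x = (f ^^ k) ((f ^^ s) x)" for x unfolding k(2) by (simp add: funpow_add)
        then have "dist ((f ^^ j) (prj a)) ((f ^^ k) v) \<le> \<epsilon> / 2" "dist ((f ^^ j) (prj b)) ((f ^^ k) v) \<le> \<epsilon> / 2"
          using e(2)[OF _ k(1), of a] e(2)[OF _ k(1), of b] a b by auto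
        then show ?thesis using dist_triangle2[of "(f ^^ j) (prj a)" "(f ^^ j) (prj b)" "(f ^^ k) v"] by linarith
      qed
    qed
  qed
qed

text \<open>A spanning set is applied only when a run ends, since applying one at every step would
  cost \<open>C1\<close> each time. The time s is the beginning of the run still open at i, whose
  points have not yet been separated. Runs end exactly at starts of blocks, which are therefore what
  the power of \<open>C1\<close> counts.\<close>

lemma shadow_partial:
  "i \<le> n \<Longrightarrow> \<exists>s\<le>i. (\<forall>j. s \<le> j \<longrightarrow> j < i \<longrightarrow> good j) \<and>
    splits (C1 ^ card {j. j < i \<and> start j} * exp (real (card {j. j < s \<and> good j}) * H)) (shadow s) Z"
proof (induction i)
  case 0
  have "shadow 0 Z" by (simp add: shadow_def)
  then show ?case using splits_1 by auto
next
  case (Suc i)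
  then have i: "i < n" by simp
  from Suc obtain s where s: "s \<le> i" "\<And>j. s \<le> j \<Longrightarrow> j < i \<Longrightarrow> good j"
    and sp: "splits (C1 ^ card {j. j < i \<and> start j} * exp (real (card {j. j < s \<and> good j}) * H)) (shadow s) Z"
    by (auto simp: Suc_le_eq)
  consider "good i" | "start i" | "bb i" by linarith
  then show ?case
  proof cases
    case 1
    then have "{j. j < Suc i \<and> start j} = {j. j < i \<and> start j}" by (auto simp: less_Suc_eq)
    then show ?thesis using s sp 1 by (intro exI[of _ s]) (auto simp: less_Suc_eq)
  next
    case 2
    have st: "{j. j < Suc i \<and> start j} = insert i {j. j < i \<and> start j}" using 2 by (auto simp: less_Suc_eq)
    have gd: "{j. j < Suc i \<and> good j} = {j. j < s \<and> good j} \<union> {s..<i}"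
      using 2 s by (auto simp: less_Suc_eq not_less)
    have "card {j. j < Suc i \<and> good j} = card {j. j < s \<and> good j} + (i - s)"
      unfolding gd by (subst card_Un_disjoint) auto
    then have eq: "C1 ^ card {j. j < i \<and> start j} * exp (real (card {j. j < s \<and> good j}) * H) * (C1 * exp (real (i - s) * H))
      = C1 ^ card {j. j < Suc i \<and> start j} * exp (real (card {j. j < Suc i \<and> good j}) * H)"
      unfolding st by (simp add: exp_add[symmetric] algebra_simps)
    have "splits (C1 ^ card {j. j < i \<and> start j} * exp (real (card {j. j < s \<and> good j}) * H) * (C1 * exp (real (i - s) * H)))
      (shadow i) Z"
      by (rule splits_trans[OF sp shadow_run]) (use s C1 in auto)
    then have "splits (C1 ^ card {j. j < Suc i \<and> start j} * exp (real (card {j. j < Suc i \<and> good j}) * H)) (shadow i) Z"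
      unfolding eq .
    then have "splits (C1 ^ card {j. j < Suc i \<and> start j} * exp (real (card {j. j < Suc i \<and> good j}) * H)) (shadow (Suc i)) Z"
      by (rule splits_mono) (use 2 in \<open>auto simp: shadow_def less_Suc_eq\<close>)
    then show ?thesis by (intro exI[of _ "Suc i"]) auto
  next
    case 3
    \<comment> \<open>A good time is never followed by a negative state, so no run is open when i is
      in the interior of a block.\<close>
    have "s = i"
    proof (rule ccontr)
      assume "s \<noteq> i"
      then have "good (i - 1)" "Suc (i - 1) = i" "i - 1 < n" using s i by auto
      then show False using good_Suc[of "i - 1"] 3 by simp
    qed
    have st: "{j. j < Suc i \<and> start j} = {j. j < i \<and> start j}" using 3 by (auto simp: less_Suc_eq)
    have gd: "{j. j < Suc i \<and> good j} = {j. j < i \<and> good j}" using 3 by (auto simp: less_Suc_eq)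
    from sp have "splits (C1 ^ card {j. j < Suc i \<and> start j} * exp (real (card {j. j < Suc i \<and> good j}) * H)) (shadow (Suc i)) Z"
      unfolding st gd \<open>s = i\<close> by (rule splits_mono) (use 3 in \<open>auto simp: shadow_def less_Suc_eq\<close>)
    then show ?thesis by (intro exI[of _ "Suc i"]) auto
  qed
qed

text \<open>The run still open at time n accounts for the additional factor
  \<open>C1\<close>.\<close>

lemma shadow_splits:
  "splits (C1 ^ Suc (card {j. j < n \<and> start j}) * exp (real (card {j. j < n \<and> good j}) * H)) (shadow n) Z"
proof -
  obtain s where s: "s \<le> n" "\<And>j. s \<le> j \<Longrightarrow> j < n \<Longrightarrow> good j"
    and sp: "splits (C1 ^ card {j. j < n \<and> start j} * exp (real (card {j. j < s \<and> good j}) * H)) (shadow s) Z"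
    using shadow_partial[of n] by auto
  have gd: "{j. j < n \<and> good j} = {j. j < s \<and> good j} \<union> {s..<n}" using s by auto
  have "card {j. j < n \<and> good j} = card {j. j < s \<and> good j} + (n - s)"
    unfolding gd by (subst card_Un_disjoint) auto
  then have eq: "C1 ^ card {j. j < n \<and> start j} * exp (real (card {j. j < s \<and> good j}) * H) * (C1 * exp (real (n - s) * H))
      = C1 ^ Suc (card {j. j < n \<and> start j}) * exp (real (card {j. j < n \<and> good j}) * H)"
    by (simp add: exp_add[symmetric] algebra_simps)
  show ?thesis unfolding eq[symmetric]
    by (rule splits_trans[OF sp shadow_run]) (use s C1 in auto)
qed

text \<open>Outside blocks size 1/4 is enough: \<open>prj_near\<close> then turns closeness in X,
  known from shadowing, into closeness of the lifts. Inside blocks the state is not constant on a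
  class of points, hence the comparison with every w. The bound 1 on earlier images limits the
  variation of the grid index.\<close>

definition cell :: "nat \<Rightarrow> real set \<Rightarrow> bool" where
  "cell i W \<longleftrightarrow> no_fold i W \<and> (\<forall>j<i. \<forall>s\<in>W. \<forall>t\<in>W. \<bar>(F ^^ j) s - (F ^^ j) t\<bar> \<le> 1) \<and>
    (\<forall>s\<in>W. \<forall>t\<in>W. \<forall>w\<in>W. \<bar>(F ^^ i) s - (F ^^ i) t\<bar> \<le> (if bb i then \<epsilon> * exp (vst i (prj w)) else 1/4))"

definition small_cell :: "nat \<Rightarrow> real set \<Rightarrow> bool" where
  "small_cell i W \<longleftrightarrow> no_fold i W \<and> (\<forall>j<i. \<forall>s\<in>W. \<forall>t\<in>W. \<bar>(F ^^ j) s - (F ^^ j) t\<bar> \<le> 1) \<and>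
    (\<forall>s\<in>W. \<forall>t\<in>W. \<forall>w\<in>W. \<bar>(F ^^ i) s - (F ^^ i) t\<bar> \<le> \<epsilon> * exp (vst i (prj w)))"

text \<open>At a good time shadowing already gives size \<epsilon>. At the start of a block
  \<open>shadow\<close> demands nothing, so a grid of mesh \<epsilon> is used; inside a block the
  size bound is inherited.\<close>

lemma cell_start:
  assumes W: "W \<subseteq> Z" and sh: "shadow n W" and c: "cell i W" and i: "i < n"
  shows "splits (if start i then 1 / \<epsilon> + 2 else 1) (small_cell i) W"
proof (cases "start i")
  case False
  have "\<bar>(F ^^ i) s - (F ^^ i) t\<bar> \<le> \<epsilon> * exp (vst i (prj w))" if st: "s \<in> W" "t \<in> W" "w \<in> W" for s t w
  proof (cases "bb i")
    case True
    then show ?thesis using c st unfolding cell_def by auto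
  next
    case nb: False
    then have g: "good i" using False by auto
    have sZ: "s \<in> Z" "t \<in> Z" "w \<in> Z" using st W by auto
    have "vst i (prj w) = 0" using bb[OF sZ(3), of i] nb i vst_nonpos[of i "prj w"] by auto
    moreover have "\<bar>(F ^^ i) s - (F ^^ i) t\<bar> \<le> dist (prj ((F ^^ i) s)) (prj ((F ^^ i) t))"
      using c st nb sZ ZD unfolding cell_def by (intro prj_near Fn_in) auto
    moreover have "dist (prj ((F ^^ i) s)) (prj ((F ^^ i) t)) \<le> \<epsilon>"
    proof -
      have "dist ((f ^^ i) (prj s)) ((f ^^ i) (prj t)) \<le> \<epsilon>"
        using sh st g i unfolding shadow_def by blast
      moreover have "s \<in> D" "t \<in> D" using sZ ZD by auto
      ultimately show ?thesis by (simp add: semiconj_n)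
    qed
    ultimately show ?thesis by simp
  qed
  then have "small_cell i W" using c unfolding cell_def small_cell_def by blast
  then show ?thesis using False splits_1[of "small_cell i" W] by auto
next
  case True
  have v0: "vst i (prj s) = 0" if "s \<in> W" for s
    using bb[of s i] that W True i vst_nonpos[of i "prj s"] by auto
  have d: "\<bar>(F ^^ i) s - (F ^^ i) t\<bar> \<le> 1/4" if "s \<in> W" "t \<in> W" for s t
    using c that True unfolding cell_def by auto
  have dd: "\<bar>(F ^^ i) s / \<epsilon> - (F ^^ i) t / \<epsilon>\<bar> \<le> (1/4) / \<epsilon>" if "s \<in> W" "t \<in> W" for s t
  proof -
    have "\<bar>(F ^^ i) s / \<epsilon> - (F ^^ i) t / \<epsilon>\<bar> = \<bar>(F ^^ i) s - (F ^^ i) t\<bar> / \<epsilon>"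
      using \<epsilon> by (simp add: diff_divide_distrib[symmetric])
    also have "\<dots> \<le> (1/4) / \<epsilon>" using d[OF that] \<epsilon> by (intro divide_right_mono) auto
    finally show ?thesis .
  qed
  have "splits (1 / \<epsilon> + 2) (small_cell i) W"
  proof (rule splits_fibres[where g = "\<lambda>t. \<lfloor>(F ^^ i) t / \<epsilon>\<rfloor>"])
    note cf = card_floor_near[of "(1/4) / \<epsilon>" W "\<lambda>t. (F ^^ i) t / \<epsilon>", OF _ dd]
    show "finite ((\<lambda>t. \<lfloor>(F ^^ i) t / \<epsilon>\<rfloor>) ` W)" using cf(1) \<epsilon> by simp
    have "(1/4) / \<epsilon> \<le> 1 / \<epsilon>" using \<epsilon> by (intro divide_right_mono) auto
    then show "real (card ((\<lambda>t. \<lfloor>(F ^^ i) t / \<epsilon>\<rfloor>) ` W)) \<le> 1 / \<epsilon> + 2" using cf(2) \<epsilon> by simp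
    fix v
    let ?V = "{x \<in> W. \<lfloor>(F ^^ i) x / \<epsilon>\<rfloor> = v}"
    have "\<bar>(F ^^ i) s - (F ^^ i) t\<bar> \<le> \<epsilon> * exp (vst i (prj w))" if "s \<in> ?V" "t \<in> ?V" "w \<in> ?V" for s t w
    proof -
      have "\<bar>(F ^^ i) s / \<epsilon> - (F ^^ i) t / \<epsilon>\<bar> \<le> 1" using that by (simp, linarith)
      then have "\<bar>(F ^^ i) s - (F ^^ i) t\<bar> / \<epsilon> \<le> 1"
        using \<epsilon> by (simp add: diff_divide_distrib[symmetric])
      then show ?thesis using \<epsilon> v0[of w] that by (simp add: divide_le_eq)
    qed
    moreover have "no_fold i ?V" using c no_fold_subset[of i W ?V] unfolding cell_def by auto
    moreover have "\<forall>j<i. \<forall>s\<in>?V. \<forall>t\<in>?V. \<bar>(F ^^ j) s - (F ^^ j) t\<bar> \<le> 1" using c unfolding cell_def by blast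
    ultimately show "small_cell i ?V" unfolding small_cell_def by blast
  qed
  then show ?thesis using True by simp
qed

text \<open>When the new state is 0, the weaker bound 1/4 follows from
  \<open>\<Lambda> * \<epsilon> \<le> 1/4\<close>, as the piece had size at most \<epsilon> one step
  before. When it is negative, the minimum in \<open>vst\<close> is not at 0 and \<open>psi\<close>
  gives the bound.\<close>

lemma cell_SucI:
  assumes W: "W \<subseteq> Z" and sc: "small_cell i W" and i: "i < n"
    and nz: "\<And>t. t \<in> convex_closure1 ((F ^^ i) ` W) \<Longrightarrow> dF t \<noteq> 0"
    and size: "\<And>s t w. s \<in> W \<Longrightarrow> t \<in> W \<Longrightarrow> w \<in> W \<Longrightarrow>
      \<bar>(F ^^ Suc i) s - (F ^^ Suc i) t\<bar> \<le> \<epsilon> * exp (vst i (prj w) + psi ((f ^^ i) (prj w)))"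
  shows "cell (Suc i) W"
  unfolding cell_def
proof (intro conjI)
  show "no_fold (Suc i) W" using sc nz unfolding small_cell_def no_fold_def by (auto simp: less_Suc_eq)
  have small: "\<bar>(F ^^ i) s - (F ^^ i) t\<bar> \<le> \<epsilon>" if "s \<in> W" "t \<in> W" for s t
  proof -
    have "\<bar>(F ^^ i) s - (F ^^ i) t\<bar> \<le> \<epsilon> * exp (vst i (prj s))" using sc that unfolding small_cell_def by auto
    also have "\<dots> \<le> \<epsilon> * 1" using \<epsilon> vst_nonpos by (intro mult_left_mono) auto
    finally show ?thesis by simp
  qed
  have "\<bar>(F ^^ j) s - (F ^^ j) t\<bar> \<le> 1" if "j < Suc i" "s \<in> W" "t \<in> W" for j s t
    using sc small[OF that(2,3)] \<epsilon>_quarter that unfolding small_cell_def by (cases "j = i") auto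
  then show "\<forall>j<Suc i. \<forall>s\<in>W. \<forall>t\<in>W. \<bar>(F ^^ j) s - (F ^^ j) t\<bar> \<le> 1" by blast
  show "\<forall>s\<in>W. \<forall>t\<in>W. \<forall>w\<in>W. \<bar>(F ^^ Suc i) s - (F ^^ Suc i) t\<bar> \<le>
      (if bb (Suc i) then \<epsilon> * exp (vst (Suc i) (prj w)) else 1/4)"
  proof (intro ballI)
    fix s t w assume st: "s \<in> W" "t \<in> W" "w \<in> W"
    then have sZ: "s \<in> Z" "t \<in> Z" "w \<in> Z" using W by auto
    show "\<bar>(F ^^ Suc i) s - (F ^^ Suc i) t\<bar> \<le> (if bb (Suc i) then \<epsilon> * exp (vst (Suc i) (prj w)) else 1/4)"
    proof (cases "bb (Suc i)")
      case True
      then have "vst (Suc i) (prj w) < 0" using bb[OF sZ(3), of "Suc i"] i by simp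
      then have "vst (Suc i) (prj w) = vst i (prj w) + psi ((f ^^ i) (prj w))"
        by (auto split: if_splits)
      then show ?thesis using True size[OF st] by simp
    next
      case False
      have "\<bar>(F ^^ Suc i) s - (F ^^ Suc i) t\<bar> \<le> \<Lambda> * \<bar>(F ^^ i) s - (F ^^ i) t\<bar>"
        using F_lipschitz[of "(F ^^ i) s" "(F ^^ i) t"] sZ ZD Fn_in by auto
      also have "\<dots> \<le> \<Lambda> * \<epsilon>" using small[OF st(1,2)] \<Lambda>_ge_1 by (intro mult_left_mono) auto
      finally show ?thesis using False \<Lambda>\<epsilon> by simp
    qed
  qed
qed

text \<open>Here |dF| exceeds \<open>exp (- K0)\<close> at the points of W, and \<epsilon> was
  chosen so that dF oscillates on the hull by less than \<open>min \<gamma> (1/2)\<close> times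
  this. The 1/2 excludes zeros; the \<gamma> gives the factor
  \<open>1 + \<gamma> \<le> exp \<gamma>\<close>.\<close>

lemma small_cell_noncritical:
  assumes W: "W \<subseteq> Z" and sc: "small_cell i W" and i: "i < n" and nc: "ll i < K0"
  shows "cell (Suc i) W"
proof (rule cell_SucI[OF W sc i])
  have bound: "dF \<tau> \<noteq> 0 \<and> \<bar>dF \<tau>\<bar> \<le> u ((f ^^ i) (prj s)) * exp \<gamma>"
    if \<tau>: "\<tau> \<in> convex_closure1 ((F ^^ i) ` W)" and s: "s \<in> W" for \<tau> s
  proof -
    obtain a b where ab: "a \<in> W" "b \<in> W" "(F ^^ i) a \<le> \<tau>" "\<tau> \<le> (F ^^ i) b"
      using \<tau> unfolding convex_closure1_def by auto
    have sD: "s \<in> D" using s W ZD by auto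
    have e1: "\<epsilon> * exp (vst i (prj s)) \<le> \<epsilon>" using \<epsilon> vst_nonpos[of i "prj s"] by simp
    have "\<bar>(F ^^ i) s - (F ^^ i) a\<bar> \<le> \<epsilon>" "\<bar>(F ^^ i) s - (F ^^ i) b\<bar> \<le> \<epsilon>"
      using sc s ab e1 unfolding small_cell_def by (meson order_trans)+
    then have near: "\<bar>\<tau> - (F ^^ i) s\<bar> \<le> \<epsilon>" using ab by linarith
    have \<tau>D: "\<tau> \<in> D" using \<tau> closure_in_D[of "(F ^^ i) ` W"] W ZD Fn_in by blast
    have osc: "\<bar>dF \<tau> - dF ((F ^^ i) s)\<bar> < min \<gamma> (1/2) * exp (- real K0)"
      by (rule dF_osc[OF \<tau>D Fn_in[OF sD] near])
    have us: "u ((f ^^ i) (prj s)) = \<bar>dF ((F ^^ i) s)\<bar>"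
      by (simp add: semiconj_n[OF sD] u_prj Fn_in[OF sD])
    let ?us = "u ((f ^^ i) (prj s))"
    have sZ: "s \<in> Z" using s W by auto
    have "real (lev ((f ^^ i) (prj s))) + 1 \<le> real K0" using nc ll_clev(1)[OF sZ i] by linarith
    then have "exp (- real K0) \<le> exp (- real (lev ((f ^^ i) (prj s))) - 1)" by simp
    then have low: "exp (- real K0) < ?us" using lev_window(1)[OF upos[OF sZ i]] by linarith
    have m1: "min \<gamma> (1/2) * exp (- real K0) \<le> (1/2) * exp (- real K0)" by (intro mult_right_mono) auto
    have m2: "min \<gamma> (1/2) * exp (- real K0) \<le> \<gamma> * exp (- real K0)" by (intro mult_right_mono) auto
    have m3: "\<gamma> * exp (- real K0) \<le> \<gamma> * ?us" using low \<gamma> by (intro mult_left_mono) auto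
    have e0: "0 < exp (- real K0)" by simp
    have "0 < \<bar>dF \<tau>\<bar>" using osc m1 low e0 unfolding us by linarith
    moreover have "\<bar>dF \<tau>\<bar> \<le> ?us * (1 + \<gamma>)"
    proof -
      have "\<bar>dF \<tau>\<bar> \<le> ?us + \<gamma> * ?us" using osc m2 m3 unfolding us by linarith
      then show ?thesis by (simp add: algebra_simps)
    qed
    moreover have "?us * (1 + \<gamma>) \<le> ?us * exp \<gamma>"
      using exp_ge_add_one_self[of \<gamma>] low e0 by (intro mult_left_mono) linarith+
    ultimately show ?thesis by auto
  qed
  show "dF \<tau> \<noteq> 0" if \<tau>: "\<tau> \<in> convex_closure1 ((F ^^ i) ` W)" for \<tau>
  proof -
    obtain a where "a \<in> W" using \<tau> unfolding convex_closure1_def by auto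
    then show ?thesis using bound[OF \<tau>] by blast
  qed
  fix s t w assume st: "s \<in> W" "t \<in> W" "w \<in> W"
  let ?us = "u ((f ^^ i) (prj w))"
  have sZ: "w \<in> Z" using st W by auto
  have up: "0 < ?us" using upos[OF sZ i] .
  have "\<bar>F ((F ^^ i) s) - F ((F ^^ i) t)\<bar> \<le> ?us * exp \<gamma> * \<bar>(F ^^ i) s - (F ^^ i) t\<bar>"
  proof (rule F_lipschitz_closure[of "(F ^^ i) ` W"])
    show "(F ^^ i) ` W \<subseteq> D" using W ZD Fn_in by blast
  qed (use bound st in auto)
  also have "\<dots> \<le> ?us * exp \<gamma> * (\<epsilon> * exp (vst i (prj w)))"
    using sc st up unfolding small_cell_def by (intro mult_left_mono) auto
  also have "\<dots> = \<epsilon> * exp (vst i (prj w) + psi ((f ^^ i) (prj w)))"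
    using up nc ll_clev(1)[OF sZ i] by (simp add: psi_def exp_add)
  finally show "\<bar>(F ^^ Suc i) s - (F ^^ Suc i) t\<bar> \<le> \<epsilon> * exp (vst i (prj w) + psi ((f ^^ i) (prj w)))"
    by simp
qed

lemma small_cell_critical:
  assumes W: "W \<subseteq> Z" and sc: "small_cell i W" and i: "i < n" and cr: "K0 \<le> ll i"
  shows "splits (B * exp (\<kappa> * real (ll i))) (cell (Suc i)) W"
proof (cases "W = {}")
  case True
  then have "cell (Suc i) W" by (simp add: cell_def no_fold_def convex_closure1_def)
  moreover have "1 * 1 \<le> B * exp (\<kappa> * real (ll i))" using B \<kappa>_pos by (intro mult_mono) auto
  ultimately show ?thesis using splits_mono[OF splits_1] by auto
next
  case False
  then obtain w where w: "w \<in> W" by auto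
  let ?g = "F ^^ i"
  have WD: "W \<subseteq> D" using W ZD by auto
  \<comment> \<open>The lemma on critical steps takes one size for the whole piece, whereas the
    bound by the state varies with the point. The exact diameter of the image lies below all these
    bounds at once.\<close>
  define \<Delta> where "\<Delta> = (\<lambda>(s,t). \<bar>?g s - ?g t\<bar>) ` (W \<times> W)"
  define \<delta> where "\<delta> = Sup \<Delta>"
  have ne: "\<Delta> \<noteq> {}" using w by (auto simp: \<Delta>_def)
  have ub: "d \<le> \<epsilon>" if "d \<in> \<Delta>" for d
  proof -
    obtain s t where st: "s \<in> W" "t \<in> W" "d = \<bar>?g s - ?g t\<bar>" using \<open>d \<in> \<Delta>\<close> by (auto simp: \<Delta>_def)
    have "\<epsilon> * exp (vst i (prj s)) \<le> \<epsilon>" using \<epsilon> vst_nonpos[of i "prj s"] by simp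
    then show ?thesis using sc st unfolding small_cell_def by force
  qed
  have bdd: "bdd_above \<Delta>" using ub by (rule bdd_aboveI)
  have in_\<delta>: "\<bar>?g s - ?g t\<bar> \<le> \<delta>" if "s \<in> W" "t \<in> W" for s t
    unfolding \<delta>_def using that by (intro cSup_upper bdd) (auto simp: \<Delta>_def)
  have \<delta>0: "0 \<le> \<delta>" using in_\<delta>[OF w w] by simp
  have \<delta>\<epsilon>: "\<delta> \<le> \<epsilon>" unfolding \<delta>_def using ne ub by (rule cSup_least)
  have \<delta>v: "\<delta> \<le> \<epsilon> * exp (vst i (prj s))" if s: "s \<in> W" for s
    unfolding \<delta>_def using ne
  proof (rule cSup_least)
    fix d assume "d \<in> \<Delta>"
    then show "d \<le> \<epsilon> * exp (vst i (prj s))"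
      using sc s unfolding small_cell_def \<Delta>_def by auto
  qed
  have YD: "?g ` W \<subseteq> D" using WD Fn_in by auto
  have diam: "\<forall>a\<in>?g ` W. \<forall>b\<in>?g ` W. \<bar>a - b\<bar> \<le> \<delta>" using in_\<delta> by auto
  have win: "\<forall>a\<in>?g ` W. exp (- real (ll i) - 1) < \<bar>dF a\<bar> \<and> \<bar>dF a\<bar> \<le> exp (- real (ll i))"
  proof
    fix a assume "a \<in> ?g ` W"
    then obtain s where s: "s \<in> W" "a = ?g s" by auto
    then have sZ: "s \<in> Z" and sD: "s \<in> D" using W WD by auto
    have "u ((f ^^ i) (prj s)) = \<bar>dF a\<bar>" by (simp add: semiconj_n[OF sD] u_prj Fn_in[OF sD] s)
    then show "exp (- real (ll i) - 1) < \<bar>dF a\<bar> \<and> \<bar>dF a\<bar> \<le> exp (- real (ll i))"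
      using lev_window[OF upos[OF sZ i]] ll_clev(3)[OF sZ i] cr K0 by auto
  qed
  have kk: "exp (2 - real (ll i)) * (\<epsilon> * exp v * exp (- \<kappa> * real (ll i))) = \<epsilon> * exp (v + (2 - (1 + \<kappa>) * real (ll i)))" for v
    by (simp add: mult_exp_exp mult_ac algebra_simps)
  show ?thesis
  proof (rule splits_mono[OF splits_vimage[OF crit[OF YD \<delta>0 \<delta>\<epsilon> diam win]]])
    fix V assume V: "V \<subseteq> W" and "(\<forall>a\<in>?g ` V. \<forall>b\<in>?g ` V. \<bar>a - b\<bar> \<le> \<delta> * exp (- \<kappa> * real (ll i))) \<and>
        (\<forall>t\<in>convex_closure1 (?g ` V). dF t \<noteq> 0 \<and> \<bar>dF t\<bar> \<le> exp (2 - real (ll i)))"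
    then have dV: "\<And>s t. s \<in> V \<Longrightarrow> t \<in> V \<Longrightarrow> \<bar>?g s - ?g t\<bar> \<le> \<delta> * exp (- \<kappa> * real (ll i))"
      and nz: "\<And>t. t \<in> convex_closure1 (?g ` V) \<Longrightarrow> dF t \<noteq> 0"
      and le: "\<And>t. t \<in> convex_closure1 (?g ` V) \<Longrightarrow> \<bar>dF t\<bar> \<le> exp (2 - real (ll i))" by auto
    have scV: "small_cell i V" using sc V no_fold_subset[OF _ V] unfolding small_cell_def by (meson subsetD)
    show "cell (Suc i) V"
    proof (rule cell_SucI[OF _ scV i nz])
      show "V \<subseteq> Z" using V W by auto
      fix s t w assume st: "s \<in> V" "t \<in> V" "w \<in> V"
      then have wW: "w \<in> W" "w \<in> Z" using V W by auto
      have "\<bar>F (?g s) - F (?g t)\<bar> \<le> exp (2 - real (ll i)) * \<bar>?g s - ?g t\<bar>"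
      proof (rule F_lipschitz_closure[of "?g ` V"])
        show "?g ` V \<subseteq> D" using V YD by auto
      qed (use le st in auto)
      also have "\<dots> \<le> exp (2 - real (ll i)) * (\<delta> * exp (- \<kappa> * real (ll i)))"
        using dV[OF st(1,2)] by (intro mult_left_mono) auto
      also have "\<dots> \<le> exp (2 - real (ll i)) * (\<epsilon> * exp (vst i (prj w)) * exp (- \<kappa> * real (ll i)))"
        using \<delta>v[OF wW(1)] by (intro mult_left_mono mult_right_mono) auto
      also have "\<dots> = \<epsilon> * exp (vst i (prj w) + psi ((f ^^ i) (prj w)))"
        unfolding kk using ll_clev(3)[OF wW(2) i] cr by (simp add: psi_def)
      finally show "\<bar>(F ^^ Suc i) s - (F ^^ Suc i) t\<bar> \<le> \<epsilon> * exp (vst i (prj w) + psi ((f ^^ i) (prj w)))"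
        by simp
    qed
  qed simp
qed

lemma step_cost_nonneg: "0 \<le> step_cost ll bb i"
  unfolding step_cost_def using \<epsilon> B by simp

lemma cell_splits:
  assumes V: "V \<subseteq> Z" and sh: "shadow n V"
  shows "i \<le> n \<Longrightarrow> splits (6 * (\<Prod>j<i. step_cost ll bb j)) (cell i) V"
proof (induction i)
  case 0
  \<comment> \<open>The initial cut of [0,1] into pieces of length 1/4; the factor 6 is the bound d
    + 2 of \<open>card_floor_near\<close> with d = 4.\<close>
  have "\<bar>4 * s - 4 * t\<bar> \<le> 4" if "s \<in> V" "t \<in> V" for s t :: real
  proof -
    have "s \<in> {0..1}" "t \<in> {0..1}" using V Z01 that by blast+
    then show ?thesis by (simp, linarith)
  qed
  note cf = card_floor_near[of 4 V "\<lambda>t. 4 * t", OF _ this]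
  have "splits 6 (cell 0) V"
  proof (rule splits_fibres[where g = "\<lambda>t. \<lfloor>4 * t\<rfloor>"])
    show "finite ((\<lambda>t. \<lfloor>4 * t\<rfloor>) ` V)" "real (card ((\<lambda>t. \<lfloor>4 * t\<rfloor>) ` V)) \<le> 6" using cf by auto
    fix v
    show "cell 0 {x \<in> V. \<lfloor>4 * x\<rfloor> = v}"
    proof -
      have "\<bar>s - t\<bar> \<le> 1/4" if "\<lfloor>4 * s\<rfloor> = v" "\<lfloor>4 * t\<rfloor> = v" for s t :: real
        using that by linarith
      then show ?thesis unfolding cell_def no_fold_def using not_bb_0 by auto
    qed
  qed
  then show ?case by simp
next
  case (Suc i)
  then have i: "i < n" by simp
  have "splits (6 * (\<Prod>j<i. step_cost ll bb j) * step_cost ll bb i) (cell (Suc i)) V"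
  proof (rule splits_trans[OF Suc.IH])
    fix W assume W: "W \<subseteq> V" "cell i W"
    then have WZ: "W \<subseteq> Z" using V by auto
    have shW: "shadow n W" using sh W(1) unfolding shadow_def by blast
    show "splits (step_cost ll bb i) (cell (Suc i)) W"
      unfolding step_cost_def
    proof (rule splits_trans[OF cell_start[OF WZ shW W(2) i]])
      fix U assume U: "U \<subseteq> W" "small_cell i U"
      then have UZ: "U \<subseteq> Z" using WZ by auto
      show "splits (if K0 \<le> ll i then B * exp (\<kappa> * real (ll i)) else 1) (cell (Suc i)) U"
        using small_cell_critical[OF UZ U(2) i] splits_1[where P = "cell (Suc i)" and W = U]
          small_cell_noncritical[OF UZ U(2) i]
        by (cases "K0 \<le> ll i") auto
    qed (use B in simp)
  qed (use i step_cost_nonneg in auto)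
  then show ?case by (simp add: mult_ac)
qed

text \<open>On a final cell every iterate is monotone and varies by at most 1, so
  \<open>card_monotone_names\<close> leaves linearly many names per cell, and the number of cells
  carries all exponential growth. The map from \<open>sec_index\<close> reads the name of a point of
  X off its lift.\<close>

lemma card_names:
  fixes K :: nat
  shows "real (card (itinerary f (\<lambda>x. \<lfloor>real K * sec x\<rfloor>) n ` prj ` Z)) \<le>
    C1 ^ Suc (card {j. j < n \<and> start j}) * exp (real (card {j. j < n \<and> good j}) * H) *
    (6 * (\<Prod>j<n. step_cost ll bb j)) * (real n * (real K + 1) + 1)"
proof -
  have "splits (C1 ^ Suc (card {j. j < n \<and> start j}) * exp (real (card {j. j < n \<and> good j}) * H) *
    (6 * (\<Prod>j<n. step_cost ll bb j))) (cell n) Z"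
    by (rule splits_trans[OF shadow_splits cell_splits])
      (auto intro!: mult_nonneg_nonneg prod_nonneg step_cost_nonneg)
  then have "real (card ((\<lambda>t. itinerary f (\<lambda>x. \<lfloor>real K * sec x\<rfloor>) n (prj t)) ` Z)) \<le>
    C1 ^ Suc (card {j. j < n \<and> start j}) * exp (real (card {j. j < n \<and> good j}) * H) *
    (6 * (\<Prod>j<n. step_cost ll bb j)) * (real n * (real K + 1) + 1)"
  proof (rule splits_card_image)
    fix W assume W: "W \<subseteq> Z" "cell n W"
    then have WD: "W \<subseteq> D" using ZD by auto
    obtain \<iota> where \<iota>: "\<And>t. t \<in> D \<Longrightarrow> \<lfloor>real K * sec (prj t)\<rfloor> = \<iota> \<lfloor>real K * t\<rfloor>"
      using sec_index by blast
    let ?a = "\<lambda>j t. \<lfloor>real K * (F ^^ j) t\<rfloor>"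
    have it: "itinerary f (\<lambda>x. \<lfloor>real K * sec x\<rfloor>) n (prj t) = map \<iota> (map (\<lambda>j. ?a j t) [0..<n])" if "t \<in> W" for t
      using WD that by (auto simp: itinerary_def semiconj_n \<iota> Fn_in subset_iff)
    have "mono_on W (?a j) \<or> antimono_on W (?a j)" if j: "j < n" for j
    proof -
      have fl: "\<lfloor>real K * x\<rfloor> \<le> \<lfloor>real K * y\<rfloor>" if "x \<le> y" for x y
        using that by (intro floor_mono mult_left_mono) auto
      have "mono_on W (F ^^ j) \<or> antimono_on W (F ^^ j)"
        using W(2) j no_fold_monotone[OF WD, of n j] unfolding cell_def by linarith
      then show ?thesis using fl unfolding monotone_on_def by auto
    qed
    moreover have "\<bar>real_of_int (?a j s) - real_of_int (?a j t)\<bar> \<le> real K + 1" if "j < n" "s \<in> W" "t \<in> W" for j s t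
    proof -
      have "\<bar>(F ^^ j) s - (F ^^ j) t\<bar> \<le> 1" using W(2) that unfolding cell_def by auto
      then have "real K * \<bar>(F ^^ j) s - (F ^^ j) t\<bar> \<le> real K * 1" by (intro mult_left_mono) auto
      then have "\<bar>real K * (F ^^ j) s - real K * (F ^^ j) t\<bar> \<le> real K"
        by (simp add: abs_mult right_diff_distrib[symmetric])
      then show ?thesis by linarith
    qed
    ultimately have cm: "finite ((\<lambda>t. map (\<lambda>j. ?a j t) [0..<n]) ` W)"
      "real (card ((\<lambda>t. map (\<lambda>j. ?a j t) [0..<n]) ` W)) \<le> real n * (real K + 1) + 1"
      using card_monotone_names[of n W ?a "real K + 1"] by auto
    have img: "(\<lambda>t. itinerary f (\<lambda>x. \<lfloor>real K * sec x\<rfloor>) n (prj t)) ` W = map \<iota> ` ((\<lambda>t. map (\<lambda>j. ?a j t) [0..<n]) ` W)"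
      unfolding image_image using it by (intro image_cong refl) auto
    show "finite ((\<lambda>t. itinerary f (\<lambda>x. \<lfloor>real K * sec x\<rfloor>) n (prj t)) ` W) \<and>
      real (card ((\<lambda>t. itinerary f (\<lambda>x. \<lfloor>real K * sec x\<rfloor>) n (prj t)) ` W)) \<le> real n * (real K + 1) + 1"
      unfolding img using cm card_image_le[OF cm(1), of "map \<iota>"] by (auto intro: order_trans[OF of_nat_mono])
  qed simp
  then show ?thesis by (simp add: image_image)
qed

end

end

text \<open>Every overhead is made a multiple of \<gamma>. The critical levels have total weight at
  most \<rho> by \<open>tail\<close>; a symbol that is neither critical nor a block end costs at
  most \<gamma> by \<open>\<rho>_small\<close>. \<open>K0_big\<close> charges the constants of a
  critical step to its level, and \<open>K1_big\<close> charges those of a block to the level of its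
  first step.\<close>

locale weighted_coding = coding +
  fixes \<rho> CR :: real
  assumes \<rho>: "0 < \<rho>" "\<rho> < 1" and \<rho>_small: "- 2 * ln (1 - \<rho>) \<le> \<gamma>"
    and tail: "finite S \<Longrightarrow> (\<Sum>k\<in>{k\<in>S. K0 \<le> k}. exp (- \<gamma> * real k)) \<le> \<rho>"
    and CR: "1 \<le> CR" "\<And>l t. t \<in> D \<Longrightarrow> (\<Prod>i<l. \<bar>dF ((F ^^ i) t)\<bar>) \<le> CR * exp (real l * (R + \<gamma>))"
    and K0_big: "ln CR + 2 \<le> \<gamma> * real K0" "ln B \<le> \<gamma> * real K0"
    and K1_big: "ln C1 + ln (1 / \<epsilon> + 2) - ln \<rho> \<le> \<gamma> * real K1"
begin

definition weight :: "nat \<times> bool \<Rightarrow> real" where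
  "weight s = (if fst s = 0 then 1 - \<rho> else if K0 \<le> fst s then exp (- \<gamma> * real (fst s)) else 0) *
     (if snd s then \<rho> else 1 - \<rho>)"

definition block_end :: "nat \<Rightarrow> 'a \<Rightarrow> bool" where
  "block_end i x \<longleftrightarrow> vst i x < 0 \<and> \<not> vst (Suc i) x < 0"

text \<open>Block starts are not recorded: they are the deep steps outside blocks, so levels and
  block ends determine all bad times (\<open>vst_Suc_neg\<close>). The real value of the state is
  never coded.\<close>

definition tag :: "nat \<Rightarrow> 'a \<Rightarrow> (nat \<times> bool) list" where
  "tag n x = map (\<lambda>i. (clev ((f ^^ i) x), block_end i x)) [0..<n]"

lemma weight_nonneg: "0 \<le> weight s"
  using \<rho> by (auto simp: weight_def)

lemma sum_weight_le_1:
  assumes S: "finite S"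
  shows "sum weight S \<le> 1"
proof -
  let ?p = "\<lambda>c::nat. if c = 0 then 1 - \<rho> else if K0 \<le> c then exp (- \<gamma> * real c) else 0"
  let ?q = "\<lambda>e. if e then \<rho> else 1 - \<rho>"
  have p0: "0 \<le> ?p c" for c using \<rho> by auto
  have "sum weight S \<le> sum weight (fst ` S \<times> UNIV)"
    using S weight_nonneg by (intro sum_mono2) force+
  also have "\<dots> = (\<Sum>c\<in>fst ` S. ?p c) * (\<Sum>e\<in>UNIV. ?q e)"
    unfolding weight_def by (simp add: sum_product sum.cartesian_product case_prod_unfold)
  also have "(\<Sum>e\<in>UNIV. ?q e) = 1" by (simp add: UNIV_bool)
  also have "(\<Sum>c\<in>fst ` S. ?p c) \<le> (\<Sum>c\<in>insert 0 (fst ` S). ?p c)"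
    using S p0 by (intro sum_mono2) auto
  also have "\<dots> = 1 - \<rho> + (\<Sum>c\<in>fst ` S - {0}. ?p c)"
    using S by (subst sum.insert_remove) auto
  also have "(\<Sum>c\<in>fst ` S - {0}. ?p c) = (\<Sum>c\<in>{c\<in>fst ` S. K0 \<le> c}. exp (- \<gamma> * real c))"
    using S K0 by (intro sum.mono_neutral_cong_right) auto
  also have "\<dots> \<le> \<rho>" using S by (intro tail) simp
  finally show ?thesis by simp
qed

lemma vst_Suc_neg: "vst (Suc i) x < 0 \<longleftrightarrow>
   (if vst i x < 0 then \<not> block_end i x else K1 \<le> clev ((f ^^ i) x))"
proof (cases "vst i x < 0")
  case False
  then have "vst i x = 0" using vst_nonpos[of i x] by simp
  then show ?thesis using deep_psi[of "(f ^^ i) x"] by (auto simp: clev(2))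
qed (simp add: block_end_def)

lemma tag_eqD:
  assumes "tag n x = tag n y"
  shows "i < n \<Longrightarrow> clev ((f ^^ i) x) = clev ((f ^^ i) y)" "i \<le> n \<Longrightarrow> (vst i x < 0) = (vst i y < 0)"
proof -
  have eq: "clev ((f ^^ i) x) = clev ((f ^^ i) y) \<and> block_end i x = block_end i y" if "i < n" for i
    using arg_cong[OF assms, of "\<lambda>T. T ! i"] that by (simp add: tag_def)
  show "i < n \<Longrightarrow> clev ((f ^^ i) x) = clev ((f ^^ i) y)" using eq by blast
  show "i \<le> n \<Longrightarrow> (vst i x < 0) = (vst i y < 0)"
  proof (induction i)
    case (Suc i)
    then show ?case using eq[of i] unfolding vst_Suc_neg[of i x] vst_Suc_neg[of i y] by auto
  qed simp
qed

section \<open>Bad blocks along a single orbit\<close>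

definition pos_orbit :: "'a set" where
  "pos_orbit = {x\<in>X. \<forall>i. 0 < u ((f ^^ i) x)}"

abbreviation "isbad i x \<equiv> vst i x < 0 \<or> K1 \<le> lev ((f ^^ i) x)"
abbreviation "isstart i x \<equiv> \<not> vst i x < 0 \<and> K1 \<le> lev ((f ^^ i) x)"
abbreviation "iscrit i x \<equiv> K0 \<le> lev ((f ^^ i) x)"

definition bad_levels :: "nat \<Rightarrow> 'a \<Rightarrow> real" where
  "bad_levels n x = (\<Sum>i<n. if isbad i x \<and> iscrit i x then real (lev ((f ^^ i) x)) else 0)"

definition moderate :: "'a \<Rightarrow> real" where
  "moderate x = (if K0 \<le> lev x \<and> lev x < K1 then real (lev x) else 0)"

definition deep :: "'a \<Rightarrow> real" where
  "deep x = (if K1 \<le> lev x then real (lev x) else 0)"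

lemma birk_deep_le: "birk f deep n x \<le> bad_levels n x"
  unfolding birk_def bad_levels_def using K01 by (intro sum_mono) (auto simp: deep_def)

text \<open>The state is a walk with steps \<open>psi\<close>, reflected at 0 and held there at good
  times; its depth is at most the drop of the Birkhoff sums of \<open>psi\<close> from their running
  maximum. If \<open>psi\<close> has positive mean, this drop has mean o(n) by
  \<open>maxbirk_growth\<close>.\<close>

lemma vst_ge: "- vst n x \<le> maxbirk f psi n x - birk f psi n x"
proof (induction n)
  case (Suc n)
  have b: "birk f psi (Suc n) x = birk f psi n x + psi ((f ^^ n) x)" by (simp add: birk_def)
  note m = birk_le_maxbirk[of f psi "Suc n" x] maxbirk_mono[of f psi n x]
  show ?case
  proof (cases "isbad n x")
    case True
    then have "vst (Suc n) x = min 0 (vst n x + psi ((f ^^ n) x))" by simp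
    then show ?thesis using Suc m b by linarith
  next
    case False
    then have "vst (Suc n) x = 0" by simp
    then show ?thesis using m by linarith
  qed
qed (simp add: birk_def)

lemma vst_le_sum: "vst n x \<le> (\<Sum>i<n. if isbad i x then psi ((f ^^ i) x) else 0)"
  by (induction n) auto

lemma ln_growth:
  assumes x: "x \<in> pos_orbit"
  shows "(\<Sum>i<l. ln (u ((f ^^ (s + i)) x))) \<le> ln CR + real l * (R + \<gamma>)"
proof -
  have xX: "x \<in> X" and up: "\<And>i. 0 < u ((f ^^ i) x)" using x by (auto simp: pos_orbit_def)
  define t where "t = (F ^^ s) (sec x)"
  have sD: "sec x \<in> D" using sec(1) xX .
  then have tD: "t \<in> D" by (simp add: t_def Fn_in)
  have eq: "u ((f ^^ (s + i)) x) = \<bar>dF ((F ^^ i) t)\<bar>" for i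
  proof -
    have "(f ^^ (s + i)) x = prj ((F ^^ (i + s)) (sec x))"
      using semiconj_n[OF sD, of "s + i"] sec(4)[OF xX] by (simp add: add.commute)
    then have "u ((f ^^ (s + i)) x) = \<bar>dF ((F ^^ (i + s)) (sec x))\<bar>" using u_prj[OF Fn_in[OF sD]] by simp
    then show ?thesis by (simp add: funpow_add t_def)
  qed
  have "(\<Sum>i<l. ln (u ((f ^^ (s + i)) x))) = ln (\<Prod>i<l. u ((f ^^ (s + i)) x))"
    by (rule ln_prod[symmetric]) (use up in \<open>auto simp: less_imp_neq[THEN not_sym]\<close>)
  also have "\<dots> \<le> ln (CR * exp (real l * (R + \<gamma>)))"
  proof -
    have "0 < (\<Prod>i<l. u ((f ^^ (s + i)) x))" using up by (intro prod_pos) auto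
    moreover have "(\<Prod>i<l. u ((f ^^ (s + i)) x)) \<le> CR * exp (real l * (R + \<gamma>))"
      unfolding eq using CR(2)[OF tD] .
    ultimately show ?thesis by simp
  qed
  also have "\<dots> = ln CR + real l * (R + \<gamma>)" using CR(1) by (simp add: ln_mult)
  finally show ?thesis .
qed

text \<open>The growth bound is applied to each maximal run of times satisfying P, which costs the
  constant \<open>ln CR\<close> once per run.\<close>

lemma ln_growth_runs:
  assumes x: "x \<in> pos_orbit"
  shows "(\<Sum>i<n. if P i then ln (u ((f ^^ i) x)) else 0) \<le>
    (R + \<gamma>) * real (card {i. i < n \<and> P i}) + ln CR * real (card {i. i < n \<and> P i \<and> (i = 0 \<or> \<not> P (i - 1))})"
proof -
  let ?S = "\<lambda>n. \<Sum>i<n. if P i then ln (u ((f ^^ i) x)) else 0"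
  let ?c = "\<lambda>n. real (card {i. i < n \<and> P i})"
  let ?r = "\<lambda>n. real (card {i. i < n \<and> P i \<and> (i = 0 \<or> \<not> P (i - 1))})"
  have lnCR: "0 \<le> ln CR" using CR(1) by simp
  have close: "?S n \<le> (R + \<gamma>) * ?c n + ln CR * ?r n"
    if s: "s \<le> n" "\<And>j. s \<le> j \<Longrightarrow> j < n \<Longrightarrow> P j" "s = 0 \<or> \<not> P (s - 1)"
      and b: "?S s \<le> (R + \<gamma>) * ?c s + ln CR * ?r s" for s n
  proof (cases "s = n")
    case True
    then show ?thesis using b by simp
  next
    case False
    then have sn: "s < n" using s by simp
    have "?S n = ?S s + (\<Sum>i<n - s. ln (u ((f ^^ (s + i)) x)))"
    proof -
      have "?S n = ?S s + (\<Sum>i\<in>{s..<n}. if P i then ln (u ((f ^^ i) x)) else 0)"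
        using s(1) by (simp add: lessThan_atLeast0 sum.atLeastLessThan_concat)
      also have "(\<Sum>i\<in>{s..<n}. if P i then ln (u ((f ^^ i) x)) else 0) = (\<Sum>i\<in>{s..<n}. ln (u ((f ^^ i) x)))"
        using s(2) by (intro sum.cong) auto
      also have "\<dots> = (\<Sum>i<n - s. ln (u ((f ^^ (s + i)) x)))"
        by (rule sum.reindex_bij_witness[of _ "\<lambda>i. s + i" "\<lambda>i. i - s"]) auto
      finally show ?thesis .
    qed
    also have "\<dots> \<le> ((R + \<gamma>) * ?c s + ln CR * ?r s) + (ln CR + real (n - s) * (R + \<gamma>))"
      using b ln_growth[OF x, of s "n - s"] by linarith
    also have "\<dots> \<le> (R + \<gamma>) * ?c n + ln CR * ?r n"
    proof -
      have "{i. i < n \<and> P i} = {i. i < s \<and> P i} \<union> {s..<n}" using s by auto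
      then have "card {i. i < n \<and> P i} = card {i. i < s \<and> P i} + (n - s)"
        by (simp add: card_Un_disjoint disjoint_iff)
      then have 1: "?c n = ?c s + real (n - s)" by simp
      have "insert s {i. i < s \<and> P i \<and> (i = 0 \<or> \<not> P (i - 1))} \<subseteq> {i. i < n \<and> P i \<and> (i = 0 \<or> \<not> P (i - 1))}"
        using s sn by auto
      then have "card (insert s {i. i < s \<and> P i \<and> (i = 0 \<or> \<not> P (i - 1))}) \<le> card {i. i < n \<and> P i \<and> (i = 0 \<or> \<not> P (i - 1))}"
        by (intro card_mono) auto
      then have "?r s + 1 \<le> ?r n" by simp
      then have "ln CR * (?r s + 1) \<le> ln CR * ?r n" using lnCR by (intro mult_left_mono) auto
      then show ?thesis unfolding 1 by (simp add: algebra_simps)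
    qed
    finally show ?thesis .
  qed
  have "\<exists>s\<le>n. (\<forall>j. s \<le> j \<longrightarrow> j < n \<longrightarrow> P j) \<and> (s = 0 \<or> \<not> P (s - 1)) \<and> ?S s \<le> (R + \<gamma>) * ?c s + ln CR * ?r s" for n
  proof (induction n)
    case (Suc n)
    then obtain s where s: "s \<le> n" "\<And>j. s \<le> j \<Longrightarrow> j < n \<Longrightarrow> P j" "s = 0 \<or> \<not> P (s - 1)"
      "?S s \<le> (R + \<gamma>) * ?c s + ln CR * ?r s" by auto
    show ?case
    proof (cases "P n")
      case True
      then show ?thesis using s by (intro exI[of _ s]) (auto simp: less_Suc_eq)
    next
      case False
      have "?S n \<le> (R + \<gamma>) * ?c n + ln CR * ?r n" by (rule close[OF s])
      moreover have "{i. i < Suc n \<and> P i} = {i. i < n \<and> P i}"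
        "{i. i < Suc n \<and> P i \<and> (i = 0 \<or> \<not> P (i - 1))} = {i. i < n \<and> P i \<and> (i = 0 \<or> \<not> P (i - 1))}"
        using False by (auto simp: less_Suc_eq)
      ultimately show ?thesis using False by (intro exI[of _ "Suc n"]) auto
    qed
  qed auto
  from this[of n] close show ?thesis by blast
qed

text \<open>Over the bad times, what the critical steps lose must be regained by the others, up to
  the depth of the block open at time n. The gain is at most about R per step by the growth bound.
  Its constant \<open>ln CR\<close> per run, like the constant 2 in \<open>psi\<close>, is charged
  to critical steps, whose levels are at least \<open>K0\<close>.\<close>

lemma bad_levels_le:
  assumes x: "x \<in> pos_orbit"
  shows "(1 + \<kappa> - \<gamma>) * bad_levels n x \<le>
    (R + 2 * \<gamma>) * real (card {i. i < n \<and> isbad i x}) + (maxbirk f psi n x - birk f psi n x)"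
proof -
  let ?P = "\<lambda>i. isbad i x \<and> \<not> iscrit i x"
  let ?Q = "\<lambda>i. isbad i x \<and> iscrit i x"
  let ?cP = "real (card {i. i < n \<and> ?P i})" and ?cQ = "real (card {i. i < n \<and> ?Q i})"
  have ind: "(\<Sum>i<n. if S i then c else 0) = c * real (card {i. i < n \<and> S i})" for S and c :: real
  proof -
    have "(\<Sum>i<n. if S i then c else 0) = (\<Sum>i\<in>{i. i < n \<and> S i}. c)"
      by (rule sum.mono_neutral_cong_right) auto
    then show ?thesis by simp
  qed
  have split: "(\<Sum>i<n. if isbad i x then psi ((f ^^ i) x) else 0) =
      (\<Sum>i<n. if ?P i then ln (u ((f ^^ i) x)) else 0) + \<gamma> * ?cP + 2 * ?cQ - (1 + \<kappa>) * bad_levels n x"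
    unfolding ind[symmetric] bad_levels_def sum_distrib_left sum.distrib[symmetric] sum_subtractf[symmetric]
    by (intro sum.cong) (auto simp: psi_def)
  \<comment> \<open>Every run of non-critical bad times follows immediately after a critical bad
    step, since blocks begin with a deep step. So there are at most as many runs as critical bad
    steps.\<close>
  have "{i. i < n \<and> ?P i \<and> (i = 0 \<or> \<not> ?P (i - 1))} \<subseteq> Suc ` {i. i < n \<and> ?Q i}"
  proof
    fix i assume "i \<in> {i. i < n \<and> ?P i \<and> (i = 0 \<or> \<not> ?P (i - 1))}"
    then have i: "i < n" "isbad i x" "\<not> iscrit i x" "i = 0 \<or> \<not> ?P (i - 1)" by auto
    then have neg: "vst i x < 0" using K01 by auto
    then obtain j where j: "i = Suc j" by (cases i) auto
    then have "isbad j x" using neg by (auto split: if_splits)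
    then have "?Q j" using i(4) j by auto
    then show "i \<in> Suc ` {i. i < n \<and> ?Q i}" using i(1) j by auto
  qed
  then have "card {i. i < n \<and> ?P i \<and> (i = 0 \<or> \<not> ?P (i - 1))} \<le> card {i. i < n \<and> ?Q i}"
    by (rule surj_card_le[rotated]) simp
  then have runs: "ln CR * real (card {i. i < n \<and> ?P i \<and> (i = 0 \<or> \<not> ?P (i - 1))}) \<le> ln CR * ?cQ"
    using CR(1) by (intro mult_left_mono) auto
  have cQ: "real K0 * ?cQ \<le> bad_levels n x"
    unfolding ind[symmetric] bad_levels_def by (intro sum_mono) auto
  have "(ln CR + 2) * ?cQ \<le> (\<gamma> * real K0) * ?cQ" using K0_big by (intro mult_right_mono) auto
  also have "\<dots> \<le> \<gamma> * bad_levels n x" using mult_left_mono[OF cQ, of \<gamma>] \<gamma> by (simp add: mult_ac)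
  finally have q: "(ln CR + 2) * ?cQ \<le> \<gamma> * bad_levels n x" .
  have "card {i. i < n \<and> ?P i} \<le> card {i. i < n \<and> isbad i x}" by (intro card_mono) auto
  then have "(R + 2 * \<gamma>) * ?cP \<le> (R + 2 * \<gamma>) * real (card {i. i < n \<and> isbad i x})"
    using R_nonneg \<gamma> by (intro mult_left_mono) auto
  moreover have "(R + 2 * \<gamma>) * ?cP = (R + \<gamma>) * ?cP + \<gamma> * ?cP" by (simp add: algebra_simps)
  moreover have "(ln CR + 2) * ?cQ = ln CR * ?cQ + 2 * ?cQ" by (simp add: algebra_simps)
  moreover have "(1 + \<kappa> - \<gamma>) * bad_levels n x = (1 + \<kappa>) * bad_levels n x - \<gamma> * bad_levels n x"
    by (simp add: algebra_simps)
  ultimately show ?thesis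
    using ln_growth_runs[OF x, of ?P n] runs q vst_le_sum[of n x] vst_ge[of n x] split by linarith
qed

lemma weight_pos: "0 < weight (clev y, e)"
  using \<rho> by (auto simp: weight_def clev_def)

lemma prod_list_weight:
  "prod_list (map weight (tag n x)) = (\<Prod>i<n. weight (clev ((f ^^ i) x), block_end i x))"
  by (simp add: tag_def o_def prod.list_conv_set_nth atLeast0LessThan)

lemma ln_prod_list_weight:
  "ln (prod_list (map weight (tag n x))) = (\<Sum>i<n. ln (weight (clev ((f ^^ i) x), block_end i x)))"
  unfolding prod_list_weight
  by (rule ln_prod) (use weight_pos in \<open>auto simp: less_imp_neq[THEN not_sym]\<close>)

text \<open>An ended block has a start of its own, and a block still open has a start without an
  end. The symbols for block ends, of cost \<open>- ln \<rho>\<close>, can thus be charged to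
  starts.\<close>

lemma block_ends_le_starts:
  "(\<Sum>i<n. if block_end i x then 1 else 0) + (if vst n x < 0 then 1 else 0) \<le> (\<Sum>i<n. if isstart i x then 1 else (0::real))"
proof (induction n)
  case (Suc n)
  show ?case
    using Suc vst_Suc_neg[of n x] clev(2)[of "(f ^^ n) x"] unfolding sum.lessThan_Suc block_end_def
    by (cases "vst n x < 0"; cases "vst (Suc n) x < 0") auto
qed simp

lemma code_length_le:
  assumes x: "x \<in> pos_orbit" and H: "0 \<le> H"
  shows "ln (real (card (itinerary f (\<lambda>x. \<lfloor>real K * sec x\<rfloor>) n ` {y\<in>pos_orbit. tag n y = tag n x})))
      - ln (prod_list (map weight (tag n x)))
    \<le> ln C1 + ln 6 + ln (real n * (real K + 1) + 1) + real n * \<gamma> + (real n - real (card {i. i < n \<and> isbad i x})) * H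
      + (\<kappa> + 3 * \<gamma>) * bad_levels n x + (\<kappa> + 2 * \<gamma>) * birk f moderate n x"
proof -
  let ?Y = "{y\<in>pos_orbit. tag n y = tag n x}"
  define Z where "Z = sec ` ?Y"
  define ll where "ll i = clev ((f ^^ i) x)" for i
  define bb where "bb i = (vst i x < 0)" for i
  have YX: "?Y \<subseteq> X" by (auto simp: pos_orbit_def)
  have xY: "x \<in> ?Y" using x by simp
  have ZD: "Z \<subseteq> D" "Z \<subseteq> {0..1}" using YX sec unfolding Z_def by (auto 0 3)
  have prjZ: "prj ` Z = ?Y" unfolding Z_def image_image using sec(4) YX by (auto simp: subset_iff)
  have pt: "prj t \<in> ?Y" if "t \<in> Z" for t using prjZ that by blast
  have c1: "clev ((f ^^ i) (prj t)) = ll i" if "t \<in> Z" "i < n" for t i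
    using tag_eqD(1)[of n "prj t" x i] pt[OF that(1)] that(2) by (simp add: ll_def)
  have c2: "0 < u ((f ^^ i) (prj t))" if "t \<in> Z" "i < n" for t i
    using pt[OF that(1)] by (simp add: pos_orbit_def)
  have c3: "(vst i (prj t) < 0) = bb i" if "t \<in> Z" "i \<le> n" for t i
    using tag_eqD(2)[of n "prj t" x i] pt[OF that(1)] that(2) by (simp add: bb_def)
  have Zne: "Z \<noteq> {}" using xY by (auto simp: Z_def)
  note cn = card_names[where K = K and n = n, OF ZD c1 c2 c3 Zne]
  let ?st = "{j. j < n \<and> \<not> bb j \<and> K1 \<le> ll j}" and ?gd = "{j. j < n \<and> \<not> bb j \<and> ll j < K1}"
  let ?sc = "step_cost ll bb"
  have st: "?st = {i. i < n \<and> isstart i x}" by (auto simp: bb_def ll_def clev(2))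
  have gd: "real (card ?gd) = real n - real (card {i. i < n \<and> isbad i x})"
  proof -
    have "?gd = {i. i < n \<and> \<not> isbad i x}" using clev(2) by (auto simp: bb_def ll_def not_le[symmetric])
    moreover have "{i. i < n \<and> \<not> isbad i x} \<union> {i. i < n \<and> isbad i x} = {..<n}" by auto
    then have "card {i. i < n \<and> \<not> isbad i x} + card {i. i < n \<and> isbad i x} = card {..<n}"
      by (subst card_Un_disjoint[symmetric]) auto
    ultimately show ?thesis by simp
  qed
  have sc: "?sc i = (if isstart i x then 1 / \<epsilon> + 2 else 1) * (if iscrit i x then B * exp (\<kappa> * real (lev ((f ^^ i) x))) else 1)" for i
    using clev[of "(f ^^ i) x"] unfolding step_cost_def by (auto simp: bb_def ll_def)
  have \<epsilon>2: "0 < 1 / \<epsilon> + 2" using \<epsilon> by (simp add: add_pos_pos)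
  have scpos: "0 < ?sc i" for i unfolding sc using \<epsilon>2 B by auto
  have fin: "finite (itinerary f (\<lambda>x. \<lfloor>real K * sec x\<rfloor>) n ` ?Y)"
  proof -
    have "itinerary f (\<lambda>x. \<lfloor>real K * sec x\<rfloor>) n ` ?Y \<subseteq> {s. set s \<subseteq> {0..int K} \<and> length s = n}"
    proof clarify
      fix y assume y: "y \<in> pos_orbit"
      have "(f ^^ i) y \<in> X" for i
        using semiconj_n[of "sec y" i] sec[of y] y prj_in Fn_in by (auto simp: pos_orbit_def)
      then have b: "0 \<le> sec ((f ^^ i) y)" "sec ((f ^^ i) y) \<le> 1" for i using sec by auto
      have "\<lfloor>real K * sec ((f ^^ i) y)\<rfloor> \<in> {0..int K}" for i
      proof -
        have "0 \<le> real K * sec ((f ^^ i) y)" "real K * sec ((f ^^ i) y) \<le> real K * 1"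
          using mult_left_mono[OF b(2)[of i], of "real K"] b(1)[of i] by simp_all
        then show ?thesis by (auto simp: le_floor_iff floor_le_iff)
      qed
      then show "set (itinerary f (\<lambda>x. \<lfloor>real K * sec x\<rfloor>) n y) \<subseteq> {0..int K} \<and>
          length (itinerary f (\<lambda>x. \<lfloor>real K * sec x\<rfloor>) n y) = n"
        by (auto simp: itinerary_def)
    qed
    then show ?thesis by (rule finite_subset) (rule finite_lists_length_eq, simp)
  qed
  let ?N = "real (card (itinerary f (\<lambda>x. \<lfloor>real K * sec x\<rfloor>) n ` ?Y))"
  have N1: "0 < ?N" using fin xY card_gt_0_iff by fastforce
  have "ln ?N \<le> ln (C1 ^ Suc (card ?st) * exp (real (card ?gd) * H) * (6 * (\<Prod>j<n. ?sc j)) * (real n * (real K + 1) + 1))"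
    by (rule ln_mono[OF cn[unfolded prjZ] N1])
  also have "\<dots> = real (Suc (card ?st)) * ln C1 + real (card ?gd) * H + (ln 6 + (\<Sum>j<n. ln (?sc j))) + ln (real n * (real K + 1) + 1)"
  proof -
    have p: "0 < (\<Prod>j<n. ?sc j)" using scpos by (intro prod_pos) auto
    have nk: "0 < real n * (real K + 1) + 1" by (simp add: add_nonneg_pos)
    have c: "0 < C1" using C1 by simp
    have "ln (\<Prod>j<n. ?sc j) = (\<Sum>j<n. ln (?sc j))"
      by (rule ln_prod) (use scpos in \<open>auto simp: less_imp_neq[THEN not_sym]\<close>)
    then show ?thesis using p nk c
      by (simp add: ln_mult_pos ln_realpow mult_pos_pos zero_less_power del: of_nat_Suc power_Suc)
  qed
  finally have lnN: "ln ?N \<le> real (Suc (card ?st)) * ln C1 + real (card ?gd) * H + (ln 6 + (\<Sum>j<n. ln (?sc j))) + ln (real n * (real K + 1) + 1)" .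
  have cst: "real (card {i. i < n \<and> isstart i x}) = (\<Sum>i<n. if isstart i x then 1 else 0)"
    by (simp add: sum.If_cases Int_def)
  let ?C3 = "ln C1 + ln (1 / \<epsilon> + 2) - ln \<rho>"
  have ln\<rho>: "ln \<rho> \<le> 0" using \<rho> by simp
  have step: "ln (?sc i) - ln (weight (clev ((f ^^ i) x), block_end i x)) \<le>
      \<gamma> + ln (1 / \<epsilon> + 2) * (if isstart i x then 1 else 0) - ln \<rho> * (if block_end i x then 1 else 0)
      + (\<kappa> + 2 * \<gamma>) * (if iscrit i x then real (lev ((f ^^ i) x)) else 0)" for i
  proof -
    let ?k = "lev ((f ^^ i) x)"
    have l1: "0 \<le> - ln (1 - \<rho>)" using \<rho> by simp
    have e: "- ln (if block_end i x then \<rho> else 1 - \<rho>) \<le> - ln (1 - \<rho>) - ln \<rho> * (if block_end i x then 1 else 0)"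
      using l1 by auto
    show ?thesis
    proof (cases "iscrit i x")
      case True
      then have ck: "clev ((f ^^ i) x) = ?k" "?k \<noteq> 0" using K0 by (auto simp: clev_def)
      have "\<gamma> * real K0 \<le> \<gamma> * real ?k" using True \<gamma> by (intro mult_left_mono) auto
      then have Bk: "ln B \<le> \<gamma> * real ?k" using K0_big by linarith
      have w: "ln (weight (clev ((f ^^ i) x), block_end i x)) = - \<gamma> * real ?k + ln (if block_end i x then \<rho> else 1 - \<rho>)"
        unfolding weight_def using ck True \<rho> by (subst ln_mult_pos) auto
      have "ln (?sc i) = ln (1 / \<epsilon> + 2) * (if isstart i x then 1 else 0) + ln B + \<kappa> * real ?k"
        unfolding sc using True \<epsilon>2 B by (auto simp: ln_mult_pos)
      then show ?thesis using True w e Bk l1 \<rho>_small by (simp add: algebra_simps)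
    next
      case False
      then have ck: "clev ((f ^^ i) x) = 0" by (simp add: clev_def)
      have w: "ln (weight (clev ((f ^^ i) x), block_end i x)) = ln (1 - \<rho>) + ln (if block_end i x then \<rho> else 1 - \<rho>)"
        unfolding weight_def using ck \<rho> by (subst ln_mult_pos) auto
      have "ln (?sc i) = ln (1 / \<epsilon> + 2) * (if isstart i x then 1 else 0)"
        unfolding sc using False by auto
      then show ?thesis using False w e \<rho>_small by simp
    qed
  qed
  have "(\<Sum>i<n. ln (?sc i)) - (\<Sum>i<n. ln (weight (clev ((f ^^ i) x), block_end i x))) \<le>
    (\<Sum>i<n. \<gamma> + ln (1 / \<epsilon> + 2) * (if isstart i x then 1 else 0) - ln \<rho> * (if block_end i x then 1 else 0)
      + (\<kappa> + 2 * \<gamma>) * (if iscrit i x then real (lev ((f ^^ i) x)) else 0))"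
    unfolding sum_subtractf[symmetric] by (intro sum_mono step)
  also have "\<dots> = real n * \<gamma> + ln (1 / \<epsilon> + 2) * real (card ?st) - ln \<rho> * (\<Sum>i<n. if block_end i x then 1 else 0)
      + (\<kappa> + 2 * \<gamma>) * (\<Sum>i<n. if iscrit i x then real (lev ((f ^^ i) x)) else 0)"
    unfolding st cst by (simp add: sum.distrib sum_subtractf sum_distrib_left)
  finally have steps: "(\<Sum>i<n. ln (?sc i)) - (\<Sum>i<n. ln (weight (clev ((f ^^ i) x), block_end i x))) \<le> \<dots>" .
  have "(\<Sum>i<n. if block_end i x then 1 else 0) \<le> real (card ?st)"
    using block_ends_le_starts[where x = x and n = n] unfolding st cst by (auto split: if_splits)
  then have ends: "- ln \<rho> * (\<Sum>i<n. if block_end i x then 1 else 0) \<le> - ln \<rho> * real (card ?st)"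
    using ln\<rho> by (intro mult_left_mono) auto
  have "(\<Sum>i<n. if iscrit i x then real (lev ((f ^^ i) x)) else 0) \<le> bad_levels n x + birk f moderate n x"
    unfolding bad_levels_def birk_def sum.distrib[symmetric] by (intro sum_mono) (auto simp: moderate_def)
  then have crits: "(\<kappa> + 2 * \<gamma>) * (\<Sum>i<n. if iscrit i x then real (lev ((f ^^ i) x)) else 0)
      \<le> (\<kappa> + 2 * \<gamma>) * (bad_levels n x + birk f moderate n x)"
    using \<kappa>_pos \<gamma> by (intro mult_left_mono) auto
  \<comment> \<open>Each block starts at a step of level at least \<open>K1\<close>, so the number
    of blocks is at most \<open>bad_levels / K1\<close>.\<close>
  have "real K1 * real (card ?st) \<le> bad_levels n x"
    unfolding st cst sum_distrib_left bad_levels_def using K01 by (intro sum_mono) auto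
  then have "\<gamma> * (real K1 * real (card ?st)) \<le> \<gamma> * bad_levels n x" using \<gamma> by (intro mult_left_mono) auto
  moreover have "?C3 * real (card ?st) \<le> (\<gamma> * real K1) * real (card ?st)"
    using K1_big by (intro mult_right_mono) auto
  ultimately have starts: "?C3 * real (card ?st) \<le> \<gamma> * bad_levels n x" by (simp add: mult_ac)
  have e1: "?C3 * real (card ?st) = ln C1 * real (card ?st) + ln (1 / \<epsilon> + 2) * real (card ?st) - ln \<rho> * real (card ?st)"
    by (simp add: algebra_simps)
  have e2: "real (Suc (card ?st)) * ln C1 = ln C1 + ln C1 * real (card ?st)" by (simp add: algebra_simps)
  have e3: "(\<kappa> + 3 * \<gamma>) * bad_levels n x + (\<kappa> + 2 * \<gamma>) * birk f moderate n x
     = (\<kappa> + 2 * \<gamma>) * (bad_levels n x + birk f moderate n x) + \<gamma> * bad_levels n x" by (simp add: algebra_simps)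
  show ?thesis
    using lnN steps ends crits starts e1 e2 e3 unfolding ln_prod_list_weight gd by linarith
qed

text \<open>The number of bad times and their total level are not Birkhoff sums; they are eliminated by
  \<open>bad_levels_le\<close>, so that the bound can be integrated.\<close>

lemma code_length_linear:
  assumes x: "x \<in> pos_orbit" and H: "H = h + \<gamma>" and h: "0 \<le> h" and \<gamma>1: "\<gamma> < 1 + \<kappa>"
  defines "\<zeta> \<equiv> (\<kappa> + 3 * \<gamma>) / (1 + \<kappa> - \<gamma>)"
  defines "\<xi> \<equiv> (h - \<zeta> * (R + 2 * \<gamma>)) / (R + 2 * \<gamma>)"
  assumes \<xi>: "0 \<le> \<xi>"
  shows "ln (real (card (itinerary f (\<lambda>x. \<lfloor>real K * sec x\<rfloor>) n ` {y\<in>pos_orbit. tag n y = tag n x})))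
      - ln (prod_list (map weight (tag n x)))
    \<le> ln C1 + ln 6 + ln (real n * (real K + 1) + 1) + real n * (h + 2 * \<gamma>)
      + (\<zeta> + \<xi>) * (maxbirk f psi n x - birk f psi n x) + (\<kappa> + 2 * \<gamma>) * birk f moderate n x
      - \<xi> * (1 + \<kappa> - \<gamma>) * birk f deep n x"
proof -
  let ?b = "real (card {i. i < n \<and> isbad i x})"
  let ?A = "bad_levels n x" and ?W = "maxbirk f psi n x - birk f psi n x"
  define c where "c = 1 + \<kappa> - \<gamma>"
  define q where "q = R + 2 * \<gamma>"
  have c: "0 < c" using \<gamma>1 by (simp add: c_def)
  have q: "0 < q" using R_nonneg \<gamma> by (simp add: q_def)
  have \<zeta>0: "0 \<le> \<zeta>" using c \<kappa>_pos \<gamma> unfolding \<zeta>_def c_def by simp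
  have main: "c * ?A \<le> q * ?b + ?W" using bad_levels_le[OF x, of n] unfolding c_def q_def .
  have \<zeta>c: "\<zeta> * c = \<kappa> + 3 * \<gamma>" using c unfolding \<zeta>_def c_def by simp
  have \<xi>q: "\<xi> * q = h - \<zeta> * q" using q unfolding \<xi>_def q_def by simp
  \<comment> \<open>The estimate \<open>main\<close> is used twice. Multiplied by \<zeta> it trades
    the cost of the bad levels for \<zeta> q per bad time; compared with the entropy h not spent at
    bad times, \<xi> q per bad time is left over. Multiplied by \<xi> it converts this surplus into
    the negative term with the deep levels.\<close>
  have "\<zeta> * (c * ?A) \<le> \<zeta> * (q * ?b + ?W)" using main \<zeta>0 by (rule mult_left_mono)
  then have 1: "(\<kappa> + 3 * \<gamma>) * ?A \<le> \<zeta> * q * ?b + \<zeta> * ?W" unfolding \<zeta>c[symmetric] by (simp add: algebra_simps)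
  have "\<xi> * (c * birk f deep n x) \<le> \<xi> * (c * ?A)"
    using birk_deep_le[of n x] c \<xi> by (intro mult_left_mono) auto
  moreover have "\<xi> * (c * ?A) \<le> \<xi> * (q * ?b + ?W)" using main \<xi> by (rule mult_left_mono)
  moreover have "\<xi> * (q * ?b + ?W) = h * ?b - \<zeta> * q * ?b + \<xi> * ?W"
  proof -
    have "\<xi> * (q * ?b + ?W) = (\<xi> * q) * ?b + \<xi> * ?W" by (simp add: algebra_simps)
    then show ?thesis unfolding \<xi>q by (simp add: algebra_simps)
  qed
  ultimately have 2: "\<xi> * c * birk f deep n x \<le> h * ?b - \<zeta> * q * ?b + \<xi> * ?W" by (simp add: mult_ac)
  have b0: "0 \<le> \<gamma> * ?b" using \<gamma> by simp
  have 3: "(real n - ?b) * H = real n * h + real n * \<gamma> - h * ?b - \<gamma> * ?b" unfolding H by (simp add: algebra_simps)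
  have 4: "real n * (h + 2 * \<gamma>) = real n * h + 2 * (real n * \<gamma>)" by (simp add: algebra_simps)
  have 5: "(\<zeta> + \<xi>) * ?W = \<zeta> * ?W + \<xi> * ?W" by (simp add: algebra_simps)
  have H0: "0 \<le> H" using h \<gamma> H by simp
  show ?thesis
    using code_length_le[OF x H0, of K n] 1 2 3 4 5 b0 unfolding c_def[symmetric] by linarith
qed

end

section \<open>Invariant measures\<close>

lemma uniformly_continuous_on_mult_bounded:
  fixes g h :: "real \<Rightarrow> real"
  assumes g: "uniformly_continuous_on S g" and h: "uniformly_continuous_on S h"
    and gb: "\<And>x. x \<in> S \<Longrightarrow> \<bar>g x\<bar> \<le> b" and hb: "\<And>x. x \<in> S \<Longrightarrow> \<bar>h x\<bar> \<le> c"
  shows "uniformly_continuous_on S (\<lambda>x. g x * h x)"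
  unfolding uniformly_continuous_on_def dist_real_def
proof (intro allI impI)
  fix e :: real assume e: "e > 0"
  define m where "m = \<bar>b\<bar> + \<bar>c\<bar> + 1"
  have m: "m > 0" by (simp add: m_def add_nonneg_pos)
  have em: "e / (2 * m) > 0" using e m by simp
  obtain d1 where d1: "d1 > 0" "\<And>x y. x \<in> S \<Longrightarrow> y \<in> S \<Longrightarrow> \<bar>y - x\<bar> < d1 \<Longrightarrow> \<bar>g y - g x\<bar> < e / (2 * m)"
    using g em unfolding uniformly_continuous_on_def dist_real_def by meson
  obtain d2 where d2: "d2 > 0" "\<And>x y. x \<in> S \<Longrightarrow> y \<in> S \<Longrightarrow> \<bar>y - x\<bar> < d2 \<Longrightarrow> \<bar>h y - h x\<bar> < e / (2 * m)"
    using h em unfolding uniformly_continuous_on_def dist_real_def by meson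
  show "\<exists>d>0. \<forall>x\<in>S. \<forall>x'\<in>S. \<bar>x' - x\<bar> < d \<longrightarrow> \<bar>g x' * h x' - g x * h x\<bar> < e"
  proof (intro exI[of _ "min d1 d2"] conjI ballI impI)
    fix x y assume xy: "x \<in> S" "y \<in> S" "\<bar>y - x\<bar> < min d1 d2"
    have "g y * h y - g x * h x = g y * (h y - h x) + (g y - g x) * h x" by (simp add: algebra_simps)
    then have "\<bar>g y * h y - g x * h x\<bar> \<le> \<bar>g y\<bar> * \<bar>h y - h x\<bar> + \<bar>g y - g x\<bar> * \<bar>h x\<bar>"
      by (metis abs_mult abs_triangle_ineq)
    also have "\<bar>g y\<bar> * \<bar>h y - h x\<bar> \<le> \<bar>b\<bar> * (e / (2 * m))"
      using gb[OF xy(2)] d2(2)[OF xy(1,2)] xy(3) by (intro mult_mono) auto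
    also have "\<bar>g y - g x\<bar> * \<bar>h x\<bar> \<le> (e / (2 * m)) * \<bar>c\<bar>"
      using hb[OF xy(1)] d1(2)[OF xy(1,2)] xy(3) by (intro mult_mono) auto
    also have "\<bar>b\<bar> * (e / (2 * m)) + (e / (2 * m)) * \<bar>c\<bar> = (\<bar>b\<bar> + \<bar>c\<bar>) * (e / (2 * m))"
      by (simp only: distrib_right mult.commute[of "e / (2 * m)"])
    also have "\<dots> \<le> m * (e / (2 * m))" using em by (intro mult_right_mono) (auto simp: m_def)
    also have "\<dots> < e" using m e by simp
    finally show "\<bar>g y * h y - g x * h x\<bar> < e" by simp
  qed (use d1 d2 in auto)
qed

text \<open>Guess a from q. On the sets \<open>K v\<close>, which q separates, the guess is right
  and has weight at least 1 - \<tau>. The mass \<tau> is spread over all values, so that a wrong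
  guess costs only \<open>ln (card / \<tau>)\<close>, on a set of small probability.\<close>

lemma (in prob_space) cond_code_integral_le:
  fixes a :: "'a \<Rightarrow> 'v" and q :: "'a \<Rightarrow> 'w" and K :: "'v \<Rightarrow> 'a set"
  assumes a: "finite_valued a" and q: "finite_valued q" and \<tau>: "0 < \<tau>" "\<tau> < 1"
    and K: "\<And>v. K v \<in> events" "\<And>v. K v \<subseteq> {x\<in>space M. a x = v}"
    and sep: "\<And>v v' x y. x \<in> K v \<Longrightarrow> y \<in> K v' \<Longrightarrow> q x = q y \<Longrightarrow> v = v'"
  shows "\<exists>w. (\<forall>u v. 0 < w u v) \<and> (\<forall>v. (\<Sum>u\<in>a ` space M. w u v) \<le> 1) \<and>
    (\<integral>x. - ln (w (a x) (q x)) \<partial>M) \<le> - ln (1 - \<tau>)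
      + ln (real (card (a ` space M)) / \<tau>) * prob (space M - (\<Union>v\<in>a ` space M. K v))"
proof -
  let ?V = "a ` space M"
  have finV: "finite ?V" using a by (simp add: finite_valued_def)
  have m1: "1 \<le> real (card ?V)" using finV not_empty card_gt_0_iff[of ?V] by fastforce
  let ?m = "real (card ?V)"
  define v0 where "v0 j = (SOME v. \<exists>x\<in>K v. q x = j)" for j
  have v0: "v0 (q x) = v" if "x \<in> K v" for x v
  proof -
    have "\<exists>v. \<exists>y\<in>K v. q y = q x" using that by blast
    then have "\<exists>y\<in>K (v0 (q x)). q y = q x" unfolding v0_def by (rule someI_ex)
    then show ?thesis using sep that by blast
  qed
  define w where "w u j = (if u = v0 j then 1 - \<tau> else \<tau> / ?m)" for u j
  have \<tau>m: "0 < \<tau> / ?m" using \<tau> m1 by simp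
  have wpos: "0 < w u j" for u j using \<tau> \<tau>m by (simp add: w_def)
  have wsum: "(\<Sum>u\<in>?V. w u j) \<le> 1" for j
  proof -
    have "(\<Sum>u\<in>?V. w u j) \<le> (\<Sum>u\<in>?V. (if u = v0 j then 1 - \<tau> else 0) + \<tau> / ?m)"
      using \<tau>m \<tau> by (intro sum_mono) (auto simp: w_def)
    also have "\<dots> = (\<Sum>u\<in>?V. if u = v0 j then 1 - \<tau> else 0) + \<tau>" using m1 by (simp add: sum.distrib)
    also have "(\<Sum>u\<in>?V. if u = v0 j then 1 - \<tau> else 0) \<le> 1 - \<tau>" using finV \<tau> by (simp add: sum.delta)
    finally show ?thesis by simp
  qed
  let ?U = "\<Union>v\<in>?V. K v" and ?L = "ln (?m / \<tau>)"
  have Uev: "?U \<in> events" using K(1) finV by (intro sets.finite_UN) auto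
  have L0: "0 \<le> ?L" using m1 \<tau> by simp
  have l0: "0 \<le> - ln (1 - \<tau>)" using \<tau> by simp
  have "(\<integral>x. - ln (w (a x) (q x)) \<partial>M) \<le> (\<integral>x. - ln (1 - \<tau>) + ?L * indicator (space M - ?U) x \<partial>M)"
  proof (rule integral_mono)
    show "integrable M (\<lambda>x. - ln (w (a x) (q x)))"
      using finite_valued_integral(1)[OF finite_valued_pair[OF a q], of "\<lambda>(u,v). - ln (w u v)"] by simp
    show "integrable M (\<lambda>x. - ln (1 - \<tau>) + ?L * indicator (space M - ?U) x)"
      using Uev by (intro Bochner_Integration.integrable_add integrable_const integrable_mult_right integrable_real_indicator)
        (auto simp: emeasure_eq_measure)
    fix x assume x: "x \<in> space M"
    have lm: "- ln (\<tau> / ?m) = ?L" using \<tau> m1 by (simp add: ln_div)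
    show "- ln (w (a x) (q x)) \<le> - ln (1 - \<tau>) + ?L * indicator (space M - ?U) x"
    proof (cases "x \<in> ?U")
      case True
      then obtain v where v: "x \<in> K v" by auto
      then have "a x = v" using K(2) by auto
      then have "w (a x) (q x) = 1 - \<tau>" using v0[OF v] by (simp add: w_def)
      then show ?thesis using True by simp
    next
      case False
      have "- ln (w (a x) (q x)) \<le> - ln (1 - \<tau>) + ?L" using lm L0 l0 by (simp add: w_def)
      then show ?thesis using False x by simp
    qed
  qed
  also have "\<dots> = - ln (1 - \<tau>) + ?L * prob (space M - ?U)"
    using Uev by (subst Bochner_Integration.integral_add)
      (auto intro!: integrable_mult_right integrable_real_indicator simp: emeasure_eq_measure prob_space Int_absorb2)
  finally show ?thesis using wpos wsum by blast
qed

section \<open>Grid partitions, Ruelle's inequality and integrability of the logarithm of the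
  derivative\<close>

locale lifted_mpt = lifted_map X f D prj sec F dF u r R \<Lambda> + mpt M f
  for X :: "'a::euclidean_space set" and f :: "'a \<Rightarrow> 'a" and D prj sec F dF u r R \<Lambda> and M :: "'a measure" +
  assumes space_M: "space M = X" and sets_M: "sets M = sets (restrict_space borel X)"
    and ergodic: "A \<in> events \<Longrightarrow> f -` A \<inter> space M = A \<Longrightarrow> prob A = 0 \<or> prob A = 1"
begin

lemma X_borel: "X \<in> sets borel" using X_closed by (rule borel_closed)

lemma events_iff: "A \<in> events \<longleftrightarrow> A \<in> sets borel \<and> A \<subseteq> X"
  unfolding sets_M using X_borel by (auto simp: sets_restrict_space_iff)

lemma sec_meas: "sec \<in> borel_measurable M"
proof -
  have "measurable M borel = measurable (restrict_space borel X) (borel :: real measure)"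
    using sets_M by (intro measurable_cong_sets) auto
  then show ?thesis using sec_measurable by simp
qed

lemma u_eq: "x \<in> X \<Longrightarrow> u x = \<bar>dF (sec x)\<bar>"
  using u_prj[of "sec x"] sec by simp

lemma u_meas: "u \<in> borel_measurable M"
proof -
  have "dF \<in> borel_measurable (restrict_space borel D)"
    by (intro borel_measurable_continuous_on_restrict uniformly_continuous_imp_continuous dF_unif)
  moreover have "sec \<in> measurable M (restrict_space borel D)"
    using sec_meas sec(1) space_M by (intro measurable_restrict_space2) auto
  ultimately have "(\<lambda>x. dF (sec x)) \<in> borel_measurable M" by (rule measurable_compose[rotated])
  then have "(\<lambda>x. \<bar>dF (sec x)\<bar>) \<in> borel_measurable M" by simp
  moreover have "u \<in> borel_measurable M \<longleftrightarrow> (\<lambda>x. \<bar>dF (sec x)\<bar>) \<in> borel_measurable M"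
    using u_eq space_M by (intro measurable_cong) auto
  ultimately show ?thesis by simp
qed

lemma u_nonneg: "x \<in> X \<Longrightarrow> 0 \<le> u x" and u_le: "x \<in> X \<Longrightarrow> u x \<le> \<Lambda>"
  using u_eq dF_bound sec(1) by auto

abbreviation cell_index :: "nat \<Rightarrow> 'a \<Rightarrow> int" where
  "cell_index K \<equiv> \<lambda>x. \<lfloor>real K * sec x\<rfloor>"

lemma cell_index_range: "cell_index K ` space M \<subseteq> {0..int K}"
proof clarify
  fix x assume "x \<in> space M"
  then have b: "0 \<le> sec x" "sec x \<le> 1" using sec space_M by auto
  then have "0 \<le> real K * sec x" "real K * sec x \<le> real K * 1"
    using mult_left_mono[OF b(2), of "real K"] by simp_all
  then show "\<lfloor>real K * sec x\<rfloor> \<in> {0..int K}" by (auto simp: le_floor_iff floor_le_iff)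
qed

lemma finite_valued_cell_index: "finite_valued (cell_index K)"
  unfolding finite_valued_def
proof (intro conjI allI)
  show "finite (cell_index K ` space M)" by (rule finite_subset[OF cell_index_range]) simp
  fix v
  have "(\<lambda>x. real_of_int \<lfloor>real K * sec x\<rfloor>) \<in> borel_measurable M" using sec_meas by measurable
  then have "{x\<in>space M. real_of_int \<lfloor>real K * sec x\<rfloor> = real_of_int v} \<in> events" by measurable
  then show "{x\<in>space M. cell_index K x = v} \<in> events" by simp
qed

lemma cell_index_near: "1 \<le> K \<Longrightarrow> cell_index K x = cell_index K y \<Longrightarrow> \<bar>sec x - sec y\<bar> \<le> 1 / real K"
proof -
  assume K: "1 \<le> K" and eq: "cell_index K x = cell_index K y"
  have "\<bar>real K * sec x - real K * sec y\<bar> \<le> 1" using eq by linarith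
  then have "real K * \<bar>sec x - sec y\<bar> \<le> 1" by (simp add: abs_mult right_diff_distrib[symmetric])
  then show "\<bar>sec x - sec y\<bar> \<le> 1 / real K" using K by (simp add: field_simps)
qed

lemma compact_approx:
  assumes A: "A \<in> events" and \<delta>: "0 < \<delta>"
  shows "\<exists>K. compact K \<and> K \<subseteq> A \<and> K \<in> events \<and> prob (A - K) < \<delta>"
proof -
  \<comment> \<open>M lives on X; the push-forward to the whole space is a finite Borel measure to
    which inner regularity applies.\<close>
  define N where "N = distr M borel (\<lambda>x. x)"
  have idm: "(\<lambda>x. x) \<in> measurable M borel"
    using sets_M space_M by (simp add: measurable_def events_iff X_borel vimage_def)
      (auto simp: sets_restrict_space Int_commute)
  have sN: "sets N = sets borel" by (simp add: N_def)
  have eN: "emeasure N B = emeasure M (B \<inter> X)" if "B \<in> sets borel" for B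
    unfolding N_def using that idm by (simp add: emeasure_distr space_M)
  have Ab: "A \<in> sets borel" "A \<subseteq> X" using A by (auto simp: events_iff)
  have "emeasure N (space N) \<noteq> \<infinity>" using eN[of UNIV] by (simp add: N_def emeasure_eq_measure)
  then have SUP: "emeasure N A = (SUP K\<in>{K. K \<subseteq> A \<and> compact K}. emeasure N K)"
    by (intro inner_regular sN Ab)
  show ?thesis
  proof (cases "prob A < \<delta>")
    case True
    then show ?thesis by (intro exI[of _ "{}"]) auto
  next
    case False
    have "ennreal (prob A - \<delta>) < emeasure N A"
      using eN[OF Ab(1)] Ab(2) False \<delta> by (simp add: Int_absorb2 emeasure_eq_measure ennreal_less_iff)
    then obtain K where K: "K \<subseteq> A" "compact K" "ennreal (prob A - \<delta>) < emeasure N K"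
      unfolding SUP by (auto simp: less_SUP_iff)
    have Kb: "K \<in> sets borel" using K(2) by (simp add: borel_compact)
    have Kev: "K \<in> events" using Kb K(1) Ab(2) by (auto simp: events_iff)
    have "prob A - \<delta> < prob K"
      using K(1,3) Ab(2) eN[OF Kb] False by (simp add: Int_absorb2 emeasure_eq_measure ennreal_less_iff)
    then have "prob (A - K) < \<delta>" using finite_measure_Diff[OF A Kev K(1)] by simp
    then show ?thesis using K Kev by blast
  qed
qed

text \<open>Sufficiently fine grids almost determine any finite partition. Its fibres are
  approximated from inside by compact sets, which have positive distances from each other, and a
  grid finer than these distances separates them.\<close>

lemma cond_code_small:
  fixes a :: "'a \<Rightarrow> 'v"
  assumes a: "finite_valued a" and \<theta>: "0 < (\<theta> :: real)"
  shows "\<exists>K0. \<forall>K\<ge>K0. \<exists>w. (\<forall>u v. 0 < w u v) \<and> (\<forall>v. (\<Sum>u\<in>a ` space M. w u v) \<le> 1) \<and>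
    (\<integral>x. - ln (w (a x) (cell_index K x)) \<partial>M) \<le> \<theta>"
proof -
  let ?V = "a ` space M"
  have finV: "finite ?V" using a by (simp add: finite_valued_def)
  have m1: "1 \<le> real (card ?V)" using finV not_empty card_gt_0_iff[of ?V] by fastforce
  define \<tau> where "\<tau> = 1 - exp (- (\<theta> / 2))"
  have \<tau>: "0 < \<tau>" "\<tau> < 1" "- ln (1 - \<tau>) = \<theta> / 2" using \<theta> by (auto simp: \<tau>_def)
  define L where "L = ln (real (card ?V) / \<tau>)"
  have L0: "0 \<le> L" using m1 \<tau> by (simp add: L_def)
  define \<delta> where "\<delta> = \<theta> / (2 * (L + 1) * real (card ?V))"
  have \<delta>: "0 < \<delta>" using \<theta> L0 m1 by (simp add: \<delta>_def)
  have "\<exists>K. compact K \<and> K \<subseteq> {x\<in>space M. a x = v} \<and> K \<in> events \<and> prob ({x\<in>space M. a x = v} - K) < \<delta>" for v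
    using compact_approx[OF _ \<delta>, of "{x\<in>space M. a x = v}"] a by (simp add: finite_valued_def)
  then have "\<exists>C. \<forall>v. compact (C v) \<and> C v \<subseteq> {x\<in>space M. a x = v} \<and> C v \<in> events \<and>
      prob ({x\<in>space M. a x = v} - C v) < \<delta>" by (intro choice allI)
  then obtain C where "\<forall>v. compact (C v) \<and> C v \<subseteq> {x\<in>space M. a x = v} \<and> C v \<in> events \<and>
      prob ({x\<in>space M. a x = v} - C v) < \<delta>" by (elim exE)
  then have C: "\<And>v. compact (C v)" "\<And>v. C v \<subseteq> {x\<in>space M. a x = v}" "\<And>v. C v \<in> events"
    "\<And>v. prob ({x\<in>space M. a x = v} - C v) < \<delta>" by simp_all
  have "\<exists>d>0. \<forall>x\<in>C v. \<forall>y\<in>C v'. d \<le> dist x y" if "v \<noteq> v'" for v v'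
  proof (rule separate_compact_closed)
    show "C v \<inter> C v' = {}" using C(2) that by blast
  qed (use C(1) compact_imp_closed in auto)
  then obtain d where d: "\<And>v v'. v \<noteq> v' \<Longrightarrow> 0 < d v v'" "\<And>v v' x y. v \<noteq> v' \<Longrightarrow> x \<in> C v \<Longrightarrow> y \<in> C v' \<Longrightarrow> d v v' \<le> dist x y"
    by metis
  \<comment> \<open>The element 1 keeps the set nonempty when a takes a single value.\<close>
  define \<Delta> where "\<Delta> = insert 1 ((\<lambda>(v,v'). d v v') ` {p\<in>?V \<times> ?V. fst p \<noteq> snd p})"
  have fin\<Delta>: "finite \<Delta>" unfolding \<Delta>_def using finV by auto
  define d0 where "d0 = Min \<Delta>"
  have d0: "0 < d0" unfolding d0_def using fin\<Delta> d(1) by (subst Min_gr_iff) (auto simp: \<Delta>_def)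
  have d0_le: "d0 \<le> dist x y" if "x \<in> C v" "y \<in> C v'" "v \<noteq> v'" for x y v v'
  proof -
    have "v \<in> ?V" "v' \<in> ?V" using that C(2) by auto
    then have "d0 \<le> d v v'" unfolding d0_def using fin\<Delta> that(3) by (intro Min_le) (auto simp: \<Delta>_def)
    then show ?thesis using d(2)[OF that(3,1,2)] by linarith
  qed
  obtain Lp where Lp: "\<And>s t. s \<in> D \<Longrightarrow> t \<in> D \<Longrightarrow> dist (prj s) (prj t) \<le> Lp * \<bar>s - t\<bar>" using prj_Lipschitz by blast
  obtain K0 :: nat where K0: "\<bar>Lp\<bar> / d0 < real K0" using reals_Archimedean2 by blast
  show ?thesis
  proof (intro exI[of _ "Suc K0"] allI impI)
    fix K assume K: "Suc K0 \<le> K"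
    have sep: "v = v'" if xy: "x \<in> C v" "y \<in> C v'" "cell_index K x = cell_index K y" for x y v v'
    proof (rule ccontr)
      assume ne: "v \<noteq> v'"
      have X: "x \<in> X" "y \<in> X" using xy C(2) space_M by auto
      have "dist x y \<le> Lp * \<bar>sec x - sec y\<bar>" using Lp[of "sec x" "sec y"] sec X by simp
      also have "\<dots> \<le> \<bar>Lp\<bar> * (1 / real K)"
        using cell_index_near[OF _ xy(3)] K by (intro mult_mono) auto
      also have "\<dots> < d0"
      proof -
        have "\<bar>Lp\<bar> < d0 * real K0" using K0 d0 by (simp add: field_simps)
        also have "\<dots> \<le> d0 * real K" using K d0 by (intro mult_left_mono) auto
        finally show ?thesis using K by (simp add: field_simps)
      qed
      finally show False using d0_le[OF xy(1,2) ne] by simp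
    qed
    have "\<exists>w. (\<forall>u v. 0 < w u v) \<and> (\<forall>v. (\<Sum>u\<in>?V. w u v) \<le> 1) \<and>
      (\<integral>x. - ln (w (a x) (cell_index K x)) \<partial>M) \<le> - ln (1 - \<tau>) + L * prob (space M - (\<Union>v\<in>?V. C v))"
      unfolding L_def
      by (rule cond_code_integral_le[OF a finite_valued_cell_index[of K] \<tau>(1,2) C(3,2)]) (rule sep)
    then obtain w where w: "\<And>u v. 0 < w u v" "\<And>v. (\<Sum>u\<in>?V. w u v) \<le> 1"
      "(\<integral>x. - ln (w (a x) (cell_index K x)) \<partial>M) \<le> - ln (1 - \<tau>) + L * prob (space M - (\<Union>v\<in>?V. C v))"
      by blast
    have "prob (space M - (\<Union>v\<in>?V. C v)) \<le> prob (\<Union>v\<in>?V. {x\<in>space M. a x = v} - C v)"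
      using C(3) a finV by (intro finite_measure_mono sets.finite_UN) (auto simp: finite_valued_def)
    also have "\<dots> \<le> (\<Sum>v\<in>?V. prob ({x\<in>space M. a x = v} - C v))"
      using C(3) a finV by (intro finite_measure_subadditive_finite) (auto simp: finite_valued_def)
    also have "\<dots> \<le> (\<Sum>v\<in>?V. \<delta>)" using C(4) by (intro sum_mono) (auto simp: less_imp_le)
    also have "\<dots> = real (card ?V) * \<delta>" by simp
    finally have "L * prob (space M - (\<Union>v\<in>?V. C v)) \<le> (L + 1) * (real (card ?V) * \<delta>)"
      using L0 by (intro mult_mono) auto
    also have "\<dots> = \<theta> / 2"
    proof -
      have "x * (y * (\<theta> / (2 * x * y))) = \<theta> / 2" if "0 < x" "0 < y" for x y using that by simp
      from this[of "L + 1" "real (card ?V)"] show ?thesis using L0 m1 unfolding \<delta>_def by simp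
    qed
    finally have "(\<integral>x. - ln (w (a x) (cell_index K x)) \<partial>M) \<le> \<theta>" using w(3) \<tau>(3) by simp
    then show "\<exists>w. (\<forall>u v. 0 < w u v) \<and> (\<forall>v. (\<Sum>u\<in>?V. w u v) \<le> 1) \<and> (\<integral>x. - ln (w (a x) (cell_index K x)) \<partial>M) \<le> \<theta>"
      using w by blast
  qed
qed

definition dFn :: "nat \<Rightarrow> real \<Rightarrow> real" where
  "dFn n t = (\<Prod>i<n. dF ((F ^^ i) t))"

lemma Fn_deriv: "t \<in> D \<Longrightarrow> ((F ^^ n) has_real_derivative dFn n t) (at t within D)"
  unfolding dFn_def using F_in F_deriv by (rule funpow_has_derivative)

lemma dFn_uniform: "uniformly_continuous_on D (dFn n) \<and> (\<forall>t\<in>D. \<bar>dFn n t\<bar> \<le> \<Lambda> ^ n) \<and> uniformly_continuous_on D (F ^^ n)"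
proof (induction n)
  case 0
  show ?case by (simp add: dFn_def uniformly_continuous_on_const uniformly_continuous_on_id id_def)
next
  case (Suc n)
  have im: "(F ^^ n) ` D \<subseteq> D" using Fn_in by auto
  have sub: "uniformly_continuous_on ((F ^^ n) ` D) g" if "uniformly_continuous_on D g" for g :: "real \<Rightarrow> real"
    using that im unfolding uniformly_continuous_on_def by (meson subsetD)
  have uF: "uniformly_continuous_on D F"
    unfolding uniformly_continuous_on_def dist_real_def
  proof (intro allI impI)
    fix e :: real assume "e > 0"
    then have "\<bar>F y - F x\<bar> < e" if "x \<in> D" "y \<in> D" "\<bar>y - x\<bar> < e / \<Lambda>" for x y
      using F_lipschitz[OF that(2,1)] that(3) \<Lambda>_ge_1 by (simp add: field_simps)
    then show "\<exists>d>0. \<forall>x\<in>D. \<forall>x'\<in>D. \<bar>x' - x\<bar> < d \<longrightarrow> \<bar>F x' - F x\<bar> < e"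
      using \<open>e > 0\<close> \<Lambda>_ge_1 by (intro exI[of _ "e / \<Lambda>"]) auto
  qed
  have c1: "uniformly_continuous_on D (\<lambda>t. dF ((F ^^ n) t))"
    using Suc sub[OF dF_unif] by (intro uniformly_continuous_on_compose[of D "F ^^ n" dF, unfolded o_def]) auto
  have c2: "uniformly_continuous_on D (\<lambda>t. F ((F ^^ n) t))"
    using Suc sub[OF uF] by (intro uniformly_continuous_on_compose[of D "F ^^ n" F, unfolded o_def]) auto
  have eq: "dFn (Suc n) = (\<lambda>t. dFn n t * dF ((F ^^ n) t))" by (rule ext) (simp add: dFn_def)
  have "uniformly_continuous_on D (dFn (Suc n))"
    unfolding eq using Suc c1 dF_bound Fn_in by (intro uniformly_continuous_on_mult_bounded) auto
  moreover have "\<bar>dFn (Suc n) t\<bar> \<le> \<Lambda> ^ Suc n" if "t \<in> D" for t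
    unfolding eq abs_mult using Suc dF_bound[OF Fn_in[OF that]] that \<Lambda>_ge_1 mult_mono[of "\<bar>dFn n t\<bar>" "\<Lambda> ^ n" "\<bar>dF ((F ^^ n) t)\<bar>" \<Lambda>]
    by (simp add: mult.commute)
  ultimately show ?case using c2 by (simp add: o_def)
qed

text \<open>By the mean value theorem the image under F^N of points in one grid cell has diameter at
  most \<open>(\<bar>dFn N\<bar> + 1) / K\<close>, where K is so large that dFn N varies by at most
  1 over a cell. Rounding adds 2.\<close>

lemma successors_card:
  assumes K: "1 \<le> K" and osc: "\<And>s t. s \<in> D \<Longrightarrow> t \<in> D \<Longrightarrow> \<bar>s - t\<bar> \<le> 1 / real K \<Longrightarrow> \<bar>dFn N s - dFn N t\<bar> \<le> 1"
    and x: "x \<in> X"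
  shows "real (card ((\<lambda>y. cell_index K ((f ^^ N) y)) ` {y\<in>space M. cell_index K y = cell_index K x})) \<le> \<bar>dFn N (sec x)\<bar> + 3"
proof -
  let ?Y = "{y\<in>space M. cell_index K y = cell_index K x}"
  let ?c = "\<bar>dFn N (sec x)\<bar> + 1"
  obtain \<iota> where \<iota>: "\<And>t. t \<in> D \<Longrightarrow> \<lfloor>real K * sec (prj t)\<rfloor> = \<iota> \<lfloor>real K * t\<rfloor>" using sec_index by blast
  have "cell_index K ((f ^^ N) y) = \<iota> \<lfloor>real K * (F ^^ N) (sec y)\<rfloor>" if "y \<in> ?Y" for y
  proof -
    have y: "y \<in> X" using that space_M by simp
    have "(f ^^ N) y = prj ((F ^^ N) (sec y))" using semiconj_n[OF sec(1)[OF y], of N] sec(4)[OF y] by simp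
    then show ?thesis using \<iota>[OF Fn_in[OF sec(1)[OF y]]] by simp
  qed
  then have img: "(\<lambda>y. cell_index K ((f ^^ N) y)) ` ?Y = \<iota> ` ((\<lambda>y. \<lfloor>real K * (F ^^ N) (sec y)\<rfloor>) ` ?Y)"
    unfolding image_image by (intro image_cong refl)
  have near: "\<bar>real K * (F ^^ N) (sec y) - real K * (F ^^ N) (sec z)\<bar> \<le> ?c" if yz: "y \<in> ?Y" "z \<in> ?Y" for y z
  proof -
    have D: "sec y \<in> D" "sec z \<in> D" "sec x \<in> D" using yz x sec space_M by auto
    have yx: "\<bar>sec y - sec x\<bar> \<le> 1 / real K" "\<bar>sec z - sec x\<bar> \<le> 1 / real K"
      using cell_index_near[OF K] yz by auto
    let ?S = "closed_segment (sec z) (sec y)"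
    have SD: "?S \<subseteq> D" using D D_interval by (simp add: closed_segment_subset is_interval_convex)
    have "norm ((F ^^ N) (sec y) - (F ^^ N) (sec z)) \<le> ?c * norm (sec y - sec z)"
    proof (rule field_differentiable_bound[of ?S "F ^^ N" "dFn N"])
      fix s assume s: "s \<in> ?S"
      then have sD: "s \<in> D" using SD by auto
      show "((F ^^ N) has_real_derivative dFn N s) (at s within ?S)"
        using Fn_deriv[OF sD] SD by (auto intro: DERIV_subset)
      have "\<bar>s - sec x\<bar> \<le> 1 / real K"
        using s yx by (auto simp: closed_segment_eq_real_ivl split: if_splits)
      then have "\<bar>dFn N s - dFn N (sec x)\<bar> \<le> 1" using osc[OF sD D(3)] by simp
      then show "norm (dFn N s) \<le> ?c" by simp
    qed auto
    also have "\<dots> \<le> ?c * (1 / real K)" using cell_index_near[OF K, of y z] yz by (intro mult_left_mono) auto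
    finally have "real K * \<bar>(F ^^ N) (sec y) - (F ^^ N) (sec z)\<bar> \<le> ?c" using K by (simp add: field_simps)
    then show ?thesis by (simp add: abs_mult right_diff_distrib[symmetric])
  qed
  note cf = card_floor_near[of ?c ?Y "\<lambda>y. real K * (F ^^ N) (sec y)", OF _ near]
  show ?thesis unfolding img using cf card_image_le[of "(\<lambda>y. \<lfloor>real K * (F ^^ N) (sec y)\<rfloor>) ` ?Y" \<iota>] by simp
qed

lemma dFn_sec: "x \<in> X \<Longrightarrow> \<bar>dFn n (sec x)\<bar> = (\<Prod>i<n. u ((f ^^ i) x))"
proof -
  assume x: "x \<in> X"
  have "u ((f ^^ i) x) = \<bar>dF ((F ^^ i) (sec x))\<bar>" for i
    using semiconj_n[OF sec(1)[OF x], of i] sec(4)[OF x] u_prj[OF Fn_in[OF sec(1)[OF x]]] by simp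
  then show ?thesis by (simp add: dFn_def abs_prod)
qed

text \<open>Ruelle's inequality. The majorant g allows to use truncations of the logarithm of the
  derivative before its integrability is known.\<close>

lemma ruelle_inequality:
  assumes g: "integrable M g" and ug: "\<And>x. x \<in> X \<Longrightarrow> u x \<le> exp (g x)" and pos: "0 < (\<integral>x. g x \<partial>M)"
  shows "metric_entropy M f \<le> ereal (\<integral>x. g x \<partial>M)"
proof (rule metric_entropy_le)
  fix a :: "'a \<Rightarrow> 'a set" and \<theta> :: real assume a: "finite_valued a" and \<theta>: "0 < \<theta>"
  let ?I = "\<integral>x. g x \<partial>M"
  obtain C where C: "\<And>n. (\<integral>x. maxbirk f g n x \<partial>M) \<le> C + real n * (?I + \<theta> / 4)"
    using maxbirk_growth[OF ergodic g pos, of "\<theta> / 4"] \<theta> by auto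
  \<comment> \<open>N makes the constants paid once per block of N steps, 1 for the conditional code
    and ln 4 + C for the successors, cost at most \<theta> / 4 per step.\<close>
  obtain N :: nat where N: "max 1 ((1 + ln 4 + C) / (\<theta> / 4)) < real N" using reals_Archimedean2 by blast
  have N1: "1 \<le> N" and N2: "1 + ln 4 + C \<le> real N * (\<theta> / 4)" using N \<theta> by (auto simp: field_simps)
  interpret P: mpt M "f ^^ N" by (rule mpt_funpow)
  have "uniformly_continuous_on D (dFn N)" using dFn_uniform by blast
  then obtain d where d: "0 < d" "\<And>s t. s \<in> D \<Longrightarrow> t \<in> D \<Longrightarrow> \<bar>t - s\<bar> < d \<Longrightarrow> \<bar>dFn N t - dFn N s\<bar> < 1"
    unfolding uniformly_continuous_on_def dist_real_def by (meson zero_less_one)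
  obtain K0 where K0: "\<forall>K\<ge>K0. \<exists>w. (\<forall>u v. 0 < w u v) \<and> (\<forall>v. (\<Sum>u\<in>itinerary f a N ` space M. w u v) \<le> 1) \<and>
    (\<integral>x. - ln (w (itinerary f a N x) (cell_index K x)) \<partial>M) \<le> (1::real)"
    using cond_code_small[OF finite_valued_itinerary[OF a] zero_less_one, of N] by (elim exE)
  obtain K1 :: nat where K1: "1 / d < real K1" using reals_Archimedean2 by blast
  define K where "K = max 1 (max K0 K1)"
  have K: "1 \<le> K" "K0 \<le> K" "1 / d < real K" using K1 by (auto simp: K_def)
  have Kd: "1 / real K < d" using K d(1) by (simp add: field_simps)
  have osc: "\<bar>dFn N s - dFn N t\<bar> \<le> 1" if "s \<in> D" "t \<in> D" "\<bar>s - t\<bar> \<le> 1 / real K" for s t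
    using d(2)[OF that(2,1)] that(3) Kd by (simp add: less_imp_le)
  from spec[OF K0, of K, THEN mp, OF K(2)]
  obtain w where "(\<forall>u v. 0 < w u v) \<and> (\<forall>v. (\<Sum>u\<in>itinerary f a N ` space M. w u v) \<le> 1) \<and>
    (\<integral>x. - ln (w (itinerary f a N x) (cell_index K x)) \<partial>M) \<le> (1::real)" by (elim exE)
  then have w: "\<And>u v. 0 < w u v" "\<And>v. (\<Sum>u\<in>itinerary f a N ` space M. w u v) \<le> 1"
    "(\<integral>x. - ln (w (itinerary f a N x) (cell_index K x)) \<partial>M) \<le> (1::real)" by simp_all
  define succ where "succ j = (\<lambda>y. cell_index K ((f ^^ N) y)) ` {y\<in>space M. cell_index K y = j}" for j
  have ln_succ: "ln (real (card (succ (cell_index K x)))) \<le> ln 4 + maxbirk f g N x" if x: "x \<in> space M" for x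
  proof -
    have xX: "x \<in> X" using x space_M by simp
    have fX: "(f ^^ i) x \<in> X" for i using funpow_space[OF x] space_M by simp
    have "succ (cell_index K x) \<subseteq> cell_index K ` space M"
      unfolding succ_def using funpow_space by blast
    then have fin: "finite (succ (cell_index K x))"
      using finite_valued_cell_index[of K] unfolding finite_valued_def by (auto intro: finite_subset)
    have "succ (cell_index K x) \<noteq> {}" using x by (auto simp: succ_def)
    then have c0: "0 < card (succ (cell_index K x))" using fin by (simp add: card_gt_0_iff)
    have "(\<Prod>i<N. u ((f ^^ i) x)) \<le> (\<Prod>i<N. exp (g ((f ^^ i) x)))"
      using fX u_nonneg ug by (intro prod_mono) auto
    also have "\<dots> = exp (birk f g N x)" by (simp add: exp_sum birk_def)
    also have "\<dots> \<le> exp (maxbirk f g N x)" using birk_le_maxbirk by simp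
    finally have "\<bar>dFn N (sec x)\<bar> \<le> exp (maxbirk f g N x)" using dFn_sec[OF xX] by simp
    \<comment> \<open>Absorbing the additive constant 3 requires a nonnegative exponent: this is why
      maximal Birkhoff sums replace plain ones.\<close>
    moreover have "1 \<le> exp (maxbirk f g N x)" using maxbirk_nonneg by simp
    ultimately have "real (card (succ (cell_index K x))) \<le> 4 * exp (maxbirk f g N x)"
      using successors_card[OF K(1) osc xX] unfolding succ_def by linarith
    then have "ln (real (card (succ (cell_index K x)))) \<le> ln (4 * exp (maxbirk f g N x))" using c0 by simp
    then show ?thesis by (simp add: ln_mult)
  qed
  note mi = maxbirk_integrable[OF g, of N]
  have "(\<integral>x. ln (real (card (succ (cell_index K x)))) \<partial>M) \<le> (\<integral>x. ln 4 + maxbirk f g N x \<partial>M)"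
    using ln_succ finite_valued_integral(1)[OF finite_valued_cell_index[of K], of "\<lambda>j. ln (real (card (succ j)))"] mi
    by (intro integral_mono Bochner_Integration.integrable_add) auto
  also have "\<dots> = ln 4 + (\<integral>x. maxbirk f g N x \<partial>M)"
    using mi by (subst Bochner_Integration.integral_add) (auto simp: prob_space)
  finally have int: "(\<integral>x. ln (real (card (succ (cell_index K x)))) \<partial>M) \<le> ln 4 + (C + real N * (?I + \<theta> / 4))"
    using C[of N] by linarith
  let ?m = "real (card (cell_index K ` space M))"
  have bound: "ent (itinerary f a (N * k)) \<le> ln ?m + real k * (1 + ln 4 + C + real N * (?I + \<theta> / 4))" for k
  proof -
    have "ent (itinerary f a (N * k)) \<le> ent (itinerary (f ^^ N) (itinerary f a N) k)"
      by (rule ent_itinerary_power[OF a])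
    also have "\<dots> \<le> ent (itinerary (f ^^ N) (cell_index K) k) + real k * (\<integral>x. - ln (w (itinerary f a N x) (cell_index K x)) \<partial>M)"
      by (rule P.ent_itinerary_cond[OF finite_valued_itinerary[OF a] finite_valued_cell_index w(1,2)])
    also have "ent (itinerary (f ^^ N) (cell_index K) k) \<le> ln ?m + real k * (\<integral>x. ln (real (card (succ (cell_index K x)))) \<partial>M)"
      unfolding succ_def by (rule P.ent_itinerary_successors[OF finite_valued_cell_index])
    also have "real k * (\<integral>x. ln (real (card (succ (cell_index K x)))) \<partial>M) \<le> real k * (ln 4 + (C + real N * (?I + \<theta> / 4)))"
      using int by (rule mult_left_mono) simp
    also have "real k * (\<integral>x. - ln (w (itinerary f a N x) (cell_index K x)) \<partial>M) \<le> real k * 1"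
      using w(3) by (rule mult_left_mono) simp
    finally show ?thesis by (simp add: algebra_simps)
  qed
  \<comment> \<open>The cost of the initial symbol, the logarithm of the number of cells, is paid
    once and vanishes for large k.\<close>
  obtain k :: nat where k: "max 1 (ln ?m / (real N * (\<theta> / 4))) < real k" using reals_Archimedean2 by blast
  have N\<theta>: "0 < real N * (\<theta> / 4)" using N1 \<theta> by simp
  have k1: "1 \<le> k" and k2: "ln ?m \<le> real k * (real N * (\<theta> / 4))" using k N\<theta> by (auto simp: field_simps)
  have "real k * (1 + ln 4 + C + real N * (?I + \<theta> / 4)) \<le> real k * (real N * (\<theta> / 4) + real N * (?I + \<theta> / 4))"
    using N2 by (intro mult_left_mono) auto
  then have "ent (itinerary f a (N * k)) \<le> real (N * k) * (?I + 3 * \<theta> / 4)"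
    using bound[of k] k2 by (simp add: algebra_simps)
  also have "\<dots> \<le> real (N * k) * (?I + \<theta>)" using \<theta> by (intro mult_left_mono) auto
  finally have "ent (itinerary f a (N * k)) / real (N * k) \<le> ?I + \<theta>"
    using N1 k1 by (simp add: divide_le_eq mult.commute del: of_nat_mult)
  moreover have "1 \<le> N * k" using N1 k1 by simp
  ultimately show "\<exists>n\<ge>1. ent (itinerary f a n) / real n \<le> ?I + \<theta>" by blast
qed

end

section \<open>Integration of the code length\<close>

locale weighted_mpt =
  weighted_coding X f D prj sec F dF u r R \<Lambda> K0 K1 \<gamma> \<epsilon> B C1 H \<rho> CR +
  lifted_mpt X f D prj sec F dF u r R \<Lambda> M
  for X :: "'a::euclidean_space set" and f D prj sec F dF u r R \<Lambda> K0 K1 \<gamma> \<epsilon> B C1 H \<rho> CR M +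
  assumes u_pos: "AE x in M. 0 < u x" and ln_u_int: "integrable M (\<lambda>x. ln (u x))"
begin

lemma lev_meas: "(\<lambda>x. real (lev x)) \<in> borel_measurable M"
proof -
  have "(\<lambda>x. max 0 (real_of_int \<lfloor>- ln (u x)\<rfloor>)) \<in> borel_measurable M" using u_meas by measurable
  moreover have "(\<lambda>x. max 0 (real_of_int \<lfloor>- ln (u x)\<rfloor>)) = (\<lambda>x. real (lev x))"
    by (rule ext) (simp add: lev_def max_def)
  ultimately show ?thesis by simp
qed

lemma lev_le: "real (lev x) \<le> \<bar>ln (u x)\<bar>"
  unfolding lev_def by linarith

lemma lev_set: "{x\<in>space M. K \<le> lev x} \<in> events"
proof -
  have "{x\<in>space M. real K \<le> real (lev x)} \<in> events" using lev_meas by measurable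
  then show ?thesis by simp
qed

lemma lev_if_integrable:
  assumes P: "{x\<in>space M. P x} \<in> events"
  shows "integrable M (\<lambda>x. if P x then real (lev x) else 0)"
proof (rule Bochner_Integration.integrable_bound[OF ln_u_int])
  show "(\<lambda>x. if P x then real (lev x) else 0) \<in> borel_measurable M"
    using P lev_meas by (intro measurable_If) auto
  show "AE x in M. norm (if P x then real (lev x) else 0) \<le> norm (ln (u x))"
    using lev_le by (intro AE_I2) (simp add: order_trans[OF abs_ge_zero])
qed

lemma moderate_integrable: "integrable M moderate"
proof -
  have "{x\<in>space M. K0 \<le> lev x} - {x\<in>space M. K1 \<le> lev x} \<in> events" using lev_set by blast
  moreover have "{x\<in>space M. K0 \<le> lev x} - {x\<in>space M. K1 \<le> lev x} = {x\<in>space M. K0 \<le> lev x \<and> lev x < K1}"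
    by auto
  ultimately show ?thesis
    using lev_if_integrable[of "\<lambda>x. K0 \<le> lev x \<and> lev x < K1"] by (simp add: moderate_def[abs_def])
qed

lemma deep_integrable: "integrable M deep"
  using lev_if_integrable[OF lev_set[of K1]] by (simp add: deep_def[abs_def])

lemma noncritical_integrable: "integrable M (\<lambda>x. if K0 \<le> lev x then 0 else ln (u x))"
proof (rule Bochner_Integration.integrable_bound[OF ln_u_int])
  show "(\<lambda>x. if K0 \<le> lev x then 0 else ln (u x)) \<in> borel_measurable M"
    using lev_set ln_u_int by (intro measurable_If) auto
qed auto

lemma psi_eq: "psi x = (if K0 \<le> lev x then 0 else ln (u x)) + (if K0 \<le> lev x then 2 else \<gamma>)
    - (1 + \<kappa>) * (if K0 \<le> lev x then real (lev x) else 0)"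
  by (simp add: psi_def)

lemma const_integrable: "integrable M (\<lambda>x. if K0 \<le> lev x then 2 else \<gamma>)"
proof (rule integrable_const_bound[where B = "max 2 \<gamma>"])
  show "(\<lambda>x. if K0 \<le> lev x then 2 else \<gamma>) \<in> borel_measurable M"
    using lev_set by (intro measurable_If) auto
qed (use \<gamma> in auto)

lemma psi_integrable: "integrable M psi"
  unfolding psi_eq[abs_def]
  by (intro Bochner_Integration.integrable_diff Bochner_Integration.integrable_add noncritical_integrable
      const_integrable integrable_mult_right lev_if_integrable lev_set)

lemma pos_orbit_events: "pos_orbit \<in> events" and prob_pos_orbit: "prob pos_orbit = 1"
proof -
  have u1: "{x\<in>space M. 0 < u x} \<in> events" using u_meas by measurable
  have "{x\<in>space M. 0 < u ((f ^^ i) x)} = {x\<in>space M. (f ^^ i) x \<in> {x\<in>space M. 0 < u x}}" for i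
    using funpow_space by auto
  then have "{x\<in>space M. 0 < u ((f ^^ i) x)} \<in> events" for i using measure_funpow_vimage(1)[OF u1] by simp
  then have "{x\<in>space M. \<forall>i. 0 < u ((f ^^ i) x)} \<in> events" by (intro sets.sets_Collect_countable_All)
  then show ev: "pos_orbit \<in> events" by (simp add: pos_orbit_def space_M)
  have "AE x in M. \<forall>i. 0 < u ((f ^^ i) x)" using AE_funpow[OF u_pos] by (simp add: AE_all_countable)
  then have "AE x in M. x \<in> pos_orbit" using AE_space by eventually_elim (simp add: pos_orbit_def space_M)
  then show "prob pos_orbit = 1" using ev by (simp add: prob_eq_1)
qed

lemma linear_beats_log:
  fixes c d :: real
  assumes "0 \<le> d" "0 < \<theta>"
  shows "\<exists>n\<ge>1. c + ln (real n * d + 1) \<le> real n * \<theta>"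
proof -
  have "((\<lambda>n. ln (real n) / real n) \<longlongrightarrow> 0) sequentially" by (rule lim_ln_over_n)
  moreover have "0 < \<theta> / 2" using assms by simp
  ultimately have "eventually (\<lambda>n. ln (real n) / real n < \<theta> / 2) sequentially" by (rule order_tendstoD(2))
  moreover have "eventually (\<lambda>n. max 1 (nat \<lceil>(c + ln (d + 1)) / (\<theta> / 2)\<rceil>) \<le> n) sequentially" by (rule eventually_ge_at_top)
  ultimately have "eventually (\<lambda>n. ln (real n) / real n < \<theta> / 2 \<and> max 1 (nat \<lceil>(c + ln (d + 1)) / (\<theta> / 2)\<rceil>) \<le> n) sequentially"
    by (rule eventually_conj)
  then obtain n where n: "ln (real n) / real n < \<theta> / 2" "1 \<le> n" "nat \<lceil>(c + ln (d + 1)) / (\<theta> / 2)\<rceil> \<le> n"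
    unfolding eventually_sequentially by (metis max.bounded_iff order_refl)
  have "(c + ln (d + 1)) / (\<theta> / 2) \<le> real n" using n(3) by linarith
  then have "c + ln (d + 1) \<le> real n * (\<theta> / 2)" using assms by (simp add: field_simps)
  moreover have "ln (real n) \<le> real n * (\<theta> / 2)" using n by (simp add: field_simps)
  moreover have "ln (real n * d + 1) \<le> ln (real n * (d + 1))"
    using n assms by (intro ln_mono) (auto simp: algebra_simps intro!: add_pos_nonneg mult_nonneg_nonneg)
  moreover have "ln (real n * (d + 1)) = ln (real n) + ln (d + 1)" using n assms by (intro ln_mult_pos) auto
  ultimately have "c + ln (real n * d + 1) \<le> real n * \<theta>" by (simp add: algebra_simps)
  then show ?thesis using n(2) by blast
qed

text \<open>In the integral of \<open>code_length_linear\<close> Birkhoff sums become n times means,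
  and the drop of the sums of \<open>psi\<close> contributes arbitrarily little per step by
  \<open>maxbirk_growth\<close>. The deep levels enter with a negative sign: entropy close to h
  forces their mean to be small once the moderate mean is.\<close>

lemma entropy_bound:
  assumes H: "H = h + \<gamma>" and h: "0 \<le> h" and \<gamma>1: "\<gamma> < 1 + \<kappa>" and psi_pos: "0 < (\<integral>x. psi x \<partial>M)"
  defines "\<zeta> \<equiv> (\<kappa> + 3 * \<gamma>) / (1 + \<kappa> - \<gamma>)"
  defines "\<xi> \<equiv> (h - \<zeta> * (R + 2 * \<gamma>)) / (R + 2 * \<gamma>)"
  assumes \<xi>: "0 \<le> \<xi>"
  shows "metric_entropy M f \<le>
    ereal (h + 2 * \<gamma> + (\<kappa> + 2 * \<gamma>) * (\<integral>x. moderate x \<partial>M) - \<xi> * (1 + \<kappa> - \<gamma>) * (\<integral>x. deep x \<partial>M))"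
proof (rule metric_entropy_le)
  fix a :: "'a \<Rightarrow> 'a set" and \<theta> :: real assume a: "finite_valued a" and \<theta>: "0 < \<theta>"
  have \<zeta>0: "0 \<le> \<zeta>" using \<kappa>_pos \<gamma> \<gamma>1 by (simp add: \<zeta>_def)
  define z where "z = \<zeta> + \<xi>"
  have z0: "0 \<le> z" using \<zeta>0 \<xi> by (simp add: z_def)
  \<comment> \<open>One third of \<theta> each goes to the drop of the sums of \<open>psi\<close>,
    to the conditional code and to the constants with the logarithm.\<close>
  define \<theta>' where "\<theta>' = \<theta> / (3 * (z + 1))"
  have \<theta>': "0 < \<theta>'" using \<theta> z0 by (simp add: \<theta>'_def)
  let ?I = "\<integral>x. psi x \<partial>M"
  obtain C where C: "\<And>n. (\<integral>x. maxbirk f psi n x \<partial>M) \<le> C + real n * (?I + \<theta>')"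
    using maxbirk_growth[OF ergodic psi_integrable psi_pos \<theta>'] by auto
  have "0 < \<theta> / 3" using \<theta> by simp
  from cond_code_small[OF a this] obtain K where "\<forall>K'\<ge>K. \<exists>w. (\<forall>u v. 0 < w u v) \<and> (\<forall>v. (\<Sum>u\<in>a ` space M. w u v) \<le> 1) \<and>
    (\<integral>x. - ln (w (a x) (cell_index K' x)) \<partial>M) \<le> \<theta> / 3" by (elim exE)
  then have "\<exists>w. (\<forall>u v. 0 < w u v) \<and> (\<forall>v. (\<Sum>u\<in>a ` space M. w u v) \<le> 1) \<and>
    (\<integral>x. - ln (w (a x) (cell_index K x)) \<partial>M) \<le> \<theta> / 3" by simp
  then obtain w where w: "\<And>u v. 0 < w u v" "\<And>v. (\<Sum>u\<in>a ` space M. w u v) \<le> 1"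
    "(\<integral>x. - ln (w (a x) (cell_index K x)) \<partial>M) \<le> \<theta> / 3" by blast
  let ?mod = "\<integral>x. moderate x \<partial>M" and ?deep = "\<integral>x. deep x \<partial>M"
  let ?q = "\<lambda>n. itinerary f (cell_index K) n"
  let ?c = "\<xi> * (1 + \<kappa> - \<gamma>)"
  let ?E = "h + 2 * \<gamma> + (\<kappa> + 2 * \<gamma>) * ?mod - ?c * ?deep"
  have names: "ent (?q n) \<le> ln C1 + ln 6 + ln (real n * (real K + 1) + 1) + z * C + real n * (?E + z * \<theta>')" for n
  proof -
    let ?G = "\<lambda>x. ln C1 + ln 6 + ln (real n * (real K + 1) + 1) + real n * (h + 2 * \<gamma>)
      + z * (maxbirk f psi n x - birk f psi n x) + (\<kappa> + 2 * \<gamma>) * birk f moderate n x - ?c * birk f deep n x"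
    note ints = birk_integrable[OF psi_integrable, of n] birk_integrable[OF moderate_integrable, of n]
      birk_integrable[OF deep_integrable, of n] maxbirk_integrable[OF psi_integrable, of n]
    have fv: "finite_valued (?q n)" by (rule finite_valued_itinerary[OF finite_valued_cell_index])
    have "ent (?q n) \<le> (\<integral>x. ?G x \<partial>M)"
    proof (rule ent_le_code[OF fv pos_orbit_events prob_pos_orbit, where tag = "tag n"
          and w = "\<lambda>T. prod_list (map weight T)" and N = "\<lambda>T. real (card (?q n ` {y\<in>pos_orbit. tag n y = T}))"])
      show "0 \<le> prod_list (map weight s)" for s using weight_nonneg by (intro prod_list_nonneg) auto
      show "0 < prod_list (map weight (tag n x))" for x
        unfolding prod_list_weight by (intro prod_pos weight_pos)
      show "(\<Sum>T\<in>S. prod_list (map weight T)) \<le> 1" if "finite S" "S \<subseteq> tag n ` pos_orbit" for S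
        using that by (intro sum_prod_list_le_1[where n = n] weight_nonneg sum_weight_le_1) (auto simp: tag_def)
      show "1 \<le> real (card (?q n ` {y\<in>pos_orbit. tag n y = tag n x}))" if x: "x \<in> pos_orbit" for x
      proof -
        have "?q n ` {y\<in>pos_orbit. tag n y = tag n x} \<subseteq> ?q n ` space M" by (auto simp: pos_orbit_def space_M)
        then have "finite (?q n ` {y\<in>pos_orbit. tag n y = tag n x})"
          using fv unfolding finite_valued_def by (meson finite_subset)
        moreover have "?q n ` {y\<in>pos_orbit. tag n y = tag n x} \<noteq> {}" using x by auto
        ultimately have "0 < card (?q n ` {y\<in>pos_orbit. tag n y = tag n x})" by (simp only: card_gt_0_iff) blast
        then show ?thesis by linarith
      qed
      show "integrable M ?G"
        using ints by (intro Bochner_Integration.integrable_diff Bochner_Integration.integrable_add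
            integrable_const integrable_mult_right) auto
      show "ln (real (card (?q n ` {y\<in>pos_orbit. tag n y = tag n x}))) - ln (prod_list (map weight (tag n x))) \<le> ?G x"
        if x: "x \<in> pos_orbit" for x
        using code_length_linear[OF x H h \<gamma>1 \<xi>[unfolded \<xi>_def \<zeta>_def], of K n]
        unfolding z_def \<xi>_def \<zeta>_def .
    qed simp
    also have "\<dots> = ln C1 + ln 6 + ln (real n * (real K + 1) + 1) + real n * (h + 2 * \<gamma>)
      + z * ((\<integral>x. maxbirk f psi n x \<partial>M) - real n * ?I) + (\<kappa> + 2 * \<gamma>) * (real n * ?mod) - ?c * (real n * ?deep)"
    proof -
      let ?k = "ln C1 + ln 6 + ln (real n * (real K + 1) + 1) + real n * (h + 2 * \<gamma>)"
      have i1: "integrable M (\<lambda>x. z * (maxbirk f psi n x - birk f psi n x))"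
        using ints by (intro integrable_mult_right Bochner_Integration.integrable_diff)
      have i2: "integrable M (\<lambda>x. (\<kappa> + 2 * \<gamma>) * birk f moderate n x)" using ints by (intro integrable_mult_right)
      have i3: "integrable M (\<lambda>x. ?c * birk f deep n x)" using ints by (intro integrable_mult_right)
      have "(\<integral>x. ?G x \<partial>M) = (\<integral>x. ?k \<partial>M) + (\<integral>x. z * (maxbirk f psi n x - birk f psi n x) \<partial>M)
        + (\<integral>x. (\<kappa> + 2 * \<gamma>) * birk f moderate n x \<partial>M) - (\<integral>x. ?c * birk f deep n x \<partial>M)"
        by (simp only: Bochner_Integration.integral_diff[OF Bochner_Integration.integrable_add[OF Bochner_Integration.integrable_add[OF integrable_const i1] i2] i3]
            Bochner_Integration.integral_add[OF Bochner_Integration.integrable_add[OF integrable_const i1] i2]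
            Bochner_Integration.integral_add[OF integrable_const i1])
      then show ?thesis using ints by (simp add: prob_space)
    qed
    also have "\<dots> \<le> ln C1 + ln 6 + ln (real n * (real K + 1) + 1) + z * C + real n * (?E + z * \<theta>')"
    proof -
      have "z * ((\<integral>x. maxbirk f psi n x \<partial>M) - real n * ?I) \<le> z * (C + real n * \<theta>')"
        using C[of n] z0 by (intro mult_left_mono) (auto simp: algebra_simps)
      then show ?thesis by (simp add: algebra_simps)
    qed
    finally show ?thesis .
  qed
  obtain n where n: "1 \<le> n" "ln C1 + ln 6 + z * C + ln (real n * (real K + 1) + 1) \<le> real n * (\<theta> / 3)"
    using linear_beats_log[of "real K + 1" "\<theta> / 3" "ln C1 + ln 6 + z * C"] \<theta> by auto
  have zt: "z * \<theta>' \<le> \<theta> / 3"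
  proof -
    have "z * \<theta>' \<le> (z + 1) * \<theta>'" using \<theta>' by (intro mult_right_mono) auto
    also have "\<dots> = \<theta> / 3"
    proof -
      have "y * (\<theta> / (3 * y)) = \<theta> / 3" if "y \<noteq> 0" for y using that by simp
      from this[of "z + 1"] show ?thesis using z0 unfolding \<theta>'_def by simp
    qed
    finally show ?thesis .
  qed
  have "ent (itinerary f a n) \<le> ent (?q n) + real n * (\<integral>x. - ln (w (a x) (cell_index K x)) \<partial>M)"
    by (rule ent_itinerary_cond[OF a finite_valued_cell_index w(1,2)])
  also have "real n * (\<integral>x. - ln (w (a x) (cell_index K x)) \<partial>M) \<le> real n * (\<theta> / 3)" using w(3) by (rule mult_left_mono) simp
  also have "ent (?q n) \<le> real n * (\<theta> / 3) + real n * (?E + z * \<theta>')" using names[of n] n(2) by linarith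
  also have "real n * (?E + z * \<theta>') \<le> real n * (?E + \<theta> / 3)" using zt by (intro mult_left_mono) auto
  finally have "ent (itinerary f a n) \<le> real n * (?E + \<theta>)" by (simp add: algebra_simps)
  then have "ent (itinerary f a n) / real n \<le> ?E + \<theta>" using n(1) by (simp add: divide_le_eq mult.commute)
  then show "\<exists>n\<ge>1. ent (itinerary f a n) / real n \<le> ?E + \<theta>" using n(1) by blast
qed

text \<open>If \<open>psi\<close> has non-positive mean, bad blocks need not end. In this case the exponent itself is
  small and Ruelle's inequality suffices.\<close>

lemma exponent_bound:
  assumes psi_nonpos: "(\<integral>x. psi x \<partial>M) \<le> 0"
  defines "A \<equiv> \<integral>x. (if K0 \<le> lev x then real (lev x) else 0) \<partial>M"
  shows "(\<integral>x. ln (u x) \<partial>M) \<le> \<kappa> / (1 + \<kappa>) * (R + \<gamma> + \<gamma> * A)"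
proof -
  let ?c = "\<lambda>x. if K0 \<le> lev x then real (lev x) else 0"
  let ?g = "\<lambda>x. if K0 \<le> lev x then 0 else ln (u x)"
  let ?I = "\<integral>x. ?g x \<partial>M"
  have ci: "integrable M ?c" by (intro lev_if_integrable lev_set)
  note gi = noncritical_integrable
  have lnCR: "0 \<le> ln CR" using CR(1) by simp
  have pt: "birk f ?g n x \<le> (R + \<gamma>) * real n + ln CR + \<gamma> * birk f ?c n x" if x: "x \<in> pos_orbit" for n x
  proof -
    let ?P = "\<lambda>i. \<not> iscrit i x"
    have "birk f ?g n x = (\<Sum>i<n. if ?P i then ln (u ((f ^^ i) x)) else 0)"
      unfolding birk_def by (intro sum.cong) auto
    also have "\<dots> \<le> (R + \<gamma>) * real (card {i. i < n \<and> ?P i}) + ln CR * real (card {i. i < n \<and> ?P i \<and> (i = 0 \<or> \<not> ?P (i - 1))})"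
      by (rule ln_growth_runs[OF x])
    also have "(R + \<gamma>) * real (card {i. i < n \<and> ?P i}) \<le> (R + \<gamma>) * real n"
    proof -
      have "card {i. i < n \<and> ?P i} \<le> card {..<n}" by (intro card_mono) auto
      then show ?thesis using R_nonneg \<gamma> by (intro mult_left_mono) auto
    qed
    also have "ln CR * real (card {i. i < n \<and> ?P i \<and> (i = 0 \<or> \<not> ?P (i - 1))}) \<le> ln CR * (1 + real (card {i. i < n \<and> iscrit i x}))"
    proof -
      have "{i. i < n \<and> ?P i \<and> (i = 0 \<or> \<not> ?P (i - 1))} \<subseteq> insert 0 (Suc ` {i. i < n \<and> iscrit i x})"
      proof
        fix i assume "i \<in> {i. i < n \<and> ?P i \<and> (i = 0 \<or> \<not> ?P (i - 1))}"
        then show "i \<in> insert 0 (Suc ` {i. i < n \<and> iscrit i x})" by (cases i) auto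
      qed
      then have "card {i. i < n \<and> ?P i \<and> (i = 0 \<or> \<not> ?P (i - 1))} \<le> card (insert 0 (Suc ` {i. i < n \<and> iscrit i x}))"
        by (intro card_mono) auto
      also have "\<dots> \<le> Suc (card (Suc ` {i. i < n \<and> iscrit i x}))" by (rule card_insert_le_m1) auto
      also have "card (Suc ` {i. i < n \<and> iscrit i x}) = card {i. i < n \<and> iscrit i x}" by (intro card_image) auto
      finally show ?thesis using lnCR by (intro mult_left_mono) auto
    qed
    also have "ln CR * (1 + real (card {i. i < n \<and> iscrit i x})) \<le> ln CR + \<gamma> * birk f ?c n x"
    proof -
      have "real K0 * real (card {i. i < n \<and> iscrit i x}) = (\<Sum>i<n. if iscrit i x then real K0 else 0)"
        by (simp add: sum.If_cases Int_def mult.commute)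
      also have "\<dots> \<le> birk f ?c n x" unfolding birk_def by (intro sum_mono) auto
      finally have "\<gamma> * (real K0 * real (card {i. i < n \<and> iscrit i x})) \<le> \<gamma> * birk f ?c n x"
        using \<gamma> by (intro mult_left_mono) auto
      moreover have "ln CR * real (card {i. i < n \<and> iscrit i x}) \<le> (\<gamma> * real K0) * real (card {i. i < n \<and> iscrit i x})"
        using K0_big by (intro mult_right_mono) auto
      ultimately show ?thesis by (simp add: algebra_simps)
    qed
    finally show ?thesis by simp
  qed
  have int_n: "real n * ?I \<le> (R + \<gamma>) * real n + ln CR + \<gamma> * (real n * A)" for n
  proof -
    have "real n * ?I = (\<integral>x. birk f ?g n x \<partial>M)" using birk_integrable(2)[OF gi] by simp
    also have "\<dots> \<le> (\<integral>x. (R + \<gamma>) * real n + ln CR + \<gamma> * birk f ?c n x \<partial>M)"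
    proof (rule integral_mono_AE[OF birk_integrable(1)[OF gi]])
      show "integrable M (\<lambda>x. (R + \<gamma>) * real n + ln CR + \<gamma> * birk f ?c n x)"
        by (intro Bochner_Integration.integrable_add integrable_const integrable_mult_right birk_integrable(1)[OF ci])
      have "AE x in M. x \<in> pos_orbit" using prob_pos_orbit pos_orbit_events by (simp add: prob_eq_1)
      then show "AE x in M. birk f ?g n x \<le> (R + \<gamma>) * real n + ln CR + \<gamma> * birk f ?c n x"
        by eventually_elim (rule pt)
    qed
    also have "\<dots> = (R + \<gamma>) * real n + ln CR + \<gamma> * (real n * A)"
      using birk_integrable[OF ci, of n] by (subst Bochner_Integration.integral_add) (auto simp: prob_space A_def)
    finally show ?thesis .
  qed
  have noncrit: "?I \<le> R + \<gamma> + \<gamma> * A"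
  proof (rule field_le_epsilon)
    fix e :: real assume e: "0 < e"
    obtain n :: nat where n: "max 1 (ln CR / e) < real n" using reals_Archimedean2 by blast
    then have n0: "0 < real n" "ln CR \<le> e * real n" using e by (auto simp: field_simps)
    have "real n * ?I \<le> real n * (R + \<gamma> + \<gamma> * A + e)" using int_n[of n] n0 by (simp add: algebra_simps)
    then show "?I \<le> R + \<gamma> + \<gamma> * A + e" using n0 by simp
  qed
  \<comment> \<open>A critical step of level l has \<open>ln (u x) \<le> - l\<close>.\<close>
  have lam: "(\<integral>x. ln (u x) \<partial>M) \<le> ?I - A"
  proof -
    have "(\<integral>x. ln (u x) \<partial>M) \<le> (\<integral>x. ?g x - ?c x \<partial>M)"
    proof (rule integral_mono[OF ln_u_int Bochner_Integration.integrable_diff[OF gi ci]])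
      fix x
      show "ln (u x) \<le> ?g x - ?c x" using K0 unfolding lev_def by (auto; linarith)
    qed
    also have "\<dots> = ?I - A" unfolding A_def by (rule Bochner_Integration.integral_diff[OF gi ci])
    finally show ?thesis .
  qed
  have "?I \<le> (1 + \<kappa>) * A"
  proof -
    have "?I - (1 + \<kappa>) * A = (\<integral>x. ?g x - (1 + \<kappa>) * ?c x \<partial>M)"
      unfolding A_def using gi ci by simp
    also have "\<dots> \<le> (\<integral>x. psi x \<partial>M)"
      using gi ci \<gamma> by (intro integral_mono psi_integrable Bochner_Integration.integrable_diff integrable_mult_right)
        (auto simp: psi_def)
    finally show ?thesis using psi_nonpos by linarith
  qed
  then have 1: "(\<integral>x. ln (u x) \<partial>M) \<le> \<kappa> * A" using lam by (simp add: algebra_simps)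
  have 2: "(\<integral>x. ln (u x) \<partial>M) \<le> R + \<gamma> + \<gamma> * A - A" using lam noncrit by linarith
  \<comment> \<open>Adding \<kappa> times the second bound to the first cancels \<kappa> A; this
    weighting produces the factor \<kappa> / (1 + \<kappa>).\<close>
  have "\<kappa> * (\<integral>x. ln (u x) \<partial>M) \<le> \<kappa> * (R + \<gamma> + \<gamma> * A - A)" using 2 \<kappa>_pos by (intro mult_left_mono) auto
  then have "(1 + \<kappa>) * (\<integral>x. ln (u x) \<partial>M) \<le> \<kappa> * (R + \<gamma> + \<gamma> * A)" using 1 by (simp add: algebra_simps)
  then show ?thesis using \<kappa>_pos by (simp add: field_simps)
qed

end

context lifted_mpt
begin

text \<open>Ruelle's inequality for the truncations of the logarithm of the derivative at -T, for all T,
  gives its integrability.\<close>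

lemma exponent_of_positive_entropy:
  assumes e: "0 < e" and ent: "ereal e \<le> metric_entropy M f"
  shows "AE x in M. 0 < u x" "integrable M (\<lambda>x. ln (u x))" "e \<le> (\<integral>x. ln (u x) \<partial>M)"
    "(\<integral>x. max 0 (- ln (u x)) \<partial>M) \<le> ln \<Lambda>"
proof -
  define p where "p x = max 0 (ln (u x))" for x
  \<comment> \<open>The negative part truncated at T. At critical points it must be T, where the
    formula with \<open>ln 0 = 0\<close> would give 0.\<close>
  define k where "k T x = (if u x = 0 then real T else min (real T) (max 0 (- ln (u x))))" for T x
  define g where "g T x = p x - k T x" for T x
  have pm: "p \<in> borel_measurable M" unfolding p_def using u_meas by measurable
  have km: "k T \<in> borel_measurable M" for T unfolding k_def using u_meas by measurable
  have ln\<Lambda>: "0 \<le> ln \<Lambda>" using \<Lambda>_ge_1 by simp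
  have ple: "p x \<le> ln \<Lambda>" if "x \<in> X" for x
  proof (cases "u x = 0")
    case False
    then have "ln (u x) \<le> ln \<Lambda>" using u_le[OF that] u_nonneg[OF that] by simp
    then show ?thesis using ln\<Lambda> by (simp add: p_def)
  qed (use ln\<Lambda> in \<open>simp add: p_def\<close>)
  have p0: "0 \<le> p x" and k0: "0 \<le> k T x" and kT: "k T x \<le> real T" for T x
    by (auto simp: p_def k_def)
  have pint: "integrable M p"
    by (rule integrable_const_bound[where B = "ln \<Lambda>"]) (use ple p0 space_M pm in \<open>auto intro!: AE_I2\<close>)
  have kint: "integrable M (k T)" for T
    by (rule integrable_const_bound[where B = "real T"]) (use k0 kT km in \<open>auto intro!: AE_I2\<close>)
  have gint: "integrable M (g T)" for T
    unfolding g_def[abs_def] by (intro Bochner_Integration.integrable_diff pint kint)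
  have ug: "u x \<le> exp (g T x)" if "x \<in> X" for x T
  proof (cases "u x = 0")
    case False
    then have u: "0 < u x" using u_nonneg[OF that] by simp
    have "ln (u x) \<le> g T x" using False unfolding g_def p_def k_def by (auto simp: max_def min_def)
    then show ?thesis using u by (simp add: ln_le_cancel_iff[symmetric] del: ln_le_cancel_iff)
  qed simp
  have ge: "e \<le> (\<integral>x. g T x \<partial>M)" for T
  proof (rule ccontr)
    assume "\<not> e \<le> (\<integral>x. g T x \<partial>M)"
    then have lt: "(\<integral>x. g T x \<partial>M) < e" by simp
    show False
    proof (cases "0 < (\<integral>x. g T x \<partial>M)")
      case True
      from ruelle_inequality[OF gint ug True] ent lt show False
        by (meson dual_order.strict_trans2 less_ereal.simps(1) not_less)
    next
      case False
      \<comment> \<open>Ruelle's inequality requires a positive mean. Raising g by a constant gives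
        it mean e / 2, still too small for an entropy of at least e.\<close>
      define c where "c = e / 2 - (\<integral>x. g T x \<partial>M)"
      have c: "0 \<le> c" using False e by (simp add: c_def)
      have i: "integrable M (\<lambda>x. g T x + c)" using gint by simp
      have eq: "(\<integral>x. g T x + c \<partial>M) = e / 2" using gint by (simp add: c_def prob_space)
      have "u x \<le> exp (g T x + c)" if "x \<in> X" for x
      proof -
        have "exp (g T x) \<le> exp (g T x + c)" using c by simp
        then show ?thesis using ug[OF that, of T] by linarith
      qed
      from ruelle_inequality[OF i this] ent e show False unfolding eq
        by (metis dual_order.trans ereal_less_eq(3) field_sum_of_halves half_gt_zero less_add_same_cancel1 not_less)
    qed
  qed
  have kle: "(\<integral>x. k T x \<partial>M) \<le> (\<integral>x. p x \<partial>M) - e" for T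
    using ge[of T] pint kint[of T] unfolding g_def by simp
  have plam: "(\<integral>x. p x \<partial>M) \<le> ln \<Lambda>"
  proof -
    have "(\<integral>x. p x \<partial>M) \<le> (\<integral>x. ln \<Lambda> \<partial>M)" using ple space_M by (intro integral_mono pint) auto
    then show ?thesis by (simp add: prob_space)
  qed
  let ?Z = "{x\<in>space M. u x = 0}"
  have Zev: "?Z \<in> events" using u_meas by measurable
  have "real T * prob ?Z \<le> ln \<Lambda>" for T
  proof -
    have "real T * prob ?Z = (\<integral>x. real T * indicator ?Z x \<partial>M)" using Zev by (simp add: Int_absorb2)
    also have "\<dots> \<le> (\<integral>x. k T x \<partial>M)"
      using Zev k0 by (intro integral_mono kint integrable_mult_right integrable_real_indicator)
        (auto simp: emeasure_eq_measure k_def indicator_def)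
    also have "\<dots> \<le> ln \<Lambda>" using kle[of T] plam e by linarith
    finally show ?thesis .
  qed
  then have "prob ?Z = 0"
  proof -
    assume *: "\<And>T :: nat. real T * prob ?Z \<le> ln \<Lambda>"
    show ?thesis
    proof (rule ccontr)
      assume "prob ?Z \<noteq> 0"
      then have pz: "0 < prob ?Z" by (simp add: less_le)
      obtain T :: nat where "ln \<Lambda> / prob ?Z < real T" using reals_Archimedean2 by blast
      then have "ln \<Lambda> < real T * prob ?Z" using pz by (simp add: field_simps)
      then show False using *[of T] by simp
    qed
  qed
  then have "AE x in M. x \<notin> ?Z" using Zev by (intro AE_I[of _ _ ?Z]) (auto simp: emeasure_eq_measure)
  then show pos: "AE x in M. 0 < u x" using AE_space
  proof eventually_elim
    fix x assume "x \<notin> ?Z" "x \<in> space M"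
    then show "0 < u x" using u_nonneg[of x] space_M by (auto simp: less_le)
  qed
  define m where "m x = max 0 (- ln (u x))" for x
  have mm: "m \<in> borel_measurable M" unfolding m_def using u_meas by measurable
  have klim: "AE x in M. (\<lambda>T. k T x) \<longlonglongrightarrow> m x"
    using pos
  proof eventually_elim
    fix x assume x: "0 < u x"
    have "eventually (\<lambda>T. k T x = m x) sequentially"
      using eventually_ge_at_top[of "nat \<lceil>m x\<rceil>"]
    proof eventually_elim
      fix T assume "nat \<lceil>m x\<rceil> \<le> T"
      then have "m x \<le> real T" by linarith
      then show "k T x = m x" using x by (simp add: k_def m_def)
    qed
    then show "(\<lambda>T. k T x) \<longlonglongrightarrow> m x" by (rule tendsto_eventually)
  qed
  have kincr: "incseq (\<lambda>T. \<integral>x. k T x \<partial>M)"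
    by (intro incseq_SucI integral_mono kint) (auto simp: k_def)
  have "convergent (\<lambda>T. \<integral>x. k T x \<partial>M)"
  proof (rule incseq_convergent[OF kincr, of "ln \<Lambda>"])
    show "\<forall>i. (\<integral>x. k i x \<partial>M) \<le> ln \<Lambda>" using kle plam e by (meson diff_le_eq le_add_same_cancel1 less_imp_le order_trans)
  qed (auto simp: convergent_def)
  then obtain l where l: "(\<lambda>T. \<integral>x. k T x \<partial>M) \<longlonglongrightarrow> l" by (auto simp: convergent_def)
  have kmono: "AE x in M. mono (\<lambda>T. k T x)"
    by (intro AE_I2 monoI) (auto simp: k_def)
  have mint: "integrable M m" and meq: "(\<integral>x. m x \<partial>M) = l"
    using integrable_monotone_convergence[OF kint kmono klim l mm]
      integral_monotone_convergence[OF kint kmono klim l mm] by auto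
  have mle: "(\<integral>x. m x \<partial>M) \<le> (\<integral>x. p x \<partial>M) - e"
    unfolding meq using l by (rule LIMSEQ_le_const2) (use kle in auto)
  have eq: "ln (u x) = p x - m x" for x by (auto simp: p_def m_def)
  show "integrable M (\<lambda>x. ln (u x))" unfolding eq by (intro Bochner_Integration.integrable_diff pint mint)
  show "e \<le> (\<integral>x. ln (u x) \<partial>M)" unfolding eq using mle by (simp add: pint mint)
  show "(\<integral>x. max 0 (- ln (u x)) \<partial>M) \<le> ln \<Lambda>" using mle plam e unfolding m_def by linarith
qed

end

section \<open>Spanning sets and the choice of the constants\<close>

context lifted_map
begin

text \<open>A separated set of maximal cardinality is spanning. The definition of topological
  entropy controls large orders only; \<open>C1\<close> makes the bound uniform in m.\<close>

lemma spanning_sets: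
  assumes h: "topological_entropy X f = ereal h" and \<gamma>: "0 < \<gamma>" and e: "0 < e" and h0: "0 \<le> h"
  shows "\<exists>C1\<ge>1. \<forall>m. \<exists>E. finite E \<and> real (card E) \<le> C1 * exp (real m * (h + \<gamma>)) \<and>
    (\<forall>x\<in>X. \<exists>y\<in>E. \<forall>k<m. dist ((f ^^ k) x) ((f ^^ k) y) \<le> e)"
proof -
  let ?S = "\<lambda>n. {E. finite E \<and> E \<noteq> {} \<and> separated_set X f n e E}"
  let ?s = "\<lambda>n. (SUP E\<in>?S n. ereal (ln (real (card E)))) / ereal (real n)"
  have "limsup ?s \<le> topological_entropy X f"
    unfolding topological_entropy_def using e by (intro SUP_upper) auto
  also have "\<dots> < ereal (h + \<gamma>)" using h \<gamma> by simp
  finally have "eventually (\<lambda>n. ?s n < ereal (h + \<gamma>)) sequentially" by (rule Limsup_lessD)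
  then obtain N0 where N0: "\<And>n. n \<ge> N0 \<Longrightarrow> ?s n < ereal (h + \<gamma>)" by (auto simp: eventually_sequentially)
  define N where "N = max N0 1"
  have big: "real (card E) \<le> exp (real n * (h + \<gamma>))" if n: "N \<le> n" and E: "E \<in> ?S n" for n E
  proof -
    have n1: "1 \<le> n" "N0 \<le> n" using n by (auto simp: N_def)
    have "ereal (ln (real (card E))) / ereal (real n) \<le> ?s n"
      using n1 E by (intro ereal_divide_right_mono SUP_upper) auto
    also have "\<dots> < ereal (h + \<gamma>)" using N0[OF n1(2)] .
    finally have "ln (real (card E)) / real n < h + \<gamma>" using n1 by simp
    then have "ln (real (card E)) \<le> real n * (h + \<gamma>)" using n1 by (simp add: field_simps)
    moreover have "0 < real (card E)" using E by (auto simp: card_gt_0_iff)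
    ultimately show ?thesis by (metis exp_le_cancel_iff exp_ln)
  qed
  define C1 where "C1 = exp (real N * (h + \<gamma>))"
  have C1: "1 \<le> C1" using h0 \<gamma> by (simp add: C1_def)
  have all: "real (card E) \<le> C1 * exp (real m * (h + \<gamma>))" if E: "E \<in> ?S m" for m E
  proof (cases "N \<le> m")
    case True
    have "1 * exp (real m * (h + \<gamma>)) \<le> C1 * exp (real m * (h + \<gamma>))" using C1 by (intro mult_right_mono) auto
    then have "exp (real m * (h + \<gamma>)) \<le> C1 * exp (real m * (h + \<gamma>))" unfolding mult_1_left .
    then show ?thesis by (rule order_trans[OF big[OF True E]])
  next
    case False
    \<comment> \<open>A set separated within m steps is separated within N steps for m < N.\<close>
    then have "separated_set X f N e E" using E unfolding separated_set_def by (auto dest: less_trans[of _ m N]) (meson less_trans not_le)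
    then have "real (card E) \<le> C1" using big[of N E] E unfolding C1_def by simp
    also have "C1 * 1 \<le> C1 * exp (real m * (h + \<gamma>))" using C1 h0 \<gamma> by (intro mult_left_mono) auto
    finally show ?thesis by simp
  qed
  have "\<exists>E. finite E \<and> real (card E) \<le> C1 * exp (real m * (h + \<gamma>)) \<and>
    (\<forall>x\<in>X. \<exists>y\<in>E. \<forall>k<m. dist ((f ^^ k) x) ((f ^^ k) y) \<le> e)" for m
  proof (cases "X = {}")
    case True
    then show ?thesis using C1 by (intro exI[of _ "{}"]) simp
  next
    case False
    then obtain x0 where x0: "x0 \<in> X" by auto
    have one: "{x0} \<in> ?S m" using x0 by (auto simp: separated_set_def)
    define b where "b = nat \<lceil>C1 * exp (real m * (h + \<gamma>))\<rceil>"
    have bound: "card E \<le> b" if "E \<in> ?S m" for E using all[OF that] unfolding b_def by linarith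
    have "\<exists>E. E \<in> ?S m \<and> (\<forall>E'. E' \<in> ?S m \<longrightarrow> card E' \<le> card E)"
      using ex_has_greatest_nat[of "\<lambda>E. E \<in> ?S m" "{x0}" card "Suc b"] one bound by (auto simp: less_Suc_eq_le)
    then obtain E where E: "E \<in> ?S m" "\<And>E'. E' \<in> ?S m \<Longrightarrow> card E' \<le> card E" by blast
    have "\<exists>y\<in>E. \<forall>k<m. dist ((f ^^ k) x) ((f ^^ k) y) \<le> e" if x: "x \<in> X" for x
    proof (rule ccontr)
      assume "\<not> (\<exists>y\<in>E. \<forall>k<m. dist ((f ^^ k) x) ((f ^^ k) y) \<le> e)"
      then have far: "\<exists>k<m. dist ((f ^^ k) x) ((f ^^ k) y) > e" if "y \<in> E" for y
        using that by (auto simp: not_le)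
      have xE: "x \<notin> E"
      proof
        assume "x \<in> E"
        from far[OF this] e show False by auto
      qed
      have "separated_set X f m e (insert x E)"
        unfolding separated_set_def
      proof (intro conjI ballI impI)
        show "insert x E \<subseteq> X" using E(1) x by (auto simp: separated_set_def)
        fix a b assume ab: "a \<in> insert x E" "b \<in> insert x E" "a \<noteq> b"
        show "\<exists>k<m. e < dist ((f ^^ k) a) ((f ^^ k) b)"
        proof (cases "a = x \<or> b = x")
          case True
          then show ?thesis using ab far[of a] far[of b] by (auto simp: dist_commute)
        next
          case False
          then show ?thesis using ab E(1) by (auto simp: separated_set_def)
        qed
      qed
      then have "card (insert x E) \<le> card E" using E by (intro E(2)) auto
      then show False using xE E(1) by simp
    qed
    then show ?thesis using E(1) all[OF E(1)] by (intro exI[of _ E]) auto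
  qed
  then show ?thesis using C1 by blast
qed

text \<open>The order of quantifiers matters: the bound \<open>Kmin\<close> depends on \<gamma>
  only, while the scale \<epsilon> depends on \<open>K0\<close>, the constant \<open>C1\<close> on
  \<epsilon>, and the bound for \<open>K1\<close> on \<open>C1\<close>. Any pair far enough apart is
  allowed, which permits many windows for the same \<gamma>.\<close>

lemma coding_exists:
  assumes h: "topological_entropy X f = ereal h" and h0: "0 \<le> h" and \<gamma>: "0 < \<gamma>"
  shows "\<exists>Kmin. \<forall>K0\<ge>Kmin. \<exists>K1min. \<forall>K1\<ge>K1min. \<exists>\<epsilon> B C1 \<rho> CR.
    weighted_coding X f D prj sec F dF u r R \<Lambda> K0 K1 \<gamma> \<epsilon> B C1 (h + \<gamma>) \<rho> CR"
proof -
  obtain CR where CR: "1 \<le> CR" "\<forall>l. \<forall>t\<in>D. (\<Prod>i<l. \<bar>dF ((F ^^ i) t)\<bar>) \<le> CR * exp (real l * (R + \<gamma>))"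
    using growth[OF \<gamma>] by auto
  obtain B \<epsilon>1 where B: "1 \<le> B" "0 < \<epsilon>1" and cs: "\<forall>Y \<delta> (k::nat). Y \<subseteq> D \<longrightarrow> 0 \<le> \<delta> \<longrightarrow> \<delta> \<le> \<epsilon>1 \<longrightarrow> (\<forall>a\<in>Y. \<forall>b\<in>Y. \<bar>a - b\<bar> \<le> \<delta>) \<longrightarrow>
    (\<forall>a\<in>Y. exp (- real k - 1) < \<bar>dF a\<bar> \<and> \<bar>dF a\<bar> \<le> exp (- real k)) \<longrightarrow>
    splits (B * exp (\<kappa> * real k))
      (\<lambda>V. (\<forall>a\<in>V. \<forall>b\<in>V. \<bar>a - b\<bar> \<le> \<delta> * exp (- \<kappa> * real k)) \<and>
           (\<forall>t\<in>convex_closure1 V. dF t \<noteq> 0 \<and> \<bar>dF t\<bar> \<le> exp (2 - real k))) Y"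
    using critical_splits by blast
  \<comment> \<open>The value for which \<open>- 2 * ln (1 - \<rho>) = \<gamma>\<close>.\<close>
  define \<rho> where "\<rho> = 1 - exp (- (\<gamma> / 2))"
  have \<rho>: "0 < \<rho>" "\<rho> < 1" "- 2 * ln (1 - \<rho>) \<le> \<gamma>" using \<gamma> by (auto simp: \<rho>_def)
  define x where "x = exp (- \<gamma>)"
  have x: "0 < x" "x < 1" using \<gamma> by (auto simp: x_def)
  have "(\<lambda>K. x ^ K / (1 - x)) \<longlonglongrightarrow> 0 / (1 - x)"
    using x by (intro tendsto_divide LIMSEQ_realpow_zero tendsto_const) auto
  then have "eventually (\<lambda>K. x ^ K / (1 - x) < \<rho>) sequentially" using \<rho>(1) by (intro order_tendstoD(2)) auto
  then obtain Kt where Kt: "\<And>K. K \<ge> Kt \<Longrightarrow> x ^ K / (1 - x) < \<rho>" by (auto simp: eventually_sequentially)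
  have tail: "(\<Sum>k\<in>{k\<in>S. K0 \<le> k}. exp (- \<gamma> * real k)) \<le> \<rho>" if S: "finite S" and K0: "Kt \<le> K0" for S K0
  proof -
    have pw: "exp (- \<gamma> * real k) = x ^ k" for k unfolding x_def by (simp add: exp_of_nat_mult[symmetric] mult.commute)
    have "(\<Sum>k\<in>{k\<in>S. K0 \<le> k}. exp (- \<gamma> * real k)) = (\<Sum>j\<in>(\<lambda>k. k - K0) ` {k\<in>S. K0 \<le> k}. x ^ (j + K0))"
      unfolding pw by (subst sum.reindex) (auto simp: inj_on_def)
    also have "\<dots> = x ^ K0 * (\<Sum>j\<in>(\<lambda>k. k - K0) ` {k\<in>S. K0 \<le> k}. x ^ j)"
      by (simp add: power_add sum_distrib_left mult.commute)
    also have "(\<Sum>j\<in>(\<lambda>k. k - K0) ` {k\<in>S. K0 \<le> k}. x ^ j) \<le> (\<Sum>j. x ^ j)"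
      using x S by (intro sum_le_suminf summable_geometric) auto
    also have "(\<Sum>j. x ^ j) = 1 / (1 - x)" using x by (intro suminf_geometric) auto
    finally have "(\<Sum>k\<in>{k\<in>S. K0 \<le> k}. exp (- \<gamma> * real k)) \<le> x ^ K0 / (1 - x)" using x by simp
    then show ?thesis using Kt[OF K0] by linarith
  qed
  obtain Ka :: nat where Ka: "max (ln CR + 2) (ln B) / \<gamma> < real Ka" using reals_Archimedean2 by blast
  define Kmin where "Kmin = max 2 (max Kt Ka)"
  show ?thesis
  proof (rule exI[of _ Kmin], intro allI impI)
    fix K0 assume "Kmin \<le> K0"
    then have K0: "2 \<le> K0" "Kt \<le> K0" "Ka \<le> K0" by (auto simp: Kmin_def)
    have "max (ln CR + 2) (ln B) < \<gamma> * real Ka" using Ka \<gamma> by (simp add: field_simps)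
    also have "\<dots> \<le> \<gamma> * real K0" using K0 \<gamma> by (intro mult_left_mono) auto
    finally have K0b: "ln CR + 2 \<le> \<gamma> * real K0" "ln B \<le> \<gamma> * real K0" by auto
    have "0 < min \<gamma> (1/2) * exp (- real K0)" using \<gamma> by simp
    then obtain d where d: "0 < d" "\<And>s t. s \<in> D \<Longrightarrow> t \<in> D \<Longrightarrow> \<bar>t - s\<bar> < d \<Longrightarrow> \<bar>dF t - dF s\<bar> < min \<gamma> (1/2) * exp (- real K0)"
      using dF_unif unfolding uniformly_continuous_on_def dist_real_def by meson
    \<comment> \<open>The three terms serve the oscillation of dF, the lemma on critical steps, and
      growth from \<epsilon> to at most 1/4 in one step.\<close>
    define \<epsilon> where "\<epsilon> = min (min (d / 2) \<epsilon>1) (1 / (4 * \<Lambda>))"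
    have \<epsilon>: "0 < \<epsilon>" "\<epsilon> < d" "\<epsilon> \<le> \<epsilon>1" using d(1) B \<Lambda>_ge_1 by (auto simp: \<epsilon>_def)
    have "\<Lambda> * \<epsilon> \<le> \<Lambda> * (1 / (4 * \<Lambda>))" using \<Lambda>_ge_1 by (intro mult_left_mono) (auto simp: \<epsilon>_def)
    then have \<Lambda>\<epsilon>: "\<Lambda> * \<epsilon> \<le> 1/4" using \<Lambda>_ge_1 by simp
    have "0 < \<epsilon> / 2" using \<epsilon> by simp
    from spanning_sets[OF h \<gamma> this h0] obtain C1 where C1: "1 \<le> C1" "\<forall>m. \<exists>E. finite E \<and> real (card E) \<le> C1 * exp (real m * (h + \<gamma>)) \<and>
      (\<forall>x\<in>X. \<exists>y\<in>E. \<forall>k<m. dist ((f ^^ k) x) ((f ^^ k) y) \<le> \<epsilon> / 2)" by blast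
    obtain Kb :: nat where Kb: "(ln C1 + ln (1 / \<epsilon> + 2) - ln \<rho>) / \<gamma> < real Kb" using reals_Archimedean2 by blast
    show "\<exists>K1min. \<forall>K1\<ge>K1min. \<exists>\<epsilon> B C1 \<rho> CR. weighted_coding X f D prj sec F dF u r R \<Lambda> K0 K1 \<gamma> \<epsilon> B C1 (h + \<gamma>) \<rho> CR"
    proof (rule exI[of _ "max K0 Kb"], intro allI impI)
      fix K1 assume "max K0 Kb \<le> K1"
      then have K1: "K0 \<le> K1" "Kb \<le> K1" by auto
      have "ln C1 + ln (1 / \<epsilon> + 2) - ln \<rho> < \<gamma> * real Kb" using Kb \<gamma> by (simp add: field_simps)
      also have "\<dots> \<le> \<gamma> * real K1" using K1 \<gamma> by (intro mult_left_mono) auto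
      finally have K1b: "ln C1 + ln (1 / \<epsilon> + 2) - ln \<rho> \<le> \<gamma> * real K1" by simp
      have "weighted_coding X f D prj sec F dF u r R \<Lambda> K0 K1 \<gamma> \<epsilon> B C1 (h + \<gamma>) \<rho> CR"
      proof unfold_locales
        show "\<bar>dF s - dF t\<bar> < min \<gamma> (1/2) * exp (- real K0)" if "s \<in> D" "t \<in> D" "\<bar>s - t\<bar> \<le> \<epsilon>" for s t
          using d(2)[OF that(2,1)] that(3) \<epsilon>(2) by simp
        fix Y \<delta> and k :: nat
        assume "Y \<subseteq> D" "0 \<le> \<delta>" "\<delta> \<le> \<epsilon>" "\<forall>a\<in>Y. \<forall>b\<in>Y. \<bar>a - b\<bar> \<le> \<delta>"
          "\<forall>a\<in>Y. exp (- real k - 1) < \<bar>dF a\<bar> \<and> \<bar>dF a\<bar> \<le> exp (- real k)"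
        moreover have "\<delta> \<le> \<epsilon>1" using \<open>\<delta> \<le> \<epsilon>\<close> \<epsilon>(3) by simp
        ultimately show "splits (B * exp (\<kappa> * real k))
          (\<lambda>V. (\<forall>a\<in>V. \<forall>b\<in>V. \<bar>a - b\<bar> \<le> \<delta> * exp (- \<kappa> * real k)) \<and>
           (\<forall>t\<in>convex_closure1 V. dF t \<noteq> 0 \<and> \<bar>dF t\<bar> \<le> exp (2 - real k))) Y" using cs by blast
      qed (use K0 K1 \<gamma> \<epsilon> \<Lambda>\<epsilon> B C1 \<rho> CR K0b K1b tail in auto)
      then show "\<exists>\<epsilon> B C1 \<rho> CR. weighted_coding X f D prj sec F dF u r R \<Lambda> K0 K1 \<gamma> \<epsilon> B C1 (h + \<gamma>) \<rho> CR" by blast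
    qed
  qed
qed

end

context lifted_map
begin

lemma lifted_mptI:
  assumes "ergodic_measure_on X f M"
  shows "lifted_mpt X f D prj sec F dF u r R \<Lambda> M"
proof -
  interpret prob_space M using assms by (simp add: ergodic_measure_on_def)
  show ?thesis
    by unfold_locales (use assms in \<open>auto simp: ergodic_measure_on_def\<close>)
qed

text \<open>At \<gamma> = 0 the last expression equals \<kappa> / (1 + \<kappa>) R = R / r, strictly
  below the midpoint of h and R / r; all conditions therefore hold for small \<gamma>.\<close>

lemma parameter_exists:
  assumes gap: "R / r < h" and a: "0 < a" and b: "0 < b"
  shows "\<exists>\<gamma>>0. \<gamma> \<le> 1/2 \<and> \<gamma> \<le> \<kappa> \<and> \<gamma> < a \<and> \<gamma> * (1 + ln \<Lambda>) < b \<and>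
    (\<kappa> + 3 * \<gamma>) / (1 + \<kappa> - \<gamma>) * (R + 2 * \<gamma>) < (h + R / r) / 2"
proof -
  have "((\<lambda>\<gamma>. (\<kappa> + 3 * \<gamma>) / (1 + \<kappa> - \<gamma>) * (R + 2 * \<gamma>)) \<longlongrightarrow> (\<kappa> + 3 * 0) / (1 + \<kappa> - 0) * (R + 2 * 0)) (at_right 0)"
    using \<kappa>_pos by (intro tendsto_intros) auto
  moreover have "(\<kappa> + 3 * 0) / (1 + \<kappa> - 0) * (R + 2 * 0) = R / r"
    using r_gt_1 by (simp add: \<kappa>_def field_simps)
  ultimately have "((\<lambda>\<gamma>. (\<kappa> + 3 * \<gamma>) / (1 + \<kappa> - \<gamma>) * (R + 2 * \<gamma>)) \<longlongrightarrow> R / r) (at_right 0)" by simp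
  then have e1: "eventually (\<lambda>\<gamma>. (\<kappa> + 3 * \<gamma>) / (1 + \<kappa> - \<gamma>) * (R + 2 * \<gamma>) < (h + R / r) / 2) (at_right 0)"
  proof (rule order_tendstoD(2))
    have "q < (h + q) / 2" if "q < h" for q using that by simp
    then show "R / r < (h + R / r) / 2" using gap by blast
  qed
  have "((\<lambda>\<gamma>. \<gamma> * (1 + ln \<Lambda>)) \<longlongrightarrow> 0 * (1 + ln \<Lambda>)) (at_right 0)" by (intro tendsto_intros)
  then have e2: "eventually (\<lambda>\<gamma>. \<gamma> * (1 + ln \<Lambda>) < b) (at_right 0)" using b by (intro order_tendstoD(2)) auto
  have e3: "eventually (\<lambda>\<gamma>. 0 < \<gamma> \<and> \<gamma> < min (1/2) (min \<kappa> a)) (at_right (0::real))"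
    using a \<kappa>_pos by (intro eventually_conj eventually_at_right_less eventually_at_rightI[of 0 "min (1/2) (min \<kappa> a)"]) auto
  have "eventually (\<lambda>\<gamma>. 0 < \<gamma> \<and> \<gamma> \<le> 1/2 \<and> \<gamma> \<le> \<kappa> \<and> \<gamma> < a \<and> \<gamma> * (1 + ln \<Lambda>) < b \<and>
    (\<kappa> + 3 * \<gamma>) / (1 + \<kappa> - \<gamma>) * (R + 2 * \<gamma>) < (h + R / r) / 2) (at_right 0)"
    using e1 e2 e3 by eventually_elim auto
  from eventually_happens[OF this] show ?thesis by auto
qed

end

context lifted_mpt
begin

text \<open>Where u is positive and below \<eta>, the level is at least K, and
  \<open>- ln (u x)\<close> is at most the level plus 1, hence at most twice the level. The value
  infinity of \<open>- ext_log\<close> occurs on a null set, and the integrand has no negative part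
  because \<eta> < 1.\<close>

lemma ext_set_integral_le:
  assumes upos: "AE x in M. 0 < u x" and int: "integrable M (\<lambda>x. if K \<le> lev x then real (lev x) else 0)"
    and K: "1 \<le> K" and \<eta>: "0 < \<eta>" "\<eta> \<le> exp (- real K)"
  shows "ext_set_integral M {x\<in>X. u x < \<eta>} (\<lambda>x. - ext_log (u x))
    \<le> ereal (2 * (\<integral>x. (if K \<le> lev x then real (lev x) else 0) \<partial>M))"
proof -
  let ?\<phi> = "\<lambda>x. if x \<in> {x\<in>X. u x < \<eta>} then - ext_log (u x) else 0"
  let ?d = "\<lambda>x. if K \<le> lev x then real (lev x) else 0"
  have "\<eta> < 1"
  proof -
    have "exp (- real K) < 1" using K by simp
    then show ?thesis using \<eta> by linarith
  qed
  have neg: "e2ennreal (- ?\<phi> x) = 0" for x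
  proof (cases "x \<in> {x\<in>X. u x < \<eta>} \<and> u x \<noteq> 0")
    case True
    then have "0 < u x" "u x < 1" using u_nonneg[of x] \<open>\<eta> < 1\<close> by auto
    then have "ln (u x) \<le> 0" by simp
    then show ?thesis using True by (simp add: ext_log_def ennreal_neg)
  next
    case False
    then show ?thesis by (auto simp: ext_log_def e2ennreal_neg)
  qed
  have pos: "AE x in M. e2ennreal (?\<phi> x) \<le> ennreal (2 * ?d x)"
    using upos
  proof eventually_elim
    fix x assume u: "0 < u x"
    show "e2ennreal (?\<phi> x) \<le> ennreal (2 * ?d x)"
    proof (cases "x \<in> {x\<in>X. u x < \<eta>}")
      case True
      then have "ln (u x) < ln (exp (- real K))" using u \<eta> by (subst ln_less_cancel_iff) auto
      then have l: "real K < - ln (u x)" by simp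
      then have "K \<le> lev x" unfolding lev_def by linarith
      moreover have "- ln (u x) \<le> real (lev x) + 1" unfolding lev_def by linarith
      ultimately have "- ln (u x) \<le> 2 * ?d x" using K by auto
      moreover have "e2ennreal (?\<phi> x) = ennreal (- ln (u x))"
        using True u by (simp add: ext_log_def ennreal.abs_eq)
      ultimately show ?thesis by (simp only: ennreal_leI)
    qed auto
  qed
  have "(\<integral>\<^sup>+x. e2ennreal (?\<phi> x) \<partial>M) \<le> (\<integral>\<^sup>+x. ennreal (2 * ?d x) \<partial>M)" using pos by (rule nn_integral_mono_AE)
  also have "\<dots> = ennreal (\<integral>x. 2 * ?d x \<partial>M)" using int by (intro nn_integral_eq_integral) auto
  also have "(\<integral>x. 2 * ?d x \<partial>M) = 2 * (\<integral>x. ?d x \<partial>M)" by simp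
  finally have "enn2ereal (\<integral>\<^sup>+x. e2ennreal (?\<phi> x) \<partial>M) \<le> enn2ereal (ennreal (2 * (\<integral>x. ?d x \<partial>M)))"
    by (simp only: less_eq_ennreal.rep_eq)
  also have "\<dots> = ereal (2 * (\<integral>x. ?d x \<partial>M))" by (subst enn2ereal_ennreal) (auto intro!: Bochner_Integration.integral_nonneg)
  finally show ?thesis unfolding ext_set_integral_def ext_integral_def by (simp only: neg) (simp add: zero_ennreal.rep_eq)
qed

end

lemma sum_windows:
  fixes K :: "nat \<Rightarrow> nat" and l :: nat
  assumes K: "\<And>j. K j \<le> K (Suc j)"
  shows "(\<Sum>j<J. if K j \<le> l \<and> l < K (Suc j) then real l else 0) = (if K 0 \<le> l \<and> l < K J then real l else 0)"
proof (induction J)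
  case (Suc J)
  have "K 0 \<le> K J" using lift_Suc_mono_le[of K 0 J] K by simp
  then show ?case using Suc K[of J] by auto
qed simp

text \<open>The levels are split into J windows; on one of them a given measure has little mass, and this
  window separates the critical steps from the deep ones.\<close>

theorem (in lifted_map) uniform_integrability:
  assumes htop: "ereal (R / r) < topological_entropy X f" and \<epsilon>: "0 < \<epsilon>"
  shows "\<exists>\<delta>>0. \<exists>\<eta>>0. \<forall>M. ergodic_measure_on X f M \<longrightarrow>
    topological_entropy X f - ereal \<delta> \<le> metric_entropy M f \<longrightarrow>
    ext_set_integral M {x\<in>X. u x < \<eta>} (\<lambda>x. - ext_log (u x)) < ereal \<epsilon>"
proof (cases "topological_entropy X f")
  case MInf
  then show ?thesis using htop by simp
next
  case PInf
  \<comment> \<open>If the topological entropy is infinite, so is the lower bound required of the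
    entropy of M, but Ruelle's inequality makes the latter finite. The summand 1 gives the majorant
    a positive mean even if \<open>ln \<Lambda> = 0\<close>.\<close>
  have False if M: "ergodic_measure_on X f M" "topological_entropy X f - ereal 1 \<le> metric_entropy M f" for M
  proof -
    interpret lifted_mpt X f D prj sec F dF u r R \<Lambda> M using M(1) by (rule lifted_mptI)
    have "0 \<le> ln \<Lambda>" using \<Lambda>_ge_1 by simp
    moreover have "u x \<le> exp (ln \<Lambda> + 1)" if "x \<in> X" for x
    proof -
      have "exp (ln \<Lambda>) \<le> exp (ln \<Lambda> + 1)" by simp
      then show ?thesis using u_le[OF that] \<Lambda>_ge_1 by simp
    qed
    ultimately have "metric_entropy M f \<le> ereal (\<integral>x. ln \<Lambda> + 1 \<partial>M)"
      by (intro ruelle_inequality) (auto simp: prob_space)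
    then show False using M(2) PInf by simp
  qed
  then show ?thesis by (intro exI[of _ "1::real"] conjI) auto
next
  case (real h)
  note h = real
  have gap: "R / r < h" using htop h by simp
  define \<Delta> where "\<Delta> = h - R / r"
  have \<Delta>: "0 < \<Delta>" using gap by (simp add: \<Delta>_def)
  have Rr: "0 \<le> R / r" using R_nonneg r_gt_1 by simp
  have h0: "0 < h" using gap Rr by linarith
  \<comment> \<open>A lower bound for \<xi> independent of \<gamma>: the surplus is at least
    \<Delta> / 2 and R + 2 \<gamma> is at most R + 1.\<close>
  define \<xi>0 where "\<xi>0 = \<Delta> / (2 * (R + 1))"
  have \<xi>0: "0 < \<xi>0" using \<Delta> R_nonneg by (simp add: \<xi>0_def)
  \<comment> \<open>The error budget: \<delta>, 2 \<gamma> and the loss in the window will each be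
    at most c, and 4 c = \<xi>0 \<epsilon> / 2.\<close>
  define c where "c = \<xi>0 * \<epsilon> / 8"
  have c: "0 < c" using \<xi>0 \<epsilon> by (simp add: c_def)
  define \<delta> where "\<delta> = min (\<Delta> / 2) c"
  have \<delta>: "0 < \<delta>" "\<delta> \<le> \<Delta> / 2" "\<delta> \<le> c" using \<Delta> c by (auto simp: \<delta>_def)
  have \<delta>h: "0 < h - \<delta>"
  proof -
    have "0 < h - \<delta>" if "\<delta> \<le> (h - q) / 2" "0 < h - q" "0 \<le> q" for q
      using that by (simp add: field_simps)
    then show ?thesis using \<delta>(2) \<Delta> Rr unfolding \<Delta>_def by blast
  qed
  define A where "A = ln \<Lambda>"
  have A0: "0 \<le> A" using \<Lambda>_ge_1 by (simp add: A_def)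
  \<comment> \<open>J depends on the budget alone. The mean levels of the windows add up to at most
    A, so for each measure some window has mean at most A / J.\<close>
  obtain J :: nat where J: "max 1 (A * (\<kappa> + 1) / c) < real J" using reals_Archimedean2 by blast
  have J1: "0 < real J" and J2: "(\<kappa> + 1) * (A / real J) \<le> c" using J c by (auto simp: field_simps)
  have "0 < c / 2" "0 < \<Delta> / 2" using c \<Delta> by auto
  from parameter_exists[OF gap this] obtain \<gamma> where \<gamma>: "0 < \<gamma>" "\<gamma> \<le> 1/2" "\<gamma> \<le> \<kappa>" "\<gamma> < c / 2"
    "\<gamma> * (1 + A) < \<Delta> / 2" "(\<kappa> + 3 * \<gamma>) / (1 + \<kappa> - \<gamma>) * (R + 2 * \<gamma>) < (h + R / r) / 2"
    unfolding A_def by blast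
  define \<xi> where "\<xi> = (h - (\<kappa> + 3 * \<gamma>) / (1 + \<kappa> - \<gamma>) * (R + 2 * \<gamma>)) / (R + 2 * \<gamma>)"
  have \<xi>: "\<xi>0 \<le> \<xi>"
  proof -
    have num: "\<Delta> / 2 \<le> h - (\<kappa> + 3 * \<gamma>) / (1 + \<kappa> - \<gamma>) * (R + 2 * \<gamma>)" using \<gamma>(6) by (simp add: \<Delta>_def field_simps)
    have "\<xi>0 = (\<Delta> / 2) / (R + 1)" by (simp add: \<xi>0_def)
    also have "\<dots> \<le> (h - (\<kappa> + 3 * \<gamma>) / (1 + \<kappa> - \<gamma>) * (R + 2 * \<gamma>)) / (R + 2 * \<gamma>)"
      using num \<Delta> R_nonneg \<gamma> by (intro frac_le) auto
    finally show ?thesis by (simp add: \<xi>_def)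
  qed
  obtain Kmin where Kmin: "\<forall>K0\<ge>Kmin. \<exists>K1min. \<forall>K1\<ge>K1min. \<exists>\<epsilon> B C1 \<rho> CR.
    weighted_coding X f D prj sec F dF u r R \<Lambda> K0 K1 \<gamma> \<epsilon> B C1 (h + \<gamma>) \<rho> CR"
    using coding_exists[OF h less_imp_le[OF h0] \<gamma>(1)] by blast
  then obtain nx where nx: "\<And>K0 K1. Kmin \<le> K0 \<Longrightarrow> nx K0 \<le> K1 \<Longrightarrow> \<exists>\<epsilon> B C1 \<rho> CR.
    weighted_coding X f D prj sec F dF u r R \<Lambda> K0 K1 \<gamma> \<epsilon> B C1 (h + \<gamma>) \<rho> CR"
    by metis
  \<comment> \<open>Successive thresholds such that \<open>K j\<close> and \<open>K (Suc j)\<close>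
    are always an admissible pair \<open>K0\<close>, \<open>K1\<close>.\<close>
  define K where "K = rec_nat (max Kmin 1) (\<lambda>_ k. max k (nx k))"
  have K_0: "K 0 = max Kmin 1" and K_Suc: "K (Suc j) = max (K j) (nx (K j))" for j by (simp_all add: K_def)
  have Kmono: "K j \<le> K (Suc j)" for j by (simp add: K_Suc)
  have Kle: "K i \<le> K j" if "i \<le> j" for i j using lift_Suc_mono_le[of K, OF Kmono that] .
  have Kbig: "Kmin \<le> K j" "1 \<le> K j" for j using Kle[of 0 j] K_0 by auto
  \<comment> \<open>Below \<eta> the level exceeds the upper end of every window, so the same \<eta>
    works whichever window suits the measure.\<close>
  define \<eta> where "\<eta> = exp (- real (K J))"
  have "ext_set_integral M {x\<in>X. u x < \<eta>} (\<lambda>x. - ext_log (u x)) < ereal \<epsilon>"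
    if M: "ergodic_measure_on X f M" "topological_entropy X f - ereal \<delta> \<le> metric_entropy M f" for M
  proof -
    interpret lifted_mpt X f D prj sec F dF u r R \<Lambda> M using M(1) by (rule lifted_mptI)
    have ent: "ereal (h - \<delta>) \<le> metric_entropy M f" using M(2) h by simp
    note exponent = exponent_of_positive_entropy[OF \<delta>h ent]
    have lev_le: "real (lev x) \<le> max 0 (- ln (u x))" for x unfolding lev_def by linarith
    have mint: "integrable M (\<lambda>x. max 0 (- ln (u x)))"
      using exponent(2) by (intro Bochner_Integration.integrable_max) auto
    have wm: "\<exists>\<epsilon> B C1 \<rho> CR. weighted_mpt X f D prj sec F dF u r R \<Lambda> (K j) (K (Suc j)) \<gamma> \<epsilon> B C1 (h + \<gamma>) \<rho> CR M" for j
    proof -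
      have "nx (K j) \<le> K (Suc j)" by (simp add: K_Suc)
      from nx[OF Kbig(1) this] obtain \<epsilon> B C1 \<rho> CR where
        "weighted_coding X f D prj sec F dF u r R \<Lambda> (K j) (K (Suc j)) \<gamma> \<epsilon> B C1 (h + \<gamma>) \<rho> CR" by blast
      then have "weighted_mpt X f D prj sec F dF u r R \<Lambda> (K j) (K (Suc j)) \<gamma> \<epsilon> B C1 (h + \<gamma>) \<rho> CR M"
        by (intro weighted_mpt.intro weighted_mpt_axioms.intro lifted_mpt_axioms exponent(1,2))
      then show ?thesis by blast
    qed
    define mo where "mo j x = (if K j \<le> lev x \<and> lev x < K (Suc j) then real (lev x) else 0)" for j x
    have mo_int: "integrable M (mo j)" for j
    proof -
      obtain \<epsilon> B C1 \<rho> CR where "weighted_mpt X f D prj sec F dF u r R \<Lambda> (K j) (K (Suc j)) \<gamma> \<epsilon> B C1 (h + \<gamma>) \<rho> CR M"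
        using wm by blast
      then interpret W: weighted_mpt X f D prj sec F dF u r R \<Lambda> "K j" "K (Suc j)" \<gamma> \<epsilon> B C1 "h + \<gamma>" \<rho> CR M .
      show ?thesis using W.moderate_integrable unfolding W.moderate_def[abs_def] mo_def[abs_def] .
    qed
    have "(\<Sum>j<J. \<integral>x. mo j x \<partial>M) = (\<integral>x. (\<Sum>j<J. mo j x) \<partial>M)"
      using mo_int by (intro Bochner_Integration.integral_sum[symmetric])
    also have "\<dots> \<le> (\<integral>x. max 0 (- ln (u x)) \<partial>M)"
    proof (intro integral_mono Bochner_Integration.integrable_sum mo_int mint)
      fix x
      have "(\<Sum>j<J. mo j x) \<le> real (lev x)" unfolding mo_def sum_windows[of K, OF Kmono] by simp
      then show "(\<Sum>j<J. mo j x) \<le> max 0 (- ln (u x))" using lev_le[of x] by linarith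
    qed
    also have "\<dots> \<le> A" using exponent(4) by (simp add: A_def)
    finally have sum_mo: "(\<Sum>j<J. \<integral>x. mo j x \<partial>M) \<le> A" .
    have "\<exists>j<J. (\<integral>x. mo j x \<partial>M) \<le> A / real J"
    proof (rule ccontr)
      assume "\<not> ?thesis"
      then have "(\<Sum>j<J. A / real J) < (\<Sum>j<J. \<integral>x. mo j x \<partial>M)" using J1 by (intro sum_strict_mono) auto
      then show False using sum_mo J1 by simp
    qed
    then obtain j where j: "j < J" "(\<integral>x. mo j x \<partial>M) \<le> A / real J" by blast
    obtain \<epsilon>' B C1 \<rho> CR where "weighted_mpt X f D prj sec F dF u r R \<Lambda> (K j) (K (Suc j)) \<gamma> \<epsilon>' B C1 (h + \<gamma>) \<rho> CR M"
      using wm by blast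
    then interpret W: weighted_mpt X f D prj sec F dF u r R \<Lambda> "K j" "K (Suc j)" \<gamma> \<epsilon>' B C1 "h + \<gamma>" \<rho> CR M .
    let ?mod = "\<integral>x. W.moderate x \<partial>M" and ?deep = "\<integral>x. W.deep x \<partial>M"
    have mod: "?mod \<le> A / real J" using j(2) unfolding W.moderate_def[abs_def] mo_def[abs_def] .
    have psi_pos: "0 < (\<integral>x. W.psi x \<partial>M)"
    proof (rule ccontr)
      assume "\<not> ?thesis"
      then have np: "(\<integral>x. W.psi x \<partial>M) \<le> 0" by simp
      let ?a = "\<integral>x. (if K j \<le> lev x then real (lev x) else 0) \<partial>M"
      have "?a \<le> (\<integral>x. max 0 (- ln (u x)) \<partial>M)"
        using lev_le by (intro integral_mono W.lev_if_integrable W.lev_set mint) auto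
      then have a: "?a \<le> A" using exponent(4) by (simp add: A_def)
      have \<kappa>r: "\<kappa> / (1 + \<kappa>) = 1 / r" using r_gt_1 by (simp add: \<kappa>_def field_simps)
      have "(\<integral>x. ln (u x) \<partial>M) \<le> (1 / r) * (R + \<gamma> + \<gamma> * ?a)" using W.exponent_bound[OF np] unfolding \<kappa>r .
      also have "\<dots> \<le> (1 / r) * (R + \<gamma> * (1 + A))"
        using a \<gamma>(1) r_gt_1 by (intro mult_left_mono) (auto simp: algebra_simps)
      also have "\<dots> = R / r + (1 / r) * (\<gamma> * (1 + A))" by (simp add: algebra_simps add_divide_distrib)
      also have "(1 / r) * (\<gamma> * (1 + A)) \<le> 1 * (\<gamma> * (1 + A))"
        using r_gt_1 \<gamma>(1) A0 by (intro mult_right_mono) auto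
      finally have "(\<integral>x. ln (u x) \<partial>M) < R / r + \<Delta> / 2" using \<gamma>(5) by simp
      then show False using exponent(3) \<delta>(2) unfolding \<Delta>_def by (simp add: field_simps)
    qed
    have "0 \<le> \<xi>" using \<xi> \<xi>0 by simp
    then have "metric_entropy M f \<le> ereal (h + 2 * \<gamma> + (\<kappa> + 2 * \<gamma>) * ?mod - \<xi> * (1 + \<kappa> - \<gamma>) * ?deep)"
      unfolding \<xi>_def using h0 \<gamma>(3) by (intro W.entropy_bound psi_pos) auto
    with ent have "ereal (h - \<delta>) \<le> ereal (h + 2 * \<gamma> + (\<kappa> + 2 * \<gamma>) * ?mod - \<xi> * (1 + \<kappa> - \<gamma>) * ?deep)"
      by (rule order_trans)
    then have main: "\<xi> * (1 + \<kappa> - \<gamma>) * ?deep \<le> \<delta> + 2 * \<gamma> + (\<kappa> + 2 * \<gamma>) * ?mod" by simp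
    have deep0: "0 \<le> ?deep" by (intro Bochner_Integration.integral_nonneg) (auto simp: W.deep_def)
    have mod0: "0 \<le> ?mod" by (intro Bochner_Integration.integral_nonneg) (auto simp: W.moderate_def)
    have "\<xi>0 * ?deep \<le> \<xi> * (1 + \<kappa> - \<gamma>) * ?deep"
    proof (intro mult_right_mono deep0)
      have "\<xi>0 * 1 \<le> \<xi> * (1 + \<kappa> - \<gamma>)" using \<xi> \<xi>0 \<gamma>(3) by (intro mult_mono) auto
      then show "\<xi>0 \<le> \<xi> * (1 + \<kappa> - \<gamma>)" by simp
    qed
    moreover have "(\<kappa> + 2 * \<gamma>) * ?mod \<le> (\<kappa> + 1) * (A / real J)"
      using \<gamma>(2) mod mod0 \<kappa>_pos by (intro mult_mono) auto
    ultimately have "\<xi>0 * ?deep < 4 * c" using main \<delta>(3) \<gamma>(4) J2 c by linarith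
    then have "\<xi>0 * ?deep < \<xi>0 * (\<epsilon> / 2)" by (simp add: c_def field_simps)
    then have deep: "2 * ?deep < \<epsilon>" using \<xi>0 by simp
    have "ext_set_integral M {x\<in>X. u x < \<eta>} (\<lambda>x. - ext_log (u x)) \<le> ereal (2 * ?deep)"
      unfolding W.deep_def[abs_def]
    proof (rule ext_set_integral_le[OF exponent(1) W.lev_if_integrable[OF W.lev_set] Kbig(2)])
      have "K (Suc j) \<le> K J" using j(1) by (intro Kle) simp
      then show "\<eta> \<le> exp (- real (K (Suc j)))" by (simp add: \<eta>_def)
    qed (simp add: \<eta>_def)
    then show ?thesis using deep by (simp add: order.strict_trans1)
  qed
  then show ?thesis using \<delta>(1) by (intro exI[of _ \<delta>] conjI exI[of _ \<eta>]) (auto simp: \<eta>_def)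
qed

section \<open>Maps of the interval and of the circle\<close>

text \<open>The positive part of the logarithm is subadditive as well, so \<open>fekete\<close>
  applies. If \<open>S n = 0\<close> then \<open>ln 0 = 0\<close> gives the value 0, consistent with
  both claims.\<close>

lemma growth_rate_bounds:
  fixes S :: "nat \<Rightarrow> real"
  assumes S0: "S 0 = 1" and nonneg: "\<And>n. 0 \<le> S n" and sub: "\<And>m n. S (m + n) \<le> S m * S n"
  defines "R \<equiv> lim (\<lambda>n. 1 / real n * max 0 (ln (S n)))"
  shows "0 \<le> R" and "0 < \<gamma> \<Longrightarrow> \<exists>C\<ge>1. \<forall>n. S n \<le> C * exp (real n * (R + \<gamma>))"
proof -
  define a where "a n = max 0 (ln (S n))" for n
  have a0: "a 0 = 0" and an: "0 \<le> a n" for n by (auto simp: a_def S0)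
  have asub: "a (m + n) \<le> a m + a n" for m n
  proof (cases "S (m + n) = 0")
    case True
    then show ?thesis using an[of m] an[of n] by (simp add: a_def)
  next
    case False
    then have "0 < S (m + n)" using nonneg[of "m + n"] by simp
    then have "0 < S m * S n" using sub[of m n] by linarith
    then have p: "0 < S m" "0 < S n" using nonneg[of m] nonneg[of n] by (auto simp: zero_less_mult_iff)
    have "ln (S (m + n)) \<le> ln (S m * S n)" by (rule ln_mono[OF sub \<open>0 < S (m + n)\<close>])
    also have "\<dots> = ln (S m) + ln (S n)" using p by (simp add: ln_mult)
    finally show ?thesis by (auto simp: a_def)
  qed
  note F = fekete[of a, OF asub an a0]
  have R: "R = (INF n\<in>{1..}. a n / real n)"
    unfolding R_def using limI[OF F(1)] by (simp add: a_def)
  have lim: "(\<lambda>n. a n / real n) \<longlonglongrightarrow> R" using F(1) unfolding R .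
  show "0 \<le> R" by (rule LIMSEQ_le_const[OF lim]) (use an in auto)
  show "\<exists>C\<ge>1. \<forall>n. S n \<le> C * exp (real n * (R + \<gamma>))" if \<gamma>: "0 < \<gamma>"
  proof -
    have "eventually (\<lambda>n. a n / real n < R + \<gamma>) sequentially" using \<gamma> by (intro order_tendstoD(2)[OF lim]) simp
    then obtain N where N: "\<And>n. n \<ge> N \<Longrightarrow> a n / real n < R + \<gamma>" by (auto simp: eventually_sequentially)
    define c where "c = (\<Sum>k<Suc N. a k)"
    have c0: "0 \<le> c" unfolding c_def by (intro sum_nonneg an)
    have bound: "a n \<le> c + real n * (R + \<gamma>)" for n
    proof (cases "n < Suc N")
      case True
      have "a n \<le> c" unfolding c_def using True an by (intro member_le_sum) auto
      moreover have "0 \<le> real n * (R + \<gamma>)" using \<open>0 \<le> R\<close> \<gamma> by simp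
      ultimately show ?thesis by linarith
    next
      case False
      then have "a n < real n * (R + \<gamma>)" using N[of n] by (simp add: divide_less_eq mult.commute)
      then show ?thesis using c0 by simp
    qed
    have "S n \<le> exp c * exp (real n * (R + \<gamma>))" for n
    proof (cases "S n = 0")
      case False
      then have "0 < S n" using nonneg[of n] by simp
      then have "S n = exp (ln (S n))" by simp
      also have "\<dots> \<le> exp (c + real n * (R + \<gamma>))" using bound[of n] by (simp add: a_def)
      finally show ?thesis by (simp add: exp_add)
    qed simp
    moreover have "1 \<le> exp c" using c0 by simp
    ultimately show ?thesis by blast
  qed
qed

lemma derivative_growth:
  fixes F dF :: "real \<Rightarrow> real"
  assumes D: "D \<noteq> {}" and F: "\<And>t. t \<in> D \<Longrightarrow> F t \<in> D" and b: "\<And>t. t \<in> D \<Longrightarrow> \<bar>dF t\<bar> \<le> \<Lambda>"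
  defines "R \<equiv> lim (\<lambda>n. 1 / real n * max 0 (ln (SUP t\<in>D. \<bar>\<Prod>i<n. dF ((F ^^ i) t)\<bar>)))"
  shows "0 \<le> R" and "0 < \<gamma> \<Longrightarrow> \<exists>C\<ge>1. \<forall>n. \<forall>t\<in>D. (\<Prod>i<n. \<bar>dF ((F ^^ i) t)\<bar>) \<le> C * exp (real n * (R + \<gamma>))"
proof -
  let ?p = "\<lambda>n t. \<bar>\<Prod>i<n. dF ((F ^^ i) t)\<bar>"
  define S where "S n = (SUP t\<in>D. ?p n t)" for n
  have Fn: "(F ^^ n) t \<in> D" if "t \<in> D" for n t using that by (induction n) (auto intro: F)
  obtain t0 where t0: "t0 \<in> D" using D by auto
  have ple: "?p n t \<le> \<Lambda> ^ n" if "t \<in> D" for n t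
  proof -
    have "(\<Prod>i<n. \<bar>dF ((F ^^ i) t)\<bar>) \<le> (\<Prod>i<n. \<Lambda>)" using b Fn[OF that] by (intro prod_mono) auto
    then show ?thesis by (simp add: abs_prod)
  qed
  have bdd: "bdd_above (?p n ` D)" for n using ple by (intro bdd_aboveI2[where M = "\<Lambda> ^ n"]) auto
  have pS: "?p n t \<le> S n" if "t \<in> D" for n t unfolding S_def using that by (intro cSUP_upper bdd)
  have Sn: "0 \<le> S n" for n using pS[OF t0, of n] by (rule order_trans[OF abs_ge_zero])
  have "S 0 = 1" unfolding S_def using D by simp
  moreover have "S (m + n) \<le> S m * S n" for m n
    unfolding S_def[of "m + n"] using D
  proof (rule cSUP_least)
    fix t assume t: "t \<in> D"
    have "(\<Prod>i<m + n. dF ((F ^^ i) t)) = (\<Prod>i<m. dF ((F ^^ i) t)) * (\<Prod>i<n. dF ((F ^^ i) ((F ^^ m) t)))"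
    proof (induction n)
      case (Suc n)
      have "(F ^^ (m + n)) t = (F ^^ n) ((F ^^ m) t)" by (simp add: add.commute[of m] funpow_add)
      then show ?case using Suc by simp
    qed simp
    then have "?p (m + n) t = ?p m t * ?p n ((F ^^ m) t)" by (simp add: abs_mult)
    also have "\<dots> \<le> S m * S n" using pS[OF t] pS[OF Fn[OF t]] Sn by (intro mult_mono) auto
    finally show "?p (m + n) t \<le> S m * S n" .
  qed
  ultimately have G: "0 \<le> R" "0 < \<gamma> \<Longrightarrow> \<exists>C\<ge>1. \<forall>n. S n \<le> C * exp (real n * (R + \<gamma>))"
    using growth_rate_bounds[of S] Sn unfolding R_def S_def by blast+
  show "0 \<le> R" by (rule G(1))
  show "\<exists>C\<ge>1. \<forall>n. \<forall>t\<in>D. (\<Prod>i<n. \<bar>dF ((F ^^ i) t)\<bar>) \<le> C * exp (real n * (R + \<gamma>))" if \<gamma>: "0 < \<gamma>"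
  proof -
    obtain C where "1 \<le> C" "\<And>n. S n \<le> C * exp (real n * (R + \<gamma>))" using G(2)[OF \<gamma>] by blast
    then show ?thesis using pS unfolding abs_prod by (meson order_trans)
  qed
qed

text \<open>Smoothness enters only through this approximation of the derivative by polynomials of
  bounded degree. The exponent is \<lfloor>r\<rfloor> - 1 from Taylor's formula for the derivative
  plus r - \<lfloor>r\<rfloor> from the Hoelder condition.\<close>

lemma C_r_on_facts:
  assumes C: "C_r_on D r F" and r: "1 < r" and D: "is_interval D"
  shows "t \<in> D \<Longrightarrow> (F has_real_derivative deriv_within D F t) (at t within D)"
    and "continuous_on D (deriv_within D F)"
    and "\<exists>C d. 0 \<le> C \<and> (\<forall>t0\<in>D. \<exists>p. degree p \<le> d \<and>
      (\<forall>t\<in>D. \<bar>deriv_within D F t - poly p t\<bar> \<le> C * \<bar>t - t0\<bar> powr (r - 1)))"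
proof -
  define k where "k = nat \<lfloor>r\<rfloor>"
  have k: "1 \<le> k" "real k = of_int \<lfloor>r\<rfloor>" using r by (auto simp: k_def le_nat_iff le_floor_iff)
  define m where "m = k - 1"
  have km: "k = Suc m" using k by (simp add: m_def)
  let ?G = "\<lambda>i. (deriv_within D ^^ i) F"
  have diff: "?G i differentiable_on D" if "i < k" for i
    using C that by (simp add: C_r_on_def C_k_on_def k_def)
  have der: "(?G i has_real_derivative ?G (Suc i) t) (at t within D)" if "i < k" "t \<in> D" for i t
  proof -
    have "?G i differentiable (at t within D)" using diff[OF that(1)] that(2) by (simp add: differentiable_on_def)
    then show ?thesis
      by (simp add: vector_derivative_works has_real_derivative_iff_has_vector_derivative deriv_within_def)
  qed
  show "(F has_real_derivative deriv_within D F t) (at t within D)" if "t \<in> D"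
    using der[of 0 t] k that by simp
  show "continuous_on D (deriv_within D F)"
  proof (cases "k = 1")
    case True
    then show ?thesis using C by (simp add: C_r_on_def C_k_on_def k_def[symmetric])
  next
    case False
    then have "?G 1 differentiable_on D" using k by (intro diff) simp
    then show ?thesis using differentiable_imp_continuous_on by force
  qed
  obtain C0 where C0: "\<And>x y. x \<in> D \<Longrightarrow> y \<in> D \<Longrightarrow> \<bar>?G k x - ?G k y\<bar> \<le> C0 * \<bar>x - y\<bar> powr (r - of_int \<lfloor>r\<rfloor>)"
    using C unfolding C_r_on_def Hoelder_on_def k_def by blast
  have "\<exists>p. degree p \<le> m \<and> (\<forall>t\<in>D. \<bar>deriv_within D F t - poly p t\<bar> \<le> \<bar>C0\<bar> * \<bar>t - t0\<bar> powr (r - 1))" if t0: "t0 \<in> D" for t0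
  proof -
    have "\<exists>p. degree p \<le> m \<and> (\<forall>t\<in>D. \<bar>?G (Suc 0) t - poly p t\<bar> \<le> \<bar>C0\<bar> * \<bar>t - t0\<bar> powr (real m + (r - of_int \<lfloor>r\<rfloor>)))"
    proof (rule taylor_poly[OF D t0, where G = "\<lambda>i. ?G (Suc i)"])
      show "(?G (Suc i) has_real_derivative ?G (Suc (Suc i)) t) (at t within D)" if "i < m" "t \<in> D" for i t
        using that by (intro der) (simp_all add: km)
      show "\<bar>?G (Suc m) t - ?G (Suc m) t0\<bar> \<le> \<bar>C0\<bar> * \<bar>t - t0\<bar> powr (r - of_int \<lfloor>r\<rfloor>)" if "t \<in> D" for t
      proof -
        have "C0 * \<bar>t - t0\<bar> powr (r - of_int \<lfloor>r\<rfloor>) \<le> \<bar>C0\<bar> * \<bar>t - t0\<bar> powr (r - of_int \<lfloor>r\<rfloor>)" by (intro mult_right_mono) auto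
        then show ?thesis using C0[OF that t0] unfolding km by linarith
      qed
    qed auto
    moreover have "real m + (r - of_int \<lfloor>r\<rfloor>) = r - 1" using k km by simp
    ultimately show ?thesis by simp
  qed
  then show "\<exists>C d. 0 \<le> C \<and> (\<forall>t0\<in>D. \<exists>p. degree p \<le> d \<and>
      (\<forall>t\<in>D. \<bar>deriv_within D F t - poly p t\<bar> \<le> C * \<bar>t - t0\<bar> powr (r - 1)))"
    using abs_ge_zero by blast
qed

lemma interval_lifted_map:
  assumes C: "C_r_interval_map r f" and r: "1 < r"
  shows "\<exists>\<Lambda>. lifted_map {0..1} f {0..1} (\<lambda>t. t) (\<lambda>t. t) f (interval_deriv f) (\<lambda>x. \<bar>interval_deriv f x\<bar>)
    r (deriv_growth_rate {0..1} interval_deriv f) \<Lambda>"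
proof -
  let ?D = "{0..1::real}" and ?dF = "interval_deriv f"
  have fD: "f t \<in> ?D" if "t \<in> ?D" for t using C that by (auto simp: C_r_interval_map_def)
  have int: "is_interval ?D" by simp
  note facts = C_r_on_facts[OF _ r int, of f]
  have CrD: "C_r_on ?D r f" using C by (simp add: C_r_interval_map_def)
  note der = facts(1)[OF CrD] and cont = facts(2)[OF CrD] and tay = facts(3)[OF CrD]
  have "bounded (?dF ` ?D)" using cont by (intro compact_imp_bounded compact_continuous_image) auto
  then obtain b where b: "\<And>t. t \<in> ?D \<Longrightarrow> \<bar>?dF t\<bar> \<le> b" unfolding bounded_iff real_norm_def by blast
  define \<Lambda> where "\<Lambda> = max 1 b"
  have \<Lambda>: "1 \<le> \<Lambda>" "\<And>t. t \<in> ?D \<Longrightarrow> \<bar>?dF t\<bar> \<le> \<Lambda>" using b by (force simp: \<Lambda>_def)+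
  have ident: "interval_deriv (f ^^ n) t = (\<Prod>i<n. ?dF ((f ^^ i) t))" if t: "t \<in> ?D" for n t
  proof -
    have "((f ^^ n) has_real_derivative (\<Prod>i<n. ?dF ((f ^^ i) t))) (at t within ?D)"
      using fD der t by (rule funpow_has_derivative)
    then show ?thesis unfolding deriv_within_def has_real_derivative_iff_has_vector_derivative
      using t by (intro vector_derivative_within_closed_interval) auto
  qed
  have "(SUP x\<in>?D. \<bar>interval_deriv (f ^^ n) x\<bar>) = (SUP t\<in>?D. \<bar>\<Prod>i<n. ?dF ((f ^^ i) t)\<bar>)" for n
    using ident by (intro SUP_cong) auto
  then have R: "deriv_growth_rate ?D interval_deriv f = lim (\<lambda>n. 1 / real n * max 0 (ln (SUP t\<in>?D. \<bar>\<Prod>i<n. ?dF ((f ^^ i) t)\<bar>)))"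
    by (simp add: deriv_growth_rate_def)
  have ne: "?D \<noteq> {}" by simp
  note gr = derivative_growth[of ?D f ?dF \<Lambda>, OF ne fD \<Lambda>(2), folded R]
  have "lifted_map ?D f ?D (\<lambda>t. t) (\<lambda>t. t) f ?dF (\<lambda>x. \<bar>?dF x\<bar>) r (deriv_growth_rate ?D interval_deriv f) \<Lambda>"
  proof unfold_locales
    show "(\<lambda>t. t) \<in> borel_measurable (restrict_space borel ?D)" by (intro measurable_restrict_space1) simp
    show "uniformly_continuous_on ?D ?dF" using cont by (intro compact_uniformly_continuous) auto
    show "\<exists>L. \<forall>s\<in>?D. \<forall>t\<in>?D. dist s t \<le> L * \<bar>s - t\<bar>" by (intro exI[of _ 1]) (simp add: dist_real_def)
    show "\<exists>\<iota>. \<forall>t\<in>?D. \<lfloor>real K * t\<rfloor> = \<iota> \<lfloor>real K * t\<rfloor>" for K by (intro exI[of _ "\<lambda>j. j"]) simp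
  qed (use fD der \<Lambda> tay r gr in \<open>auto simp: dist_real_def\<close>)
  then show ?thesis by blast
qed

text \<open>The argument in units of a full turn, with values in [0,1).\<close>

definition circle_section :: "complex \<Rightarrow> real" where
  "circle_section z = (if 0 \<le> Im z then arccos (Re z) / (2 * pi) else 1 - arccos (Re z) / (2 * pi))"

lemma circle_section:
  assumes z: "z \<in> circle"
  shows "0 \<le> circle_section z" "circle_section z < 1" "cis (2 * pi * circle_section z) = z"
proof -
  have n: "(Re z)\<^sup>2 + (Im z)\<^sup>2 = 1" using z by (simp add: cmod_def)
  have "(Re z)\<^sup>2 \<le> 1" using n zero_le_power2[of "Im z"] by linarith
  then have Re1: "- 1 \<le> Re z" "Re z \<le> 1" by (simp_all add: abs_square_le_1 abs_le_iff)
  define a where "a = arccos (Re z)"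
  have a: "0 \<le> a" "a \<le> pi" "cos a = Re z" using Re1 by (simp_all add: a_def arccos_lbound arccos_ubound)
  have sa: "sin a = \<bar>Im z\<bar>"
  proof -
    have "1 - (Re z)\<^sup>2 = (Im z)\<^sup>2" using n by simp
    then show ?thesis unfolding a_def using Re1 by (simp add: sin_arccos)
  qed
  show "0 \<le> circle_section z" using a unfolding circle_section_def a_def[symmetric] by (auto simp: field_simps)
  show "circle_section z < 1"
  proof (cases "0 \<le> Im z")
    case True
    then show ?thesis using a unfolding circle_section_def a_def[symmetric] by (simp add: field_simps) (use pi_gt_zero in linarith)
  next
    case False
    then have "a \<noteq> 0" using sa by auto
    then have "0 < a / (2 * pi)" using a by simp
    then show ?thesis using False unfolding circle_section_def a_def[symmetric] by simp
  qed
  show "cis (2 * pi * circle_section z) = z"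
  proof (cases "0 \<le> Im z")
    case True
    then have "2 * pi * circle_section z = a" unfolding circle_section_def a_def[symmetric] by simp
    then show ?thesis using a sa True by (simp add: complex_eq_iff)
  next
    case False
    then have "2 * pi * circle_section z = 2 * pi - a" unfolding circle_section_def a_def[symmetric]
      by (simp add: field_simps)
    then show ?thesis using a sa False by (simp add: complex_eq_iff cos_diff sin_diff)
  qed
qed

lemma circle_section_measurable: "circle_section \<in> borel_measurable (restrict_space borel circle)"
proof -
  have "continuous_on circle (\<lambda>z. arccos (Re z))"
  proof (intro continuous_intros ballI)
    fix z :: complex assume "z \<in> circle"
    then have "\<bar>Re z\<bar> \<le> 1" using abs_Re_le_cmod[of z] by simp
    then show "- 1 \<le> Re z \<and> Re z \<le> 1" by (simp add: abs_le_iff)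
  qed
  then have [measurable]: "(\<lambda>z. arccos (Re z)) \<in> borel_measurable (restrict_space borel circle)"
    by (rule borel_measurable_continuous_on_restrict)
  have [measurable]: "Im \<in> borel_measurable (restrict_space borel circle)"
    by (intro measurable_restrict_space1) simp
  show ?thesis unfolding circle_section_def[abs_def] by measurable
qed

lemma dist_cis: "dist (cis a) (cis b) = 2 * \<bar>sin ((a - b) / 2)\<bar>"
proof -
  have "(dist (cis a) (cis b))\<^sup>2 = (cos a - cos b)\<^sup>2 + (sin a - sin b)\<^sup>2"
    by (simp add: dist_norm cmod_power2)
  also have "\<dots> = ((cos a)\<^sup>2 + (sin a)\<^sup>2) + ((cos b)\<^sup>2 + (sin b)\<^sup>2) - 2 * (cos a * cos b + sin a * sin b)"
    by (simp add: power2_eq_square algebra_simps)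
  also have "\<dots> = 2 - 2 * cos (a - b)" by (simp add: cos_diff)
  also have "cos (a - b) = cos (2 * ((a - b) / 2))" by (simp only: times_divide_eq_right nonzero_mult_div_cancel_left[OF numeral_neq_zero])
  also have "2 - 2 * cos (2 * ((a - b) / 2)) = (2 * \<bar>sin ((a - b) / 2)\<bar>)\<^sup>2" by (subst cos_double_sin) (simp add: power_mult_distrib)
  finally show ?thesis by (rule power2_eq_imp_eq) auto
qed

text \<open>The chord is 2 sin x with x = pi |s - t|, and sin x is at least x / 2 for x up to pi /
  4, because cosine is there at least cos (pi / 3) = 1/2.\<close>

lemma dist_cis_near:
  assumes "\<bar>s - t\<bar> \<le> 1/4"
  shows "\<bar>s - t\<bar> \<le> dist (cis (2 * pi * s)) (cis (2 * pi * t))"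
proof -
  define x where "x = pi * \<bar>s - t\<bar>"
  have x: "0 \<le> x" "x \<le> pi / 4" using assms mult_left_mono[OF assms, of pi] by (auto simp: x_def)
  have "x / 2 \<le> sin x"
  proof (cases "x = 0")
    case False
    then have "0 < x" using x by simp
    then obtain z where z: "0 < z" "z < x" "sin x - sin 0 = (x - 0) * cos z"
      using MVT2[of 0 x sin cos] by (auto simp: DERIV_sin)
    have "cos (pi / 3) \<le> cos z" using z x by (intro cos_monotone_0_pi_le) auto
    then have "x * (1/2) \<le> x * cos z" using x by (intro mult_left_mono) (auto simp: cos_60)
    then show ?thesis using z by simp
  qed simp
  moreover have "\<bar>sin ((2 * pi * s - 2 * pi * t) / 2)\<bar> = sin x"
  proof -
    have e: "(2 * pi * s - 2 * pi * t) / 2 = pi * (s - t)" by (simp add: field_simps)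
    have "0 \<le> sin x" using x by (intro sin_ge_zero) auto
    moreover have "pi * (s - t) = x \<or> pi * (s - t) = - x" unfolding x_def by (auto simp: abs_if algebra_simps)
    ultimately show ?thesis unfolding e by auto
  qed
  ultimately have "x \<le> dist (cis (2 * pi * s)) (cis (2 * pi * t))" unfolding dist_cis by simp
  moreover have "1 * \<bar>s - t\<bar> \<le> x" unfolding x_def using pi_gt3 by (intro mult_right_mono) auto
  ultimately show ?thesis by simp
qed

text \<open>The increment over a period is continuous and integer-valued; the constant is the degree
  of the map. It follows that the derivative of a lift is periodic.\<close>

lemma lift_periodic:
  assumes F: "circle_lift f F"
  shows "\<exists>c. \<forall>t. F (t + 1) = F t + c"
proof -
  define H where "H t = F (t + 1) - F t" for t
  have Hint: "\<exists>n::int. H t = of_int n" for t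
  proof -
    have "cis (2 * pi * F (t + 1)) = f (cis (2 * pi * (t + of_int 1)))" using F by (simp add: circle_lift_def)
    also have "\<dots> = f (cis (2 * pi * t))" by (simp only: cis_2pi_add_int)
    also have "\<dots> = cis (2 * pi * F t)" using F by (simp add: circle_lift_def)
    finally show ?thesis using cis_2pi_eq_imp unfolding H_def by force
  qed
  have Fc: "continuous_on UNIV F" using F by (simp add: circle_lift_def)
  have cont: "continuous_on UNIV H"
    unfolding H_def by (intro continuous_on_diff Fc continuous_on_compose2[OF Fc] continuous_intros) auto
  have "H constant_on UNIV"
  proof (rule continuous_discrete_range_constant[OF connected_UNIV cont])
    fix x
    have "1 \<le> norm (H y - H x)" if "H y \<noteq> H x" for y
    proof -
      obtain m n :: int where "H y = of_int m" "H x = of_int n" using Hint by metis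
      moreover from this that have "1 \<le> \<bar>m - n\<bar>" by auto
      then have "(1::real) \<le> of_int \<bar>m - n\<bar>" by linarith
      ultimately show ?thesis by simp
    qed
    then show "\<exists>e>0. \<forall>y. y \<in> UNIV \<and> H y \<noteq> H x \<longrightarrow> e \<le> norm (H y - H x)"
      by (intro exI[of _ 1]) auto
  qed
  then obtain c where "\<And>t. H t = c" unfolding constant_on_def by auto
  then have "F (t + 1) = F t + c" for t unfolding H_def by (metis diff_add_cancel add.commute)
  then show ?thesis by blast
qed

lemma periodic_bounded_uniform:
  fixes g :: "real \<Rightarrow> real"
  assumes c: "continuous_on UNIV g" and p: "\<And>t. g (t + 1) = g t"
  shows "\<exists>b. \<forall>t. \<bar>g t\<bar> \<le> b" and "uniformly_continuous_on UNIV g"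
proof -
  have pn: "g (t + real n) = g t" for n t
  proof (induction n)
    case (Suc n)
    then show ?case using p[of "t + real n"] by (simp add: algebra_simps)
  qed simp
  have pz: "g (t + of_int k) = g t" for k :: int and t
  proof (cases k)
    case (nonneg n)
    then show ?thesis using pn[of t n] by simp
  next
    case (neg n)
    then show ?thesis using pn[of "t + of_int k" "Suc n"] by simp
  qed
  have "bounded (g ` {0..1})" using c
    by (intro compact_imp_bounded compact_continuous_image) (auto intro: continuous_on_subset)
  then obtain b where b: "\<And>t. t \<in> {0..1} \<Longrightarrow> \<bar>g t\<bar> \<le> b" unfolding bounded_iff real_norm_def by blast
  have "\<bar>g t\<bar> \<le> b" for t
  proof -
    have "g t = g (t - of_int \<lfloor>t\<rfloor>)" using pz[of "t - of_int \<lfloor>t\<rfloor>" "\<lfloor>t\<rfloor>"] by simp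
    moreover have "t - of_int \<lfloor>t\<rfloor> \<in> {0..1}" by (simp, linarith)
    ultimately show ?thesis using b by simp
  qed
  then show "\<exists>b. \<forall>t. \<bar>g t\<bar> \<le> b" by blast
  \<comment> \<open>After translating x into [0,1], a point at distance less than 1 from it lies in
    [-1,2].\<close>
  have uc: "uniformly_continuous_on {-1..2} g"
    using c by (intro compact_uniformly_continuous) (auto intro: continuous_on_subset)
  show "uniformly_continuous_on UNIV g"
    unfolding uniformly_continuous_on_def
  proof (intro allI impI)
    fix e :: real assume "0 < e"
    then obtain d where d: "0 < d" "\<And>x y. x \<in> {-1..2} \<Longrightarrow> y \<in> {-1..2} \<Longrightarrow> dist y x < d \<Longrightarrow> dist (g y) (g x) < e"
      using uc unfolding uniformly_continuous_on_def by meson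
    have "dist (g y) (g x) < e" if xy: "dist y x < min d 1" for x y
    proof -
      define k where "k = \<lfloor>x\<rfloor>"
      have gx: "g x = g (x - of_int k)" using pz[of "x - of_int k" k] by simp
      have gy: "g y = g (y - of_int k)" using pz[of "y - of_int k" k] by simp
      have "x - of_int k \<in> {-1..2}" unfolding k_def by (simp, linarith)
      moreover have "y - of_int k \<in> {-1..2}" using xy unfolding k_def dist_real_def by (simp, linarith)
      moreover have "dist (y - of_int k) (x - of_int k) < d" using xy by (simp add: dist_real_def)
      ultimately show ?thesis unfolding gx gy by (rule d(2))
    qed
    then show "\<exists>d>0. \<forall>x\<in>UNIV. \<forall>x'\<in>UNIV. dist x' x < d \<longrightarrow> dist (g x') (g x) < e"
      using d(1) by (intro exI[of _ "min d 1"]) auto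
  qed
qed

lemma circle_lift_funpow:
  assumes F: "circle_lift f F"
  shows "circle_lift (f ^^ n) (F ^^ n)"
proof (induction n)
  case 0
  then show ?case by (simp add: circle_lift_def id_def)
next
  case (Suc n)
  have Fc: "continuous_on UNIV F" and Fnc: "continuous_on UNIV (F ^^ n)" using F Suc by (simp_all add: circle_lift_def)
  have "continuous_on UNIV (\<lambda>t. F ((F ^^ n) t))" by (rule continuous_on_compose2[OF Fc Fnc]) simp
  then show ?case using F Suc by (simp add: circle_lift_def o_def)
qed

lemma circle_lifted_map:
  assumes C: "C_r_circle_map r f" and r: "1 < r"
  shows "\<exists>F dF \<Lambda>. lifted_map circle f UNIV (\<lambda>t. cis (2 * pi * t)) circle_section F dF (\<lambda>x. \<bar>circle_deriv f x\<bar>)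
    r (deriv_growth_rate circle circle_deriv f) \<Lambda>"
proof -
  obtain F where F: "circle_lift f F" and CF: "C_r_on UNIV r F" using C by (auto simp: C_r_circle_map_def)
  define dF where "dF = deriv_within UNIV F"
  let ?\<pi> = "\<lambda>t. cis (2 * pi * t)"
  have int: "is_interval (UNIV :: real set)" by simp
  note facts = C_r_on_facts[OF CF r int, folded dF_def]
  have der: "(F has_real_derivative dF t) (at t)" for t using facts(1)[of t] by simp
  obtain c where c: "\<And>t. F (t + 1) = F t + c" using lift_periodic[OF F] by blast
  have per: "dF (t + 1) = dF t" for t
  proof -
    have "((\<lambda>s. F (s + 1)) has_real_derivative dF (t + 1)) (at t)" using der[of "t + 1"] by (simp add: DERIV_shift)
    moreover have "((\<lambda>s. F (s + 1)) has_real_derivative dF t) (at t)"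
      unfolding c using der[of t] by (auto intro!: derivative_eq_intros)
    ultimately show ?thesis by (rule DERIV_unique)
  qed
  note pb = periodic_bounded_uniform[OF facts(2) per]
  obtain b where b: "\<And>t. \<bar>dF t\<bar> \<le> b" using pb(1) by blast
  define \<Lambda> where "\<Lambda> = max 1 b"
  have \<Lambda>: "1 \<le> \<Lambda>" by (simp add: \<Lambda>_def)
  have dF\<Lambda>: "\<bar>dF t\<bar> \<le> \<Lambda>" for t using b[of t] by (simp add: \<Lambda>_def)
  have surj: "circle = ?\<pi> ` UNIV"
  proof
    show "circle \<subseteq> ?\<pi> ` UNIV"
    proof
      fix z :: complex assume "z \<in> circle"
      then have "z = ?\<pi> (circle_section z)" by (rule circle_section(3)[symmetric])
      then show "z \<in> ?\<pi> ` UNIV" by (rule image_eqI) simp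
    qed
  qed auto
  have ident: "circle_deriv (f ^^ n) (?\<pi> t) = (\<Prod>i<n. dF ((F ^^ i) t))" for n t
  proof (rule circle_deriv_eq[OF circle_lift_funpow[OF F]])
    show "((F ^^ n) has_real_derivative (\<Prod>i<n. dF ((F ^^ i) t))) (at t)"
      using funpow_has_derivative[of UNIV F dF t n] der by simp
  qed
  have "(SUP x\<in>circle. \<bar>circle_deriv (f ^^ n) x\<bar>) = (SUP t\<in>UNIV. \<bar>\<Prod>i<n. dF ((F ^^ i) t)\<bar>)" for n
    unfolding surj image_image ident ..
  then have R: "deriv_growth_rate circle circle_deriv f = lim (\<lambda>n. 1 / real n * max 0 (ln (SUP t\<in>UNIV. \<bar>\<Prod>i<n. dF ((F ^^ i) t)\<bar>)))"
    by (simp add: deriv_growth_rate_def)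
  note gr = derivative_growth[of UNIV F dF \<Lambda>, OF _ _ dF\<Lambda>, folded R]
  have "lifted_map circle f UNIV ?\<pi> circle_section F dF (\<lambda>x. \<bar>circle_deriv f x\<bar>)
    r (deriv_growth_rate circle circle_deriv f) \<Lambda>"
  proof unfold_locales
    show "circle_section \<in> borel_measurable (restrict_space borel circle)" by (rule circle_section_measurable)
    show "\<bar>s - t\<bar> \<le> dist (?\<pi> s) (?\<pi> t)" if "\<bar>s - t\<bar> \<le> 1/4" for s t using that by (rule dist_cis_near)
    show "\<exists>L. \<forall>s\<in>UNIV. \<forall>t\<in>UNIV. dist (?\<pi> s) (?\<pi> t) \<le> L * \<bar>s - t\<bar>"
    proof (intro exI[of _ "2 * pi"] ballI)
      fix s t :: real
      have "(2 * pi * s - 2 * pi * t) / 2 = pi * (s - t)" by (simp add: field_simps)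
      then show "dist (?\<pi> s) (?\<pi> t) \<le> 2 * pi * \<bar>s - t\<bar>"
        unfolding dist_cis using abs_sin_x_le_abs_x[of "pi * (s - t)"] by (simp add: abs_mult)
    qed
    show "\<exists>\<iota>. \<forall>t\<in>UNIV. \<lfloor>real K * circle_section (?\<pi> t)\<rfloor> = \<iota> \<lfloor>real K * t\<rfloor>" for K
    \<comment> \<open>The section of the projection differs from t by an integer, which shifts the
      grid index by a multiple of K.\<close>
    proof (intro exI[of _ "\<lambda>j. j mod int K"] ballI)
      fix t :: real
      let ?s = "circle_section (?\<pi> t)"
      have z: "?\<pi> t \<in> circle" by simp
      obtain n :: int where n: "t = ?s + of_int n"
        using cis_2pi_eq_imp[of t ?s] circle_section(3)[OF z] by metis
      show "\<lfloor>real K * ?s\<rfloor> = \<lfloor>real K * t\<rfloor> mod int K"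
      proof (cases "K = 0")
        case False
        have "real K * t = real K * ?s + of_int (int K * n)" 
          using arg_cong[OF n, of "\<lambda>y. real K * y"] by (simp only: distrib_left of_int_mult of_int_of_nat_eq)
        then have "\<lfloor>real K * t\<rfloor> = \<lfloor>real K * ?s\<rfloor> + int K * n" by (simp only: floor_add_int[symmetric])
        moreover have "0 \<le> \<lfloor>real K * ?s\<rfloor>" "\<lfloor>real K * ?s\<rfloor> < int K"
          using circle_section(1,2)[OF z] False by (auto simp: floor_less_iff)
        ultimately show ?thesis by (simp add: mod_pos_pos_trivial)
      qed simp
    qed
    show "\<exists>C\<ge>1. \<forall>l. \<forall>t\<in>UNIV. (\<Prod>i<l. \<bar>dF ((F ^^ i) t)\<bar>) \<le> C * exp (real l * (deriv_growth_rate circle circle_deriv f + \<gamma>))"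
      if "0 < \<gamma>" for \<gamma> using gr(2)[OF _ _ that] by simp
    show "0 \<le> deriv_growth_rate circle circle_deriv f" using gr(1) by simp
    show "f (?\<pi> t) = ?\<pi> (F t)" for t using F by (simp add: circle_lift_def)
    show "\<bar>circle_deriv f (?\<pi> t)\<bar> = \<bar>dF t\<bar>" for t using ident[of 1 t] by simp
    show "circle_section x \<le> 1" if "x \<in> circle" for x using circle_section(2)[OF that] by simp
  qed (use der \<Lambda> dF\<Lambda> facts(3) r pb(2) circle_section in auto)
  then show ?thesis by blast
qed

theorem corollary1p9:
  fixes r :: real
  assumes "r > 1"
  shows
    "(\<forall>f. C_r_interval_map r f \<longrightarrow>
        topological_entropy {0..1} f > ereal (deriv_growth_rate {0..1} interval_deriv f / r) \<longrightarrow>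
        (\<forall>\<epsilon>>0. \<exists>\<delta>>0. \<exists>\<eta>>0. \<forall>\<mu>. ergodic_measure_on {0..1} f \<mu> \<longrightarrow>
           metric_entropy \<mu> f \<ge> topological_entropy {0..1} f - ereal \<delta> \<longrightarrow>
           ext_set_integral \<mu> {x\<in>{0..1}. \<bar>interval_deriv f x\<bar> < \<eta>}
             (\<lambda>x. - ext_log \<bar>interval_deriv f x\<bar>) < ereal \<epsilon>)) \<and>
     (\<forall>f. C_r_circle_map r f \<longrightarrow>
        topological_entropy circle f > ereal (deriv_growth_rate circle circle_deriv f / r) \<longrightarrow>
        (\<forall>\<epsilon>>0. \<exists>\<delta>>0. \<exists>\<eta>>0. \<forall>\<mu>. ergodic_measure_on circle f \<mu> \<longrightarrow>
           metric_entropy \<mu> f \<ge> topological_entropy circle f - ereal \<delta> \<longrightarrow>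
           ext_set_integral \<mu> {x\<in>circle. \<bar>circle_deriv f x\<bar> < \<eta>}
             (\<lambda>x. - ext_log \<bar>circle_deriv f x\<bar>) < ereal \<epsilon>))"
proof (intro conjI allI impI)
  fix f and \<epsilon> :: real
  assume "C_r_interval_map r f" and h: "ereal (deriv_growth_rate {0..1} interval_deriv f / r) < topological_entropy {0..1} f"
    and \<epsilon>: "0 < \<epsilon>"
  then obtain \<Lambda> where "lifted_map {0..1} f {0..1} (\<lambda>t. t) (\<lambda>t. t) f (interval_deriv f) (\<lambda>x. \<bar>interval_deriv f x\<bar>)
    r (deriv_growth_rate {0..1} interval_deriv f) \<Lambda>" using interval_lifted_map assms by blast
  then interpret lifted_map "{0..1}" f "{0..1}" "\<lambda>t. t" "\<lambda>t. t" f "interval_deriv f" "\<lambda>x. \<bar>interval_deriv f x\<bar>"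
    r "deriv_growth_rate {0..1} interval_deriv f" \<Lambda> .
  show "\<exists>\<delta>>0. \<exists>\<eta>>0. \<forall>\<mu>. ergodic_measure_on {0..1} f \<mu> \<longrightarrow>
     metric_entropy \<mu> f \<ge> topological_entropy {0..1} f - ereal \<delta> \<longrightarrow>
     ext_set_integral \<mu> {x\<in>{0..1}. \<bar>interval_deriv f x\<bar> < \<eta>} (\<lambda>x. - ext_log \<bar>interval_deriv f x\<bar>) < ereal \<epsilon>"
    by (rule uniform_integrability[OF h \<epsilon>])
next
  fix f and \<epsilon> :: real
  assume "C_r_circle_map r f" and h: "ereal (deriv_growth_rate circle circle_deriv f / r) < topological_entropy circle f"
    and \<epsilon>: "0 < \<epsilon>"
  then obtain F dF \<Lambda> where "lifted_map circle f UNIV (\<lambda>t. cis (2 * pi * t)) circle_section F dF (\<lambda>x. \<bar>circle_deriv f x\<bar>)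
    r (deriv_growth_rate circle circle_deriv f) \<Lambda>" using circle_lifted_map assms by blast
  then interpret lifted_map circle f UNIV "\<lambda>t. cis (2 * pi * t)" circle_section F dF "\<lambda>x. \<bar>circle_deriv f x\<bar>"
    r "deriv_growth_rate circle circle_deriv f" \<Lambda> .
  show "\<exists>\<delta>>0. \<exists>\<eta>>0. \<forall>\<mu>. ergodic_measure_on circle f \<mu> \<longrightarrow>
     metric_entropy \<mu> f \<ge> topological_entropy circle f - ereal \<delta> \<longrightarrow>
     ext_set_integral \<mu> {x\<in>circle. \<bar>circle_deriv f x\<bar> < \<eta>} (\<lambda>x. - ext_log \<bar>circle_deriv f x\<bar>) < ereal \<epsilon>"
    by (rule uniform_integrability[OF h \<epsilon>])
qed

end
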